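(* Let $K_0\in\mathfrak g$ satisfy $K_0=K_0^*$ and have kernel $K(x,y)$. For each $t$ write $\exp(-tK_0)=I+S(t)$, where $S(t)\in\mathfrak g$ has kernel $S(x,y;t)$, and define $C_+(x,y;t)$ by $$C_+(x,y;t)=-\Big(\big(e^{-tK_0}|_{(-\infty,y)}\big)^{-1}S(\cdot,y;t)\Big)(x)=-\left(S(x,y;t)+\frac{\big(D_2(S(t)|_{(-\infty,y)})S(\cdot,y;t)\big)(x)}{\det_2\big(e^{-tK_0}|_{(-\infty,y)}\big)}\right)$$ for $x<y$, and $C_+(x,y;t)=0$ for $y<x$. Then the solution $K(\xi,\eta;t)$ of the integro-differential equation $$\dot K(x,y;t)=\int_{-\infty}^xK(x,z;t)K(z,y;t)\,dz-\int_y^\infty K(x,z;t)K(z,y;t)\,dz$$ with initial value $K(x,y;0)=K(x,y)$ is $$\begin{aligned}K(\xi,\eta;t)={}&K(\xi,\eta)+\int_{-\infty}^\infty C_+(\zeta,\xi;t)K(\zeta,\eta)\,d\zeta\\&+\int_\eta^\infty\left(K(\xi,\zeta_2)+\int_{-\infty}^\infty C_+(\zeta_1,\xi;t)K(\zeta_1,\zeta_2)\,d\zeta_1\right)\left(S(\zeta_2,\eta;t)+\int_{-\infty}^\infty S(\zeta_2,\zeta_3;t)C_+(\zeta_3,\eta;t)\,d\zeta_3\right)d\zeta_2.\end{aligned}$$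
   Context: Let $\mathcal H=L^2(\mathbb R)$ (real-valued functions) and let $\mathfrak g$ be the space of Hilbert-Schmidt operators on $\mathcal H$; every $A\in\mathfrak g$ is an integral operator $(A\varphi)(x)=\int_{\mathbb R}A(x,y)\varphi(y)\,dy$ with a unique kernel in $L^2(\mathbb R^2)$. Kernels are elements of $L^2(\mathbb R^2)$, and equalities of kernels are understood accordingly; the dot is the derivative in $t$ and the equation is understood as an evolution equation for the kernel in $L^2(\mathbb R^2)$. $\exp$ is the operator exponential and $I$ is the identity. For $A\in\mathfrak g$ and $y\in\mathbb R$, $A|_{(-\infty,y)}$ is the operator on $L^2(-\infty,y)$ given by $(A|_{(-\infty,y)}\varphi)(x)=\int_{-\infty}^yA(x,z)\varphi(z)\,dz$; $(I+A)|_{(-\infty,y)}$ is the identity on $L^2(-\infty,y)$ plus $A|_{(-\infty,y)}$. For a Hilbert-Schmidt operator $A$, the regularized determinant is $\det_2(I+A)=\det\big((I+A)e^{-A}\big)$ (Fredholm determinant). If $I+A$ is invertible, $D_2(A)=-A(I+A)^{-1}\det_2(I+A)$, so that $(I+A)^{-1}=I+D_2(A)/\det_2(I+A)$. *)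

theory Defs
  imports "HOL-Analysis.Analysis"
begin

text \<open>
  Elements of \<open>L\<^sup>2(M)\<close> are represented by functions and operators on \<open>L\<^sup>2(M)\<close> by maps on functions;
  every equality between elements of \<open>L\<^sup>2(M)\<close> below is almost everywhere.  Values of an operator
  outside \<open>L2_space M\<close> carry no meaning.
\<close>

type_synonym 'a fop = "('a \<Rightarrow> real) \<Rightarrow> 'a \<Rightarrow> real"
type_synonym 'a kernel = "'a \<Rightarrow> 'a \<Rightarrow> real"

definition L2_space :: "'a measure \<Rightarrow> ('a \<Rightarrow> real) set" where
  "L2_space M = {f \<in> borel_measurable M. integrable M (\<lambda>x. (f x)\<^sup>2)}"

definition L2_inner :: "'a measure \<Rightarrow> ('a \<Rightarrow> real) \<Rightarrow> ('a \<Rightarrow> real) \<Rightarrow> real" where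
  "L2_inner M f g = (\<integral>x. f x * g x \<partial>M)"

definition L2_norm :: "'a measure \<Rightarrow> ('a \<Rightarrow> real) \<Rightarrow> real" where
  "L2_norm M f = sqrt (L2_inner M f f)"

definition orthonormal_basis :: "'a measure \<Rightarrow> (nat \<Rightarrow> 'a \<Rightarrow> real) \<Rightarrow> bool" where
  "orthonormal_basis M e \<longleftrightarrow>
     (\<forall>i. e i \<in> L2_space M) \<and>
     (\<forall>i j. L2_inner M (e i) (e j) = (if i = j then 1 else 0)) \<and>
     (\<forall>f\<in>L2_space M. (\<forall>i. L2_inner M (e i) f = 0) \<longrightarrow> (AE x in M. f x = 0))"


subsection \<open>Operators on \<open>L\<^sup>2(M)\<close>\<close>

definition bounded_op :: "'a measure \<Rightarrow> 'a fop \<Rightarrow> bool" where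
  "bounded_op M T \<longleftrightarrow>
     (\<forall>f\<in>L2_space M. T f \<in> L2_space M) \<and>
     (\<forall>f\<in>L2_space M. \<forall>g\<in>L2_space M. \<forall>a b.
        AE x in M. T (\<lambda>u. a * f u + b * g u) x = a * T f x + b * T g x) \<and>
     (\<exists>B. \<forall>f\<in>L2_space M. L2_norm M (T f) \<le> B * L2_norm M f)"

definition self_adjoint_op :: "'a measure \<Rightarrow> 'a fop \<Rightarrow> bool" where
  "self_adjoint_op M T \<longleftrightarrow>
     (\<forall>f\<in>L2_space M. \<forall>g\<in>L2_space M. L2_inner M (T f) g = L2_inner M f (T g))"

definition hilbert_schmidt :: "'a measure \<Rightarrow> 'a fop \<Rightarrow> bool" where
  "hilbert_schmidt M T \<longleftrightarrow>
     bounded_op M T \<and> (\<exists>e. orthonormal_basis M e \<and> summable (\<lambda>i. (L2_norm M (T (e i)))\<^sup>2))"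

definition is_inverse_op :: "'a measure \<Rightarrow> 'a fop \<Rightarrow> 'a fop \<Rightarrow> bool" where
  "is_inverse_op M T R \<longleftrightarrow>
     bounded_op M R \<and>
     (\<forall>f\<in>L2_space M. (AE x in M. T (R f) x = f x) \<and> (AE x in M. R (T f) x = f x))"

definition invertible_op :: "'a measure \<Rightarrow> 'a fop \<Rightarrow> bool" where
  "invertible_op M T \<longleftrightarrow> (\<exists>R. is_inverse_op M T R)"

text \<open>Inverse and exponential are unique only up to null sets, hence a choice of representative.\<close>

definition inverse_op :: "'a measure \<Rightarrow> 'a fop \<Rightarrow> 'a fop" where
  "inverse_op M T = (SOME R. is_inverse_op M T R)"

text \<open>\<open>E = \<Sum>n. T\<^sup>n / n!\<close>, with convergence in operator norm; \<open>\<epsilon> N\<close> bounds the norm of the remainder.\<close>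

definition is_exp_op :: "'a measure \<Rightarrow> 'a fop \<Rightarrow> 'a fop \<Rightarrow> bool" where
  "is_exp_op M T E \<longleftrightarrow>
     bounded_op M E \<and>
     (\<exists>\<epsilon>. \<epsilon> \<longlonglongrightarrow> 0 \<and>
        (\<forall>N. \<forall>f\<in>L2_space M.
           L2_norm M (\<lambda>x. E f x - (\<Sum>n<N. (T ^^ n) f x / fact n)) \<le> \<epsilon> N * L2_norm M f))"

definition exp_op :: "'a measure \<Rightarrow> 'a fop \<Rightarrow> 'a fop" where
  "exp_op M T = (SOME E. is_exp_op M T E)"


subsection \<open>Integral operators\<close>

definition L2_kernel :: "'a measure \<Rightarrow> 'a kernel \<Rightarrow> bool" where
  "L2_kernel M A \<longleftrightarrow> (\<lambda>(x, y). A x y) \<in> L2_space (M \<Otimes>\<^sub>M M)"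

definition integral_op :: "'a measure \<Rightarrow> 'a kernel \<Rightarrow> 'a fop" where
  "integral_op M A f x = (\<integral>y. A x y * f y \<partial>M)"

definition has_kernel :: "'a measure \<Rightarrow> 'a fop \<Rightarrow> 'a kernel \<Rightarrow> bool" where
  "has_kernel M T A \<longleftrightarrow>
     L2_kernel M A \<and> (\<forall>f\<in>L2_space M. AE x in M. T f x = integral_op M A f x)"

text \<open>The measure space of \<open>L\<^sup>2(-\<infinity>, y)\<close>; for an operator \<open>A\<close> on \<open>L\<^sup>2(\<real>)\<close> with kernel \<open>A(x, z)\<close>, the
  restriction of \<open>A\<close> to \<open>(-\<infinity>, y)\<close> is \<open>integral_op (below y) A\<close>.\<close>

definition below :: "real \<Rightarrow> real measure" where
  "below y = restrict_space lborel {..<y}"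

definition id_plus :: "'a fop \<Rightarrow> 'a fop" where
  "id_plus A f x = f x + A f x"


subsection \<open>Determinants\<close>

text \<open>
  Fredholm determinant of \<open>I + T\<close> for trace class \<open>T\<close>: the sum over \<open>k\<close> of the traces of the exterior
  powers \<open>\<Lambda>\<^sup>k T\<close>.  In an orthonormal basis the trace of \<open>\<Lambda>\<^sup>k T\<close> is the sum of the principal minors of
  size \<open>k\<close>, so this is the (absolutely convergent) sum of all finite principal minors; it does not
  depend on the basis.
\<close>

definition principal_minor :: "(nat \<Rightarrow> nat \<Rightarrow> real) \<Rightarrow> nat set \<Rightarrow> real" where
  "principal_minor a J = (\<Sum>p | p permutes J. of_int (sign p) * (\<Prod>i\<in>J. a i (p i)))"

definition fredholm_det :: "'a measure \<Rightarrow> 'a fop \<Rightarrow> real" where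
  "fredholm_det M T =
     (let e = (SOME e. orthonormal_basis M e)
      in \<Sum>\<^sub>\<infinity>J\<in>{J. finite J}. principal_minor (\<lambda>i j. L2_inner M (e i) (T (e j))) J)"

text \<open>\<open>det2 M A\<close> is \<open>det\<^sub>2(I + A) = det((I + A) e\<^bsup>-A\<^esup>)\<close>.  As \<open>fredholm_det M T\<close> is \<open>det(I + T)\<close>, the
  identity is subtracted.\<close>

definition det2 :: "'a measure \<Rightarrow> 'a fop \<Rightarrow> real" where
  "det2 M A = fredholm_det M (\<lambda>f x. id_plus A (exp_op M (\<lambda>g u. - A g u) f) x - f x)"

definition D2 :: "'a measure \<Rightarrow> 'a fop \<Rightarrow> 'a fop" where
  "D2 M A f x = - A (inverse_op M (id_plus A) f) x * det2 M A"


subsection \<open>The flow and its solution formula\<close>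

text \<open>\<open>e\<^bsup>-tK\<^sub>0\<^esup> - I\<close>, whose kernel is called \<open>S(x, y; t)\<close>.\<close>

definition S_op :: "real fop \<Rightarrow> real \<Rightarrow> real fop" where
  "S_op K0 t f x = exp_op lborel (\<lambda>g u. - t * K0 g u) f x - f x"

text \<open>The condition for \<open>x < y\<close> is stated for almost every \<open>y\<close> as an identity in
  \<open>L\<^sup>2(-\<infinity>, y)\<close>, since the inverse is applied separately for each \<open>y\<close>.\<close>

definition is_C_plus :: "real kernel \<Rightarrow> real kernel \<Rightarrow> bool" where
  "is_C_plus S C \<longleftrightarrow>
     L2_kernel lborel C \<and>
     (AE y in lborel. AE x in below y.
        C x y = - inverse_op (below y) (id_plus (integral_op (below y) S)) (\<lambda>u. S u y) x) \<and>
     (AE (x, y) in lborel \<Otimes>\<^sub>M lborel. y < x \<longrightarrow> C x y = 0)"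

definition flow_rhs :: "real kernel \<Rightarrow> real kernel" where
  "flow_rhs A x y =
     (LINT z:{..x}|lborel. A x z * A z y) - (LINT z:{y..}|lborel. A x z * A z y)"

text \<open>Solutions on a time set \<open>J\<close>, the time derivative being taken in \<open>L\<^sup>2(\<real>\<^sup>2)\<close>.\<close>

definition solves_flow :: "real set \<Rightarrow> real kernel \<Rightarrow> (real \<Rightarrow> real kernel) \<Rightarrow> bool" where
  "solves_flow J K L \<longleftrightarrow>
     (\<forall>t\<in>J. L2_kernel lborel (L t)) \<and>
     (AE (x, y) in lborel \<Otimes>\<^sub>M lborel. L 0 x y = K x y) \<and>
     (\<forall>t\<in>J. ((\<lambda>s. L2_norm (lborel \<Otimes>\<^sub>M lborel)
                   (\<lambda>(x, y). (L s x y - L t x y) / (s - t) - flow_rhs (L t) x y))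
              \<longlongrightarrow> 0) (at t within J))"

definition solution_formula :: "real kernel \<Rightarrow> real kernel \<Rightarrow> real kernel \<Rightarrow> real kernel" where
  "solution_formula K S C \<xi> \<eta> =
     K \<xi> \<eta> + (LINT \<zeta>|lborel. C \<zeta> \<xi> * K \<zeta> \<eta>) +
     (LINT \<zeta>2:{\<eta>..}|lborel.
        (K \<xi> \<zeta>2 + (LINT \<zeta>1|lborel. C \<zeta>1 \<xi> * K \<zeta>1 \<zeta>2)) *
        (S \<zeta>2 \<eta> + (LINT \<zeta>3|lborel. S \<zeta>2 \<zeta>3 * C \<zeta>3 \<eta>)))"

end

theory Submission
  imports Defs
begin

text \<open>
  The kernel \<open>C\<^sub>+\<close> is the upper triangular kernel for which \<open>e\<^bsup>-tK\<^sub>0\<^esup> (1 + C\<^sub>+) = 1 + L\<close> is lower triangular; it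
  exists because truncation preserves the coercivity of the positive operator \<open>e\<^bsup>-tK\<^sub>0\<^esup>\<close>.  By
  self-adjointness \<open>1 + L\<close> is the inverse of \<open>1 + C\<^sub>+\<^sup>*\<close>, so the solution formula is the conjugate
  \<open>(1 + C\<^sub>+\<^sup>*) K (1 + L)\<close> of \<open>K\<close>.  Differentiating the factorization gives the Lax equation
  \<open>K' = [K\<^sub>-, K]\<close> with the lower triangular part \<open>K\<^sub>-\<close>, which is the integro-differential equation; its
  right-hand side is quadratic, hence locally Lipschitz, in \<open>L\<^sup>2(\<real>\<^sup>2)\<close>, and solutions are unique.

  The determinant does not vanish because \<open>(1 + A) e\<^bsup>-A\<^esup> = 1 - p\<close> with \<open>p\<close> positive, of trace class and bounded
  away from \<open>1\<close>: Schur complements bound the principal minors of \<open>p\<close> by the products of the diagonal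
  entries and those of \<open>1 - p\<close> from below by a convergent product.
\<close>

section \<open>Square-integrable functions\<close>

text \<open>Scalars plus Hilbert-Schmidt operators form one Banach algebra, the unitization of the
  algebra of kernel classes. A function f is stored as the kernel f(x) 1_[0,1](v), so that half-line
  operators become left multiplication by kernels cut to a square. The obstacle: C_+ is prescribed
  column by column, through an inverse on L2(-inf, y) that changes with y; this shows neither a
  jointly measurable kernel nor any regularity in t. As column y lives on (-inf, y), all these
  conditions together are the single equation C + up (S C) = - up S, where \<open>up\<close> keeps
  the part x < y. Its left side is a compression of left multiplication by the exponential with an
  orthogonal projection of the kernel space, hence invertible with an explicit bound; continuity and
  differentiability in t follow from that bound. Inverse, exponential and the basis in the
  determinant are picked by choice, so existence must be shown for each, and uniqueness where the
  choice must not matter. An orthonormal basis of L2(R) comes with the hypothesis that K0 is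
  Hilbert-Schmidt and is transported to half-lines by a change of variables.\<close>

lemma L2_spaceD [dest]:
  assumes "f \<in> L2_space M"
  shows "f \<in> borel_measurable M" "integrable M (\<lambda>x. (f x)\<^sup>2)"
  using assms by (auto simp: L2_space_def)

lemma L2_mult_integrable:
  assumes "f \<in> L2_space M" "g \<in> L2_space M"
  shows "integrable M (\<lambda>x. f x * g x)"
proof (rule Bochner_Integration.integrable_bound)
  show "integrable M (\<lambda>x. (f x)\<^sup>2 + (g x)\<^sup>2)"
    using assms by (auto simp: L2_space_def)
  have "norm (f x * g x) \<le> norm ((f x)\<^sup>2 + (g x)\<^sup>2)" for x
  proof -
    have "2 * (\<bar>f x\<bar> * \<bar>g x\<bar>) \<le> (f x)\<^sup>2 + (g x)\<^sup>2"
      using sum_squares_bound[of "\<bar>f x\<bar>" "\<bar>g x\<bar>"] by (simp add: mult.assoc)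
    moreover have "0 \<le> \<bar>f x\<bar> * \<bar>g x\<bar>" by simp
    ultimately have "\<bar>f x\<bar> * \<bar>g x\<bar> \<le> (f x)\<^sup>2 + (g x)\<^sup>2" by linarith
    then show ?thesis by (simp add: abs_mult)
  qed
  then show "AE x in M. norm (f x * g x) \<le> norm ((f x)\<^sup>2 + (g x)\<^sup>2)"
    by simp
qed (use assms in \<open>auto simp: L2_space_def\<close>)

lemma L2_space_add:
  assumes "f \<in> L2_space M" "g \<in> L2_space M"
  shows "(\<lambda>x. f x + g x) \<in> L2_space M"
  using assms L2_mult_integrable[OF assms]
  by (auto simp: L2_space_def power2_sum mult.assoc)

lemma L2_space_scale: "f \<in> L2_space M \<Longrightarrow> (\<lambda>x. a * f x) \<in> L2_space M"
  by (auto simp: L2_space_def power_mult_distrib)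

lemma L2_space_lincomb:
  "f \<in> L2_space M \<Longrightarrow> g \<in> L2_space M \<Longrightarrow> (\<lambda>x. a * f x + b * g x) \<in> L2_space M"
  by (intro L2_space_add L2_space_scale)

lemma L2_space_uminus: "f \<in> L2_space M \<Longrightarrow> (\<lambda>x. - f x) \<in> L2_space M"
  using L2_space_scale[of f M "-1"] by simp

lemma L2_space_diff:
  "f \<in> L2_space M \<Longrightarrow> g \<in> L2_space M \<Longrightarrow> (\<lambda>x. f x - g x) \<in> L2_space M"
  using L2_space_lincomb[of f M g 1 "-1"] by simp

lemma L2_space_zero: "(\<lambda>x. 0) \<in> L2_space M"
  by (auto simp: L2_space_def)

lemma L2_space_indicator_mult:
  assumes "f \<in> L2_space M" "X \<in> sets M"
  shows "(\<lambda>x. indicator X x * f x) \<in> L2_space M"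
proof -
  have "integrable M (\<lambda>x. indicator X x *\<^sub>R (f x)\<^sup>2)"
    using assms by (intro integrable_mult_indicator) auto
  moreover have "(indicator X x * f x)\<^sup>2 = indicator X x *\<^sub>R (f x)\<^sup>2" for x
    by (auto simp: indicator_def)
  ultimately show ?thesis
    using assms by (auto simp: L2_space_def)
qed

lemma L2_space_iff_nn_integral:
  "f \<in> L2_space M \<longleftrightarrow> f \<in> borel_measurable M \<and> (\<integral>\<^sup>+x. ennreal ((f x)\<^sup>2) \<partial>M) < \<infinity>"
  by (auto simp: L2_space_def integrable_iff_bounded)

lemma L2_inner_self_nonneg: "0 \<le> L2_inner M f f"
  by (simp add: L2_inner_def)

lemma L2_inner_self_eq_0_iff:
  "f \<in> L2_space M \<Longrightarrow> L2_inner M f f = 0 \<longleftrightarrow> (AE x in M. f x = 0)"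
  using integral_nonneg_eq_0_iff_AE[of M "\<lambda>x. (f x)\<^sup>2"]
  by (auto simp: L2_inner_def L2_space_def power2_eq_square)

abbreviation lborel2 :: "(real \<times> real) measure" where
  "lborel2 \<equiv> lborel \<Otimes>\<^sub>M lborel"

subsection \<open>The Hilbert space of Hilbert-Schmidt kernels\<close>

\<comment> \<open>Almost everywhere equality becomes equality, so that kernels can carry type class
  instances and the general theory of Hilbert spaces and Banach algebras applies. The quotient is
  partial because only square-integrable functions have a class.\<close>
quotient_type hs = "real \<times> real \<Rightarrow> real" / partial:
  "\<lambda>f g. f \<in> L2_space lborel2 \<and> g \<in> L2_space lborel2 \<and> (AE p in lborel2. f p = g p)"
  morphisms rep_hs abs_hs
proof (rule part_equivpI)
  show "\<exists>x. x \<in> L2_space lborel2 \<and> x \<in> L2_space lborel2 \<and> (AE p in lborel2. x p = x p)"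
    using L2_space_zero by auto
qed (auto intro!: sympI transpI)

lemma hs_cases: obtains f where "f \<in> L2_space lborel2" "x = abs_hs f"
  using Quotient3_abs_rep[OF Quotient3_hs, of x] Quotient3_rep_reflp[OF Quotient3_hs, of x]
  by metis

lemma abs_hs_eq_iff:
  "f \<in> L2_space lborel2 \<Longrightarrow> g \<in> L2_space lborel2 \<Longrightarrow>
    abs_hs f = abs_hs g \<longleftrightarrow> (AE p in lborel2. f p = g p)"
  using Quotient3_rel[OF Quotient3_hs, of f g] by auto

lemmas L2_space_closure = L2_space_add L2_space_diff L2_space_scale L2_space_uminus L2_space_zero

instantiation hs :: real_vector
begin

lift_definition zero_hs :: hs is "\<lambda>_. 0"
  by (auto simp: L2_space_zero)

lift_definition plus_hs :: "hs \<Rightarrow> hs \<Rightarrow> hs" is "\<lambda>f g p. f p + g p"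
  by (auto intro: L2_space_add)

lift_definition uminus_hs :: "hs \<Rightarrow> hs" is "\<lambda>f p. - f p"
  by (auto intro: L2_space_uminus)

lift_definition minus_hs :: "hs \<Rightarrow> hs \<Rightarrow> hs" is "\<lambda>f g p. f p - g p"
  by (auto intro: L2_space_diff)

lift_definition scaleR_hs :: "real \<Rightarrow> hs \<Rightarrow> hs" is "\<lambda>a f p. a * f p"
  by (auto intro: L2_space_scale)

lemma abs_hs_simps:
  "0 = abs_hs (\<lambda>_. 0)"
  "f \<in> L2_space lborel2 \<Longrightarrow> g \<in> L2_space lborel2 \<Longrightarrow> abs_hs f + abs_hs g = abs_hs (\<lambda>p. f p + g p)"
  "f \<in> L2_space lborel2 \<Longrightarrow> g \<in> L2_space lborel2 \<Longrightarrow> abs_hs f - abs_hs g = abs_hs (\<lambda>p. f p - g p)"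
  "f \<in> L2_space lborel2 \<Longrightarrow> - abs_hs f = abs_hs (\<lambda>p. - f p)"
  "f \<in> L2_space lborel2 \<Longrightarrow> a *\<^sub>R abs_hs f = abs_hs (\<lambda>p. a * f p)"
  by (simp_all add: zero_hs_def plus_hs.abs_eq minus_hs.abs_eq uminus_hs.abs_eq scaleR_hs.abs_eq)

instance
proof
  fix x y z :: hs and a b :: real
  obtain f where f: "f \<in> L2_space lborel2" "x = abs_hs f" by (rule hs_cases)
  obtain g where g: "g \<in> L2_space lborel2" "y = abs_hs g" by (rule hs_cases)
  obtain h where h: "h \<in> L2_space lborel2" "z = abs_hs h" by (rule hs_cases)
  show "x + y + z = x + (y + z)" "x + y = y + x" "0 + x = x" "- x + x = 0" "x - y = x + - y"
    "a *\<^sub>R (x + y) = a *\<^sub>R x + a *\<^sub>R y" "(a + b) *\<^sub>R x = a *\<^sub>R x + b *\<^sub>R x" "a *\<^sub>R b *\<^sub>R x = (a * b) *\<^sub>R x"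
    "1 *\<^sub>R x = x"
    by (simp_all add: f g h abs_hs_simps L2_space_closure algebra_simps)
qed

end

instantiation hs :: real_inner
begin

lift_definition inner_hs :: "hs \<Rightarrow> hs \<Rightarrow> real" is "L2_inner lborel2"
  unfolding L2_inner_def by (intro integral_cong_AE) (auto simp: L2_space_def)

definition "norm_hs (x::hs) = sqrt (inner x x)"
definition "sgn_hs (x::hs) = x /\<^sub>R norm x"
definition "dist_hs (x::hs) y = norm (x - y)"
definition "uniformity_hs = (INF e\<in>{0<..}. principal {(x::hs, y). dist x y < e})"
definition "open_hs (U :: hs set) = (\<forall>x\<in>U. eventually (\<lambda>(x', y). x' = x \<longrightarrow> y \<in> U) uniformity)"

lemma inner_abs_hs:
  "f \<in> L2_space lborel2 \<Longrightarrow> g \<in> L2_space lborel2 \<Longrightarrow> abs_hs f \<bullet> abs_hs g = L2_inner lborel2 f g"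
  by (simp add: inner_hs.abs_eq)

instance
proof
  fix x y z :: hs and a b :: real
  obtain f where f: "f \<in> L2_space lborel2" "x = abs_hs f" by (rule hs_cases)
  obtain g where g: "g \<in> L2_space lborel2" "y = abs_hs g" by (rule hs_cases)
  obtain h where h: "h \<in> L2_space lborel2" "z = abs_hs h" by (rule hs_cases)
  show "x \<bullet> y = y \<bullet> x"
    by (simp add: f g inner_abs_hs L2_inner_def mult.commute)
  have i: "integrable lborel2 (\<lambda>p. f p * h p)" "integrable lborel2 (\<lambda>p. g p * h p)"
    using f g h by (auto intro: L2_mult_integrable)
  show "(x + y) \<bullet> z = x \<bullet> z + y \<bullet> z"
    using i by (simp add: f g h L2_space_closure inner_abs_hs abs_hs_simps L2_inner_def algebra_simps)
  show "a *\<^sub>R x \<bullet> y = a * (x \<bullet> y)"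
    by (simp add: f g h L2_space_closure inner_abs_hs abs_hs_simps L2_inner_def algebra_simps)
  show "0 \<le> x \<bullet> x"
    by (simp add: f inner_abs_hs L2_inner_self_nonneg)
  show "x \<bullet> x = 0 \<longleftrightarrow> x = 0"
    using L2_inner_self_eq_0_iff[OF f(1)] abs_hs_eq_iff[OF f(1) L2_space_zero]
    by (simp add: f inner_abs_hs abs_hs_simps)
qed (simp_all add: norm_hs_def sgn_hs_def dist_hs_def uniformity_hs_def open_hs_def)

end

lemma norm_abs_hs: "f \<in> L2_space lborel2 \<Longrightarrow> norm (abs_hs f) = L2_norm lborel2 f"
  by (simp add: norm_hs_def inner_abs_hs L2_norm_def)

lemma norm_abs_hs_sq:
  assumes "f \<in> L2_space lborel2"
  shows "ennreal ((norm (abs_hs f))\<^sup>2) = (\<integral>\<^sup>+p. ennreal ((f p)\<^sup>2) \<partial>lborel2)"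
proof -
  have "(norm (abs_hs f))\<^sup>2 = (\<integral>p. (f p)\<^sup>2 \<partial>lborel2)"
    using assms by (simp add: norm_abs_hs L2_norm_def L2_inner_self_nonneg)
      (simp add: L2_inner_def power2_eq_square)
  then show ?thesis
    using assms nn_integral_eq_integral[of lborel2 "\<lambda>p. (f p)\<^sup>2"] by (auto simp: L2_space_def)
qed

text \<open>Riesz-Fischer: a subsequence with geometrically small increments converges almost
  everywhere, and Fatou's lemma turns this into convergence in norm.\<close>

instance hs :: complete_space
proof
  fix X :: "nat \<Rightarrow> hs"
  assume X: "Cauchy X"
  have "\<exists>f. f \<in> L2_space lborel2 \<and> X n = abs_hs f" for n
    using hs_cases by metis
  then obtain F where F: "\<And>n. F n \<in> L2_space lborel2" "\<And>n. X n = abs_hs (F n)"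
    by metis
  have [measurable]: "F n \<in> borel_measurable lborel2" for n
    using F by auto
  have "\<exists>N. \<forall>m\<ge>N. \<forall>n\<ge>N. dist (X m) (X n) < (1/2)^k" for k :: nat
    using X unfolding Cauchy_def by (auto simp: ge_iff_diff_ge_0)
  then obtain N where N: "\<And>k m n. m \<ge> N k \<Longrightarrow> n \<ge> N k \<Longrightarrow> dist (X m) (X n) < (1/2)^k"
    by metis
  \<comment> \<open>Monotone in \<open>k\<close> and above every \<open>N k\<close>, so consecutive
    terms of the subsequence are within (1/2)^k. The summand \<open>k\<close> gives
    \<open>r j \<ge> j\<close>, which is needed when Fatou's lemma is applied.\<close>
  define r where "r k = k + Max (N ` {..k})" for k
  have rN: "r k \<ge> N k" and rk: "r k \<ge> k" for k
    by (auto simp: r_def trans_le_add2)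
  have rmono: "r k \<le> r (Suc k)" for k
    by (auto simp: r_def intro!: le_SucI Max_ge)
  have bnd: "dist (X (r (Suc k))) (X (r k)) \<le> (1/2)^k" for k
    using N[of k "r (Suc k)" "r k"] rN[of k] rmono[of k] by auto
  define d where "d k p = F (r (Suc k)) p - F (r k) p" for k p
  have d_L2: "d k \<in> L2_space lborel2" for k
    unfolding d_def by (intro L2_space_diff F)
  have [measurable]: "d k \<in> borel_measurable lborel2" for k
    unfolding d_def by measurable
  have d_bnd: "(\<integral>\<^sup>+p. ennreal ((d k p)\<^sup>2) \<partial>lborel2) \<le> ennreal ((1/4)^k)" for k
  proof -
    have "(\<integral>\<^sup>+p. ennreal ((d k p)\<^sup>2) \<partial>lborel2) = ennreal ((dist (X (r (Suc k))) (X (r k)))\<^sup>2)"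
      using norm_abs_hs_sq[OF d_L2[of k]] unfolding d_def dist_norm F(2) by (simp add: abs_hs_simps F(1))
    also have "\<dots> \<le> ennreal (((1/2)^k)\<^sup>2)"
      using bnd[of k] by (intro ennreal_leI power_mono) auto
    also have "((1/2::real)^k)\<^sup>2 = (1/4)^k"
      by (simp add: power_divide power2_eq_square flip: power_mult_distrib)
    finally show ?thesis .
  qed
  \<comment> \<open>The weight 2^k splits the bound 4^(-k): the weighted sum still has a finite
    integral, hence is finite almost everywhere, and this gives |d k p| \<le> sqrt C * 2^(-k/2),
    which is summable.\<close>
  have "(\<integral>\<^sup>+p. (\<Sum>k. ennreal (2^k * (d k p)\<^sup>2)) \<partial>lborel2) = (\<Sum>k. \<integral>\<^sup>+p. ennreal (2^k * (d k p)\<^sup>2) \<partial>lborel2)"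
    by (rule nn_integral_suminf) measurable
  also have "\<dots> = (\<Sum>k. ennreal (2^k) * (\<integral>\<^sup>+p. ennreal ((d k p)\<^sup>2) \<partial>lborel2))"
    by (intro suminf_cong) (simp add: ennreal_mult nn_integral_cmult)
  also have "\<dots> \<le> (\<Sum>k. ennreal (2^k) * ennreal ((1/4)^k))"
    by (intro suminf_le mult_left_mono d_bnd) auto
  also have "\<dots> = (\<Sum>k. ennreal ((1/2)^k))"
    by (intro suminf_cong) (simp add: power_divide field_simps flip: ennreal_mult power_mult_distrib)
  also have "\<dots> = ennreal (\<Sum>k. (1/2)^k)"
    by (intro suminf_ennreal2 summable_geometric) auto
  also have "\<dots> < \<infinity>" by simp
  finally have "AE p in lborel2. (\<Sum>k. ennreal (2^k * (d k p)\<^sup>2)) \<noteq> \<infinity>"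
    by (intro nn_integral_PInf_AE) auto
  then have conv: "AE p in lborel2. convergent (\<lambda>k. F (r k) p)"
  proof eventually_elim
    fix p assume fin: "(\<Sum>k. ennreal (2^k * (d k p)\<^sup>2)) \<noteq> \<infinity>"
    have sm: "summable (\<lambda>k. 2^k * (d k p)\<^sup>2)"
      using fin by (intro summable_suminf_not_top) auto
    define C where "C = (\<Sum>k. 2^k * (d k p)\<^sup>2)"
    have C: "2^k * (d k p)\<^sup>2 \<le> C" for k
      using sum_le_suminf[OF sm, of "{k}"] by (auto simp: C_def)
    have dC: "\<bar>d k p\<bar> \<le> sqrt C * (sqrt (1/2))^k" for k
    proof -
      have "(d k p)\<^sup>2 \<le> C * (1/2)^k"
        using C[of k] by (simp add: field_simps)
      then have "sqrt ((d k p)\<^sup>2) \<le> sqrt (C * (1/2)^k)"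
        by (rule real_sqrt_le_mono)
      then have "\<bar>d k p\<bar> \<le> sqrt C * sqrt ((1/2)^k)"
        by (simp only: real_sqrt_abs real_sqrt_mult)
      also have "sqrt ((1/2)^k) = (sqrt (1/2))^k"
        by (rule real_sqrt_power)
      finally show ?thesis .
    qed
    have "summable (\<lambda>k. sqrt C * (sqrt (1/2))^k)"
      by (intro summable_mult summable_geometric) simp
    then have "summable (\<lambda>k. d k p)"
      by (rule summable_comparison_test'[where N = 0]) (simp add: dC)
    then have "convergent (\<lambda>n. \<Sum>k<n. d k p)"
      by (simp add: summable_iff_convergent)
    then have "convergent (\<lambda>n. (\<Sum>k<n. d k p) + F (r 0) p)"
      by (intro convergent_add convergent_const)
    moreover have "(\<Sum>k<n. d k p) + F (r 0) p = F (r n) p" for n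
      unfolding d_def by (simp add: sum_lessThan_telescope[of "\<lambda>k. F (r k) p"])
    ultimately show "convergent (\<lambda>k. F (r k) p)" by simp
  qed
  define L where "L p = lim (\<lambda>k. F (r k) p)" for p
  have [measurable]: "L \<in> borel_measurable lborel2"
    unfolding L_def by (intro borel_measurable_lim_metric) measurable
  have lim: "AE p in lborel2. (\<lambda>k. F (r k) p) \<longlonglongrightarrow> L p"
    using conv unfolding L_def by (simp add: convergent_LIMSEQ_iff)
  \<comment> \<open>Fatou along the subsequence, with \<open>m\<close> an index of the full
    sequence: this yields both that \<open>L\<close> is square-integrable and that the whole
    sequence converges to it.\<close>
  have close: "(\<integral>\<^sup>+p. ennreal ((F m p - L p)\<^sup>2) \<partial>lborel2) \<le> ennreal (((1/2)^k)\<^sup>2)" if m: "m \<ge> N k" for m k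
  proof -
    have "(\<integral>\<^sup>+p. ennreal ((F m p - L p)\<^sup>2) \<partial>lborel2)
        = (\<integral>\<^sup>+p. liminf (\<lambda>j. ennreal ((F m p - F (r j) p)\<^sup>2)) \<partial>lborel2)"
      using lim by (intro nn_integral_cong_AE, eventually_elim)
        (intro lim_imp_Liminf[symmetric] tendsto_intros; simp)
    also have "\<dots> \<le> liminf (\<lambda>j. \<integral>\<^sup>+p. ennreal ((F m p - F (r j) p)\<^sup>2) \<partial>lborel2)"
      by (intro nn_integral_liminf) measurable
    also have "\<dots> \<le> liminf (\<lambda>j. ennreal (((1/2)^k)\<^sup>2))"
    proof (intro Liminf_mono eventually_sequentiallyI)
      fix j assume "j \<ge> N k"
      then have "r j \<ge> N k" using rk[of j] by simp
      then have "dist (X m) (X (r j)) \<le> (1/2)^k" using N m by (auto intro: less_imp_le)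
      moreover have "(\<integral>\<^sup>+p. ennreal ((F m p - F (r j) p)\<^sup>2) \<partial>lborel2) = ennreal ((dist (X m) (X (r j)))\<^sup>2)"
        using norm_abs_hs_sq[OF L2_space_diff[OF F(1)[of m] F(1)[of "r j"]]]
        unfolding dist_norm F(2) by (simp add: abs_hs_simps F(1))
      ultimately show "(\<integral>\<^sup>+p. ennreal ((F m p - F (r j) p)\<^sup>2) \<partial>lborel2) \<le> ennreal (((1/2)^k)\<^sup>2)"
        by (simp add: ennreal_leI power_mono)
    qed
    finally show ?thesis by (simp add: Liminf_const)
  qed
  have "(\<lambda>p. F (N 0) p - L p) \<in> L2_space lborel2"
    using le_less_trans[OF close[where m = "N 0" and k = 0], of top] by (simp add: L2_space_iff_nn_integral)
  from L2_space_diff[OF F(1)[of "N 0"] this] have L_L2: "L \<in> L2_space lborel2" by simp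
  have close': "dist (X m) (abs_hs L) \<le> (1/2)^k" if "m \<ge> N k" for m k
  proof -
    have "ennreal ((dist (X m) (abs_hs L))\<^sup>2) \<le> ennreal (((1/2)^k)\<^sup>2)"
      using norm_abs_hs_sq[OF L2_space_diff[OF F(1)[of m] L_L2]] close[OF that]
      unfolding dist_norm F(2) by (simp add: abs_hs_simps F(1) L_L2)
    then show ?thesis
      by (subst (asm) ennreal_le_iff) (auto intro: power2_le_imp_le)
  qed
  have "X \<longlonglongrightarrow> abs_hs L"
  proof (rule metric_LIMSEQ_I)
    fix e :: real assume "e > 0"
    then obtain k where "(1/2)^k < e"
      using real_arch_pow_inv[of e "1/2"] by auto
    then show "\<exists>n. \<forall>m\<ge>n. dist (X m) (abs_hs L) < e"
      by (intro exI[of _ "N k"] allI impI le_less_trans[OF close'])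
  qed
  then show "convergent X" by (auto simp: convergent_def)
qed

subsection \<open>Kernels and their composition\<close>

abbreviation L2k :: "real kernel \<Rightarrow> bool" where
  "L2k \<equiv> L2_kernel lborel"

definition cls :: "real kernel \<Rightarrow> hs" where
  "cls A = abs_hs (case_prod A)"

definition kcomp :: "real kernel \<Rightarrow> real kernel \<Rightarrow> real kernel" where
  "kcomp A B x y = (\<integral>z. A x z * B z y \<partial>lborel)"

lemma cls_cases: obtains A where "L2k A" "x = cls A"
proof -
  obtain f where "f \<in> L2_space lborel2" "x = abs_hs f" by (rule hs_cases)
  then show thesis using that[of "curry f"] by (simp add: L2_kernel_def cls_def)
qed

lemma cls_eq_iff: "L2k A \<Longrightarrow> L2k B \<Longrightarrow> cls A = cls B \<longleftrightarrow> (AE (x, y) in lborel2. A x y = B x y)"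
  by (simp add: L2_kernel_def cls_def abs_hs_eq_iff case_prod_unfold)

lemma inner_cls: "L2k A \<Longrightarrow> L2k B \<Longrightarrow> cls A \<bullet> cls B = (\<integral>p. A (fst p) (snd p) * B (fst p) (snd p) \<partial>lborel2)"
  by (simp add: L2_kernel_def cls_def inner_abs_hs L2_inner_def case_prod_unfold)

lemma L2k_add: "L2k A \<Longrightarrow> L2k B \<Longrightarrow> L2k (\<lambda>x y. A x y + B x y)"
  and L2k_diff: "L2k A \<Longrightarrow> L2k B \<Longrightarrow> L2k (\<lambda>x y. A x y - B x y)"
  and L2k_scale: "L2k A \<Longrightarrow> L2k (\<lambda>x y. c * A x y)"
  and L2k_zero: "L2k (\<lambda>x y. 0)"
  using L2_space_add[of "case_prod A" lborel2 "case_prod B"] L2_space_diff[of "case_prod A" lborel2 "case_prod B"]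
    L2_space_scale[of "case_prod A" lborel2 c] L2_space_zero[of lborel2]
  by (auto simp: L2_kernel_def case_prod_unfold)

lemma cls_add: "L2k A \<Longrightarrow> L2k B \<Longrightarrow> cls A + cls B = cls (\<lambda>x y. A x y + B x y)"
  and cls_diff: "L2k A \<Longrightarrow> L2k B \<Longrightarrow> cls A - cls B = cls (\<lambda>x y. A x y - B x y)"
  and cls_scale: "L2k A \<Longrightarrow> c *\<^sub>R cls A = cls (\<lambda>x y. c * A x y)"
  and cls_zero: "0 = cls (\<lambda>x y. 0)"
  by (simp_all add: L2_kernel_def cls_def abs_hs_simps case_prod_unfold)

abbreviation sq_mass :: "real kernel \<Rightarrow> ennreal" where
  "sq_mass A \<equiv> \<integral>\<^sup>+p. (ennreal \<bar>A (fst p) (snd p)\<bar>)\<^sup>2 \<partial>lborel2"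

lemma kernel_measurable:
  assumes "case_prod A \<in> borel_measurable lborel2" "f \<in> measurable N lborel" "g \<in> measurable N lborel"
  shows "(\<lambda>x. A (f x) (g x)) \<in> borel_measurable N"
proof -
  have "(\<lambda>x. (f x, g x)) \<in> measurable N lborel2"
    using assms by simp
  from measurable_compose[OF this assms(1)] show ?thesis by simp
qed

lemma L2kD:
  assumes "L2k A"
  shows "case_prod A \<in> borel_measurable lborel2"
    and "sq_mass A < \<infinity>"
  using assms by (auto simp: L2_kernel_def L2_space_iff_nn_integral case_prod_unfold ennreal_power)

lemma L2kI:
  assumes "case_prod A \<in> borel_measurable lborel2"
    and "sq_mass A < \<infinity>"
  shows "L2k A"
  using assms by (auto simp: L2_kernel_def L2_space_iff_nn_integral case_prod_unfold ennreal_power)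

lemmas L2k_measurable = kernel_measurable[OF L2kD(1)]

lemma norm_cls_sq:
  assumes "L2k A"
  shows "ennreal ((norm (cls A))\<^sup>2) = sq_mass A"
  using assms norm_abs_hs_sq[of "case_prod A"]
  by (simp add: L2_kernel_def cls_def case_prod_unfold ennreal_power)

text \<open>Cauchy-Schwarz in the middle variable, after which Tonelli splits the integral into a
  product. Stated for extended nonnegative functions, the bound gives submultiplicativity of the
  norm and, applied to absolute values, convergence of the defining integrals almost
  everywhere.\<close>

lemma nn_kcomp_bound:
  fixes a b :: "real \<Rightarrow> real \<Rightarrow> ennreal"
  assumes [measurable]: "case_prod a \<in> borel_measurable lborel2" "case_prod b \<in> borel_measurable lborel2"
  shows "(\<integral>\<^sup>+p. (\<integral>\<^sup>+z. a (fst p) z * b z (snd p) \<partial>lborel)\<^sup>2 \<partial>lborel2)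
    \<le> (\<integral>\<^sup>+p. (a (fst p) (snd p))\<^sup>2 \<partial>lborel2) * (\<integral>\<^sup>+p. (b (fst p) (snd p))\<^sup>2 \<partial>lborel2)"
proof -
  have "(\<integral>\<^sup>+p. (\<integral>\<^sup>+z. a (fst p) z * b z (snd p) \<partial>lborel)\<^sup>2 \<partial>lborel2)
    \<le> (\<integral>\<^sup>+p. (\<integral>\<^sup>+z. (a (fst p) z)\<^sup>2 \<partial>lborel) * (\<integral>\<^sup>+z. (b z (snd p))\<^sup>2 \<partial>lborel) \<partial>lborel2)"
    by (intro nn_integral_mono Cauchy_Schwarz_nn_integral) measurable
  also have "\<dots> = (\<integral>\<^sup>+x. \<integral>\<^sup>+y. (\<integral>\<^sup>+z. (a x z)\<^sup>2 \<partial>lborel) * (\<integral>\<^sup>+z. (b z y)\<^sup>2 \<partial>lborel) \<partial>lborel \<partial>lborel)"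
    by (subst lborel.nn_integral_fst[symmetric]) simp_all
  also have "\<dots> = (\<integral>\<^sup>+x. \<integral>\<^sup>+z. (a x z)\<^sup>2 \<partial>lborel \<partial>lborel) * (\<integral>\<^sup>+y. \<integral>\<^sup>+z. (b z y)\<^sup>2 \<partial>lborel \<partial>lborel)"
    by (simp add: nn_integral_cmult nn_integral_multc)
  also have "(\<integral>\<^sup>+x. \<integral>\<^sup>+z. (a x z)\<^sup>2 \<partial>lborel \<partial>lborel) = (\<integral>\<^sup>+p. (a (fst p) (snd p))\<^sup>2 \<partial>lborel2)"
    by (subst lborel.nn_integral_fst[symmetric]) simp_all
  also have "(\<integral>\<^sup>+y. \<integral>\<^sup>+z. (b z y)\<^sup>2 \<partial>lborel \<partial>lborel) = (\<integral>\<^sup>+p. (b (fst p) (snd p))\<^sup>2 \<partial>lborel2)"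
    using lborel_pair.nn_integral_snd[of "\<lambda>p. (b (fst p) (snd p))\<^sup>2"] by simp
  finally show ?thesis .
qed

lemma nn_kcomp_finite:
  fixes a b :: "real \<Rightarrow> real \<Rightarrow> ennreal"
  assumes "case_prod a \<in> borel_measurable lborel2" "case_prod b \<in> borel_measurable lborel2"
    and "(\<integral>\<^sup>+p. (a (fst p) (snd p))\<^sup>2 \<partial>lborel2) < \<infinity>" "(\<integral>\<^sup>+p. (b (fst p) (snd p))\<^sup>2 \<partial>lborel2) < \<infinity>"
  shows "(\<integral>\<^sup>+p. (\<integral>\<^sup>+z. a (fst p) z * b z (snd p) \<partial>lborel)\<^sup>2 \<partial>lborel2) < \<infinity>"
  by (rule le_less_trans[OF nn_kcomp_bound[OF assms(1,2)]]) (use assms in \<open>auto simp: ennreal_mult_less_top\<close>)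

lemma AE_finite_of_square:
  assumes [measurable]: "g \<in> borel_measurable M" and "(\<integral>\<^sup>+p. (g p)\<^sup>2 \<partial>M) < \<infinity>"
  shows "AE p in M. g p < (\<infinity>::ennreal)"
proof -
  have "AE p in M. (g p)\<^sup>2 \<noteq> \<infinity>"
    using assms by (intro nn_integral_PInf_AE) auto
  then show ?thesis
  proof eventually_elim
    case (elim p)
    then show ?case by (cases "g p = top") (auto simp: power2_eq_square top.not_eq_extremum)
  qed
qed

lemma nn_integral_abs_iff:
  "integrable M (f :: _ \<Rightarrow> real) \<longleftrightarrow> f \<in> borel_measurable M \<and> (\<integral>\<^sup>+x. ennreal \<bar>f x\<bar> \<partial>M) < \<infinity>"
  by (simp add: integrable_iff_bounded)

lemma kcomp_integrable_AE:
  assumes "L2k A" "L2k B"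
  shows "AE (x, y) in lborel2. integrable lborel (\<lambda>z. A x z * B z y)"
proof -
  note [measurable (raw)] = L2k_measurable[OF assms(1)] L2k_measurable[OF assms(2)]
  have "AE p in lborel2. (\<integral>\<^sup>+z. ennreal \<bar>A (fst p) z\<bar> * ennreal \<bar>B z (snd p)\<bar> \<partial>lborel) < \<infinity>"
    using assms by (intro AE_finite_of_square nn_kcomp_finite) (auto dest: L2kD(2))
  then show ?thesis
    by eventually_elim (auto simp: nn_integral_abs_iff abs_mult ennreal_mult)
qed

lemma kcomp_measurable:
  assumes "L2k A" "L2k B"
  shows "case_prod (kcomp A B) \<in> borel_measurable lborel2"
proof -
  note [measurable (raw)] = L2k_measurable[OF assms(1)] L2k_measurable[OF assms(2)]
  show ?thesis unfolding kcomp_def case_prod_unfold by measurable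
qed

lemma kcomp_abs_le:
  assumes "L2k A" "L2k B"
  shows "ennreal \<bar>kcomp A B x y\<bar> \<le> (\<integral>\<^sup>+z. ennreal \<bar>A x z\<bar> * ennreal \<bar>B z y\<bar> \<partial>lborel)"
proof (cases "integrable lborel (\<lambda>z. A x z * B z y)")
  case True
  from integral_norm_bound_ennreal[OF this] show ?thesis
    by (simp add: kcomp_def abs_mult ennreal_mult)
qed (simp add: kcomp_def not_integrable_integral_eq)

lemma kcomp_nn_le:
  assumes "L2k A" "L2k B"
  shows "sq_mass (kcomp A B) \<le>
     sq_mass A * sq_mass B"
proof -
  note [measurable (raw)] = L2k_measurable[OF assms(1)] L2k_measurable[OF assms(2)]
  have "sq_mass (kcomp A B)
     \<le> (\<integral>\<^sup>+p. (\<integral>\<^sup>+z. ennreal \<bar>A (fst p) z\<bar> * ennreal \<bar>B z (snd p)\<bar> \<partial>lborel)\<^sup>2 \<partial>lborel2)"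
    by (intro nn_integral_mono power_mono kcomp_abs_le assms) auto
  also have "\<dots> \<le> sq_mass A * sq_mass B"
    by (rule nn_kcomp_bound) simp_all
  finally show ?thesis .
qed

lemma L2k_kcomp:
  assumes "L2k A" "L2k B"
  shows "L2k (kcomp A B)"
  by (rule L2kI[OF kcomp_measurable[OF assms] le_less_trans[OF kcomp_nn_le[OF assms]]])
    (use L2kD(2)[OF assms(1)] L2kD(2)[OF assms(2)] in \<open>simp add: ennreal_mult_less_top\<close>)

lemma norm_cls_kcomp:
  assumes "L2k A" "L2k B"
  shows "norm (cls (kcomp A B)) \<le> norm (cls A) * norm (cls B)"
proof -
  have "ennreal ((norm (cls (kcomp A B)))\<^sup>2) \<le> ennreal ((norm (cls A) * norm (cls B))\<^sup>2)"
    using kcomp_nn_le[OF assms]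
    by (simp add: assms L2k_kcomp power_mult_distrib ennreal_mult flip: norm_cls_sq)
  then show ?thesis
    by (subst (asm) ennreal_le_iff) (auto intro: power2_le_imp_le)
qed

lemma kcomp_cong_AE:
  assumes A: "L2k A" "L2k A'" "AE (x, y) in lborel2. A x y = A' x y"
    and B: "L2k B" "L2k B'" "AE (x, y) in lborel2. B x y = B' x y"
  shows "AE (x, y) in lborel2. kcomp A B x y = kcomp A' B' x y"
proof -
  note [measurable (raw)] = L2k_measurable[OF A(1)] L2k_measurable[OF A(2)]
    L2k_measurable[OF B(1)] L2k_measurable[OF B(2)]
  note [measurable (raw)] = kernel_measurable[OF kcomp_measurable[OF A(1) B(1)]] kernel_measurable[OF kcomp_measurable[OF A(2) B(2)]]
  have a: "AE x in lborel. AE z in lborel. A x z = A' x z"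
    using lborel_pair.AE_pair[OF A(3)] by simp
  have "AE z in lborel. AE y in lborel. B z y = B' z y"
    using lborel_pair.AE_pair[OF B(3)] by simp
  \<comment> \<open>The integral runs down a column of \<open>B\<close>, so the exceptional set must
    be null for almost every \<open>y\<close>; the two almost everywhere quantifiers are
    exchanged.\<close>
  then have b: "AE y in lborel. AE z in lborel. B z y = B' z y"
    by (subst lborel_pair.AE_commute[symmetric]) measurable
  have "AE p in lborel2. kcomp A B (fst p) (snd p) = kcomp A' B' (fst p) (snd p)"
  proof (rule lborel_pair.AE_pair_measure)
    show "AE x in lborel. AE y in lborel. kcomp A B (fst (x, y)) (snd (x, y)) = kcomp A' B' (fst (x, y)) (snd (x, y))"
      using a
    proof eventually_elim
      case x: (elim x)
      show ?case
        using b
      proof eventually_elim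
        case (elim y)
        then have "AE z in lborel. A x z * B z y = A' x z * B' z y"
          using x by eventually_elim simp
        then show ?case
          unfolding kcomp_def by (auto intro!: integral_cong_AE)
      qed
    qed
  qed measurable
  then show ?thesis by (simp add: case_prod_unfold)
qed

text \<open>Fubini in the two middle variables, at every (x, y) where the composition of the
  absolute values is finite. \<open>G\<close> composes |B| and |C| and is again square-integrable,
  so the bound for compositions can be applied twice.\<close>

lemma kcomp_assoc_AE:
  assumes "L2k A" "L2k B" "L2k C"
  shows "AE (x, y) in lborel2. kcomp (kcomp A B) C x y = kcomp A (kcomp B C) x y"
proof -
  note [measurable (raw)] = L2k_measurable[OF assms(1)] L2k_measurable[OF assms(2)]
    L2k_measurable[OF assms(3)]
  define G where "G z y = (\<integral>\<^sup>+w. ennreal \<bar>B z w\<bar> * ennreal \<bar>C w y\<bar> \<partial>lborel)" for z y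
  have [measurable]: "case_prod G \<in> borel_measurable lborel2"
    unfolding G_def case_prod_unfold by measurable
  have "AE p in lborel2. (\<integral>\<^sup>+z. ennreal \<bar>A (fst p) z\<bar> * G z (snd p) \<partial>lborel) < \<infinity>"
  proof (intro AE_finite_of_square nn_kcomp_finite)
    show "(\<integral>\<^sup>+p. (G (fst p) (snd p))\<^sup>2 \<partial>lborel2) < \<infinity>"
      unfolding G_def using assms by (intro nn_kcomp_finite) (auto dest: L2kD(2))
  qed (use assms in \<open>auto dest: L2kD(2)\<close>)
  then show ?thesis
  proof eventually_elim
    case (elim p)
    obtain x y where p: "p = (x, y)" by (cases p)
    have "(\<integral>\<^sup>+q. ennreal \<bar>A x (fst q) * B (fst q) (snd q) * C (snd q) y\<bar> \<partial>lborel2)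
      = (\<integral>\<^sup>+z. \<integral>\<^sup>+w. ennreal \<bar>A x z\<bar> * (ennreal \<bar>B z w\<bar> * ennreal \<bar>C w y\<bar>) \<partial>lborel \<partial>lborel)"
      by (subst lborel.nn_integral_fst[symmetric]) (simp_all add: abs_mult ennreal_mult mult.assoc)
    also have "\<dots> = (\<integral>\<^sup>+z. ennreal \<bar>A x z\<bar> * G z y \<partial>lborel)"
      unfolding G_def by (intro nn_integral_cong nn_integral_cmult) measurable
    also have "\<dots> < \<infinity>" using elim p by simp
    finally have "integrable lborel2 (\<lambda>(z, w). A x z * B z w * C w y)"
      by (simp add: nn_integral_abs_iff case_prod_unfold)
    from lborel_pair.Fubini_integral[OF this]
    show ?case
      by (simp add: p kcomp_def mult.assoc flip: integral_mult_right_zero integral_mult_left_zero)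
  qed
qed

text \<open>Fubini in three variables moves \<open>A\<close> across the inner product as its
  transpose. The triple integrand is absolutely integrable by Cauchy-Schwarz between |C| and the
  composition of |A| and |B|.\<close>

lemma kcomp_inner:
  assumes "L2k A" "L2k B" "L2k C"
  shows "(\<integral>p. kcomp A B (fst p) (snd p) * C (fst p) (snd p) \<partial>lborel2) =
    (\<integral>p. B (fst p) (snd p) * kcomp (\<lambda>x y. A y x) C (fst p) (snd p) \<partial>lborel2)"
proof -
  note [measurable (raw)] = L2k_measurable[OF assms(1)] L2k_measurable[OF assms(2)]
    L2k_measurable[OF assms(3)]
  interpret P: pair_sigma_finite lborel2 "lborel :: real measure" ..
  define G where "G p = (\<integral>\<^sup>+z. ennreal \<bar>A (fst p) z\<bar> * ennreal \<bar>B z (snd p)\<bar> \<partial>lborel)" for p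
  have [measurable]: "G \<in> borel_measurable lborel2"
    unfolding G_def by measurable
  have G: "(\<integral>\<^sup>+p. (G p)\<^sup>2 \<partial>lborel2) < \<infinity>"
    unfolding G_def using assms by (intro nn_kcomp_finite) (auto dest: L2kD(2))
  define F where "F p z = A (fst p) z * B z (snd p) * C (fst p) (snd p)" for p :: "real \<times> real" and z
  have [measurable]: "case_prod F \<in> borel_measurable (lborel2 \<Otimes>\<^sub>M lborel)"
    unfolding F_def case_prod_unfold by measurable
  have "(\<integral>\<^sup>+q. ennreal \<bar>case_prod F q\<bar> \<partial>(lborel2 \<Otimes>\<^sub>M lborel)) = (\<integral>\<^sup>+p. \<integral>\<^sup>+z. ennreal \<bar>F p z\<bar> \<partial>lborel \<partial>lborel2)"
    by (subst lborel.nn_integral_fst[symmetric]) simp_all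
  also have "\<dots> = (\<integral>\<^sup>+p. \<integral>\<^sup>+z. (ennreal \<bar>A (fst p) z\<bar> * ennreal \<bar>B z (snd p)\<bar>) * ennreal \<bar>C (fst p) (snd p)\<bar> \<partial>lborel \<partial>lborel2)"
    by (simp add: F_def abs_mult ennreal_mult)
  also have "\<dots> = (\<integral>\<^sup>+p. G p * ennreal \<bar>C (fst p) (snd p)\<bar> \<partial>lborel2)"
    unfolding G_def by (intro nn_integral_cong nn_integral_multc) measurable
  also have "\<dots> < \<infinity>"
  proof -
    have "(\<integral>\<^sup>+p. G p * ennreal \<bar>C (fst p) (snd p)\<bar> \<partial>lborel2)\<^sup>2 \<le>
      (\<integral>\<^sup>+p. (G p)\<^sup>2 \<partial>lborel2) * (\<integral>\<^sup>+p. (ennreal \<bar>C (fst p) (snd p)\<bar>)\<^sup>2 \<partial>lborel2)"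
      by (intro Cauchy_Schwarz_nn_integral) measurable
    also have "\<dots> < \<infinity>"
      using G L2kD(2)[OF assms(3)] by (simp add: ennreal_mult_less_top)
    finally show ?thesis
      by (auto simp: top.not_eq_extremum[symmetric] power2_eq_square)
  qed
  finally have F: "integrable (lborel2 \<Otimes>\<^sub>M lborel) (case_prod F)"
    by (simp add: nn_integral_abs_iff)
  have LB: "L2k (kcomp (\<lambda>x y. A y x) C) \<Longrightarrow> integrable lborel2 (\<lambda>(z, y). B z y * kcomp (\<lambda>x y. A y x) C z y)"
    using L2_mult_integrable[of "case_prod B" lborel2 "case_prod (kcomp (\<lambda>x y. A y x) C)"] assms(2)
    by (simp add: L2_kernel_def case_prod_unfold)
  have LA: "L2k (\<lambda>x y. A y x)"
    using assms(1) lborel_pair.integrable_product_swap_iff[of "\<lambda>p. (A (fst p) (snd p))\<^sup>2"]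
      measurable_pair_swap[OF L2kD(1)[OF assms(1)]]
    by (auto simp: L2_kernel_def L2_space_def case_prod_unfold)
  have "(\<integral>p. kcomp A B (fst p) (snd p) * C (fst p) (snd p) \<partial>lborel2) = (\<integral>p. \<integral>z. F p z \<partial>lborel \<partial>lborel2)"
    by (simp add: kcomp_def F_def)
  also have "\<dots> = (\<integral>z. \<integral>p. F p z \<partial>lborel2 \<partial>lborel)"
    using P.Fubini_integral[OF F] by simp
  also have "\<dots> = (\<integral>z. \<integral>y. B z y * kcomp (\<lambda>x y. A y x) C z y \<partial>lborel \<partial>lborel)"
  proof (intro integral_cong_AE)
    show "AE z in lborel. (\<integral>p. F p z \<partial>lborel2) = (\<integral>y. B z y * kcomp (\<lambda>x y. A y x) C z y \<partial>lborel)"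
      using P.AE_integrable_snd[OF F]
    proof eventually_elim
      case (elim z)
      then have "integrable lborel2 (\<lambda>(x, y). F (x, y) z)" by (simp add: case_prod_unfold)
      from lborel_pair.integral_snd[OF this]
      have "(\<integral>p. F p z \<partial>lborel2) = (\<integral>y. \<integral>x. F (x, y) z \<partial>lborel \<partial>lborel)"
        by (simp add: case_prod_unfold)
      also have "\<dots> = (\<integral>y. B z y * kcomp (\<lambda>x y. A y x) C z y \<partial>lborel)"
        by (simp add: F_def kcomp_def mult_ac flip: integral_mult_right_zero)
      finally show ?case .
    qed
    note [measurable (raw)] = kernel_measurable[OF kcomp_measurable[OF LA assms(3)]]
    show "(\<lambda>z. \<integral>y. B z y * kcomp (\<lambda>x y. A y x) C z y \<partial>lborel) \<in> borel_measurable lborel"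
      by measurable
  qed (simp add: F_def)
  also have "\<dots> = (\<integral>p. B (fst p) (snd p) * kcomp (\<lambda>x y. A y x) C (fst p) (snd p) \<partial>lborel2)"
    using lborel_pair.integral_fst[OF LB[OF L2k_kcomp[OF LA assms(3)]]] by (simp add: case_prod_unfold)
  finally show ?thesis .
qed

subsection \<open>The algebra of Hilbert-Schmidt kernels\<close>

definition ker :: "hs \<Rightarrow> real kernel" where
  "ker x = (SOME A. L2k A \<and> cls A = x)"

lemma L2k_ker [simp]: "L2k (ker x)" and cls_ker [simp]: "cls (ker x) = x"
proof -
  have "\<exists>A. L2k A \<and> cls A = x" using cls_cases by metis
  from someI_ex[OF this] show "L2k (ker x)" "cls (ker x) = x" by (simp_all add: ker_def)
qed

lemma ker_cls_AE: "L2k A \<Longrightarrow> AE (x, y) in lborel2. ker (cls A) x y = A x y"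
  by (simp flip: cls_eq_iff)

instantiation hs :: real_normed_algebra
begin

definition times_hs :: "hs \<Rightarrow> hs \<Rightarrow> hs" where
  "times_hs x y = cls (kcomp (ker x) (ker y))"

lemma cls_mult:
  assumes "L2k A" "L2k B"
  shows "cls A * cls B = cls (kcomp A B)"
  unfolding times_hs_def using assms
  by (subst cls_eq_iff) (auto intro!: L2k_kcomp kcomp_cong_AE ker_cls_AE)

instance
proof
  fix x y z :: hs and a :: real
  obtain A where A: "L2k A" "x = cls A" by (rule cls_cases)
  obtain B where B: "L2k B" "y = cls B" by (rule cls_cases)
  obtain C where C: "L2k C" "z = cls C" by (rule cls_cases)
  note L = A(1) B(1) C(1)
  show "x * y * z = x * (y * z)"
    using L by (simp add: A(2) B(2) C(2) cls_mult L2k_kcomp cls_eq_iff kcomp_assoc_AE)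
  have "AE (x, y) in lborel2. kcomp (\<lambda>x y. A x y + B x y) C x y = kcomp A C x y + kcomp B C x y"
    using kcomp_integrable_AE[OF A(1) C(1)] kcomp_integrable_AE[OF B(1) C(1)]
    by eventually_elim (auto simp: kcomp_def distrib_right)
  then show "(x + y) * z = x * z + y * z"
    using L by (simp add: A(2) B(2) C(2) cls_mult cls_add L2k_kcomp L2k_add cls_eq_iff)
  have "AE (x, y) in lborel2. kcomp A (\<lambda>x y. B x y + C x y) x y = kcomp A B x y + kcomp A C x y"
    using kcomp_integrable_AE[OF A(1) C(1)] kcomp_integrable_AE[OF A(1) B(1)]
    by eventually_elim (auto simp: kcomp_def distrib_left)
  then show "x * (y + z) = x * y + x * z"
    using L by (simp add: A(2) B(2) C(2) cls_mult cls_add L2k_kcomp L2k_add cls_eq_iff)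
  have "kcomp (\<lambda>x y. a * A x y) B = (\<lambda>x y. a * kcomp A B x y)" "kcomp A (\<lambda>x y. a * B x y) = (\<lambda>x y. a * kcomp A B x y)"
    by (auto simp: kcomp_def mult_ac fun_eq_iff simp flip: integral_mult_right_zero)
  then show "a *\<^sub>R x * y = a *\<^sub>R (x * y)" "x * a *\<^sub>R y = a *\<^sub>R (x * y)"
    using L by (simp_all add: A(2) B(2) cls_mult cls_scale L2k_kcomp L2k_scale)
  show "norm (x * y) \<le> norm x * norm y"
    using L norm_cls_kcomp by (simp add: A(2) B(2) cls_mult)
qed

end

instance hs :: banach ..

section \<open>Transposition of kernels as the adjoint\<close>

lemma AE_swap:
  assumes "AE p in lborel2. P p"
  shows "AE p in lborel2. P (snd p, fst p)"
proof -
  have "AE p in distr lborel2 lborel2 (\<lambda>(x, y). (y, x)). P p"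
    using assms by (subst (asm) lborel_pair.distr_pair_swap)
  from AE_distrD[OF _ this] show ?thesis by (simp add: case_prod_unfold measurable_pair_swap')
qed

lemma nn_integral_swap:
  assumes [measurable]: "f \<in> borel_measurable lborel2"
  shows "(\<integral>\<^sup>+p. f (snd p, fst p) \<partial>lborel2) = (\<integral>\<^sup>+p. f p \<partial>lborel2)"
  by (subst (2) lborel_pair.distr_pair_swap, subst nn_integral_distr)
    (auto simp: case_prod_unfold)

lemma L2k_swap:
  assumes "L2k A"
  shows "L2k (\<lambda>x y. A y x)"
proof (rule L2kI)
  note [measurable (raw)] = L2k_measurable[OF assms]
  show "(\<lambda>(x, y). A y x) \<in> borel_measurable lborel2"
    unfolding case_prod_unfold by measurable
  show "(\<integral>\<^sup>+p. (ennreal \<bar>A (snd p) (fst p)\<bar>)\<^sup>2 \<partial>lborel2) < \<infinity>"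
    using nn_integral_swap[of "\<lambda>p. (ennreal \<bar>A (fst p) (snd p)\<bar>)\<^sup>2"] L2kD(2)[OF assms] by simp
qed

definition adj :: "hs \<Rightarrow> hs" where
  "adj x = cls (\<lambda>u v. ker x v u)"

lemma adj_cls:
  assumes "L2k A"
  shows "adj (cls A) = cls (\<lambda>x y. A y x)"
  unfolding adj_def
  using AE_swap[of "\<lambda>(x, y). ker (cls A) x y = A x y"] ker_cls_AE[OF assms] assms
  by (simp add: cls_eq_iff L2k_swap case_prod_unfold)

lemma adj_adj [simp]: "adj (adj x) = x"
  by (cases x rule: cls_cases) (simp add: adj_cls L2k_swap)

lemma adj_mult: "adj (x * y) = adj y * adj x"
proof (cases x rule: cls_cases, cases y rule: cls_cases)
  fix A B assume "L2k A" "x = cls A" "L2k B" "y = cls B"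
  moreover have "(\<lambda>u v. kcomp A B v u) = kcomp (\<lambda>u v. B v u) (\<lambda>u v. A v u)"
    by (auto simp: kcomp_def fun_eq_iff mult.commute)
  ultimately show ?thesis
    by (simp add: adj_cls L2k_swap cls_mult L2k_kcomp)
qed

lemma adj_add: "adj (x + y) = adj x + adj y"
  by (cases x rule: cls_cases, cases y rule: cls_cases) (simp add: adj_cls L2k_swap cls_add L2k_add)

lemma adj_scaleR: "adj (c *\<^sub>R x) = c *\<^sub>R adj x"
  by (cases x rule: cls_cases) (simp add: adj_cls L2k_swap cls_scale L2k_scale)

lemma adj_uminus: "adj (- x) = - adj x"
  using adj_scaleR[of "-1" x] by simp

lemma adj_zero [simp]: "adj 0 = 0"
  using adj_scaleR[of 0 0] by simp

lemma inner_adj: "adj x \<bullet> adj y = x \<bullet> y"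
proof (cases x rule: cls_cases, cases y rule: cls_cases)
  fix A B assume AB: "L2k A" "x = cls A" "L2k B" "y = cls B"
  have "(\<integral>(x, y). (\<lambda>p. A (fst p) (snd p) * B (fst p) (snd p)) (y, x) \<partial>lborel2) =
    (\<integral>p. A (fst p) (snd p) * B (fst p) (snd p) \<partial>lborel2)"
    using L2kD(1)[OF AB(1)] L2kD(1)[OF AB(3)]
    by (intro lborel_pair.integral_product_swap) (simp add: case_prod_unfold)
  then show ?thesis
    using AB by (simp add: adj_cls L2k_swap inner_cls case_prod_unfold)
qed

lemma norm_adj [simp]: "norm (adj x) = norm x"
  by (simp add: norm_eq_sqrt_inner inner_adj)

lemma bounded_linear_adj: "bounded_linear adj"
  by (rule bounded_linear_intro[of _ 1]) (simp_all add: adj_add adj_scaleR)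

lemma inner_mult_left: "(x * y) \<bullet> z = y \<bullet> (adj x * z)" for x y z :: hs
proof (cases x rule: cls_cases, cases y rule: cls_cases, cases z rule: cls_cases)
  fix A B C assume "L2k A" "x = cls A" "L2k B" "y = cls B" "L2k C" "z = cls C"
  then show ?thesis
    using kcomp_inner[of A B C] by (simp add: cls_mult adj_cls L2k_kcomp L2k_swap inner_cls)
qed

lemma inner_mult_right: "(x * y) \<bullet> z = x \<bullet> (z * adj y)" for x y z :: hs
proof -
  have "(x * y) \<bullet> z = (adj y * adj x) \<bullet> adj z"
    by (metis adj_mult inner_adj)
  also have "\<dots> = adj x \<bullet> (y * adj z)" by (simp add: inner_mult_left)
  also have "\<dots> = adj (adj x) \<bullet> adj (y * adj z)" by (simp only: inner_adj)
  finally show ?thesis by (simp add: adj_mult)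
qed

subsection \<open>Truncation of kernels\<close>

text \<open>On the Hilbert space of kernels this is the orthogonal projection onto the kernels
  supported in \<open>X\<close> (see \<open>inner_trunc\<close> and \<open>trunc_trunc\<close>),
  which is what makes truncation compatible with coercivity.\<close>

definition trunc :: "(real \<times> real) set \<Rightarrow> hs \<Rightarrow> hs" where
  "trunc X x = cls (\<lambda>u v. indicator X (u, v) * ker x u v)"

lemma L2k_indicator_mult:
  assumes "L2k A" "X \<in> sets (borel \<Otimes>\<^sub>M borel)"
  shows "L2k (\<lambda>u v. indicator X (u, v) * A u v)"
  using L2_space_indicator_mult[of "case_prod A" lborel2 X] assms
  by (simp add: L2_kernel_def case_prod_unfold)

lemma trunc_cls:
  assumes "L2k A" "X \<in> sets (borel \<Otimes>\<^sub>M borel)"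
  shows "trunc X (cls A) = cls (\<lambda>u v. indicator X (u, v) * A u v)"
  unfolding trunc_def using ker_cls_AE[OF assms(1)] assms
  by (auto simp: cls_eq_iff L2k_indicator_mult elim: eventually_mono)

lemma trunc_cong_AE:
  assumes "X \<in> sets (borel \<Otimes>\<^sub>M borel)" "Y \<in> sets (borel \<Otimes>\<^sub>M borel)" "AE p in lborel2. p \<in> X \<longleftrightarrow> p \<in> Y"
  shows "trunc X x = trunc Y x"
proof (cases x rule: cls_cases)
  case (1 A)
  have "AE p in lborel2. indicator X p * A (fst p) (snd p) = indicator Y p * A (fst p) (snd p)"
    using assms(3) by eventually_elim (auto simp: indicator_def)
  then show ?thesis
    using assms 1 by (simp add: trunc_cls cls_eq_iff L2k_indicator_mult case_prod_unfold)
qed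

context
  fixes X :: "(real \<times> real) set"
  assumes X: "X \<in> sets (borel \<Otimes>\<^sub>M borel)"
begin

lemmas trunc_cls_X = trunc_cls[OF _ X] L2k_indicator_mult[OF _ X]

lemma trunc_add: "trunc X (x + y) = trunc X x + trunc X y"
  by (cases x rule: cls_cases, cases y rule: cls_cases)
    (simp add: trunc_cls_X cls_add L2k_add distrib_left)

lemma trunc_diff: "trunc X (x - y) = trunc X x - trunc X y"
  by (cases x rule: cls_cases, cases y rule: cls_cases)
    (simp add: trunc_cls_X cls_diff L2k_diff right_diff_distrib)

lemma trunc_scaleR: "trunc X (c *\<^sub>R x) = c *\<^sub>R trunc X x"
  by (cases x rule: cls_cases)
    (simp add: trunc_cls_X cls_scale L2k_scale mult.left_commute)

lemma trunc_trunc: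
  assumes Y: "Y \<in> sets (borel \<Otimes>\<^sub>M borel)"
  shows "trunc X (trunc Y x) = trunc (X \<inter> Y) x"
  by (cases x rule: cls_cases)
    (simp add: trunc_cls_X trunc_cls[OF _ Y] trunc_cls[OF _ sets.Int[OF X Y]] L2k_indicator_mult[OF _ Y] indicator_inter_arith mult.assoc)

lemma inner_trunc: "trunc X x \<bullet> y = x \<bullet> trunc X y"
  by (cases x rule: cls_cases, cases y rule: cls_cases)
    (simp add: trunc_cls_X inner_cls mult.assoc mult.left_commute)

lemma trunc_compl: "trunc (- X) x = x - trunc X x"
proof (cases x rule: cls_cases)
  case (1 A)
  have "- X \<in> sets (borel \<Otimes>\<^sub>M borel)"
    using sets.compl_sets[OF X] by (simp add: space_pair_measure Compl_eq_Diff_UNIV)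
  then show ?thesis
    using 1 by (simp add: trunc_cls_X trunc_cls[OF _ \<open>- X \<in> sets (borel \<Otimes>\<^sub>M borel)\<close>] cls_diff)
      (auto intro!: arg_cong[of _ _ cls] simp: fun_eq_iff indicator_def)
qed

lemma adj_trunc: "adj (trunc X x) = trunc {p. (snd p, fst p) \<in> X} (adj x)"
proof (cases x rule: cls_cases)
  case (1 A)
  have "(\<lambda>(x, y). (y, x)) -` X \<inter> space (borel \<Otimes>\<^sub>M borel) \<in> sets (borel \<Otimes>\<^sub>M borel)"
    by (rule sets_pair_swap) (rule X)
  then have "{p. (snd p, fst p) \<in> X} \<in> sets (borel \<Otimes>\<^sub>M borel)"
    by (simp add: space_pair_measure case_prod_unfold vimage_def)
  then show ?thesis
    using 1 by (simp add: trunc_cls_X trunc_cls[OF _ \<open>{p. (snd p, fst p) \<in> X} \<in> sets (borel \<Otimes>\<^sub>M borel)\<close>] adj_cls L2k_swap)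
      (auto intro!: arg_cong[of _ _ cls] simp: fun_eq_iff indicator_def)
qed

end

lemma norm_trunc_le:
  assumes "X \<in> sets (borel \<Otimes>\<^sub>M borel)"
  shows "norm (trunc X x) \<le> norm x"
proof -
  have "(norm (trunc X x))\<^sup>2 = trunc X x \<bullet> x"
    using assms by (simp add: power2_norm_eq_inner inner_trunc trunc_trunc inner_commute)
  also have "\<dots> \<le> norm (trunc X x) * norm x" by (rule norm_cauchy_schwarz)
  finally show ?thesis
    by (cases "trunc X x = 0") (auto simp: power2_eq_square)
qed

lemma bounded_linear_trunc: "X \<in> sets (borel \<Otimes>\<^sub>M borel) \<Longrightarrow> bounded_linear (trunc X)"
  by (rule bounded_linear_intro[of _ 1]) (simp_all add: trunc_add trunc_scaleR norm_trunc_le)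

lemma trunc_UNIV [simp]: "trunc UNIV x = x"
  by (simp add: trunc_def)

text \<open>Cutting rows to \<open>S\<close> is left multiplication by the projection onto L2(S),
  which in general is not Hilbert-Schmidt and hence no element of the algebra. Its associativity
  with products is recorded here and in \<open>trunc_mult_rows\<close>.\<close>

lemma trunc_rows_mult:
  assumes "S \<in> sets borel"
  shows "trunc (S \<times> UNIV) (x * y) = trunc (S \<times> UNIV) x * y"
proof (cases x rule: cls_cases, cases y rule: cls_cases)
  fix A B assume AB: "L2k A" "x = cls A" "L2k B" "y = cls B"
  have S: "S \<times> UNIV \<in> sets (borel \<Otimes>\<^sub>M borel)" using assms by auto
  have "(\<lambda>u v. indicator (S \<times> UNIV) (u, v) * kcomp A B u v) = kcomp (\<lambda>u v. indicator (S \<times> UNIV) (u, v) * A u v) B"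
    by (auto simp: kcomp_def fun_eq_iff indicator_times mult.assoc simp flip: integral_mult_right_zero)
  with AB show ?thesis
    by (simp add: trunc_cls[OF _ S] cls_mult L2k_indicator_mult[OF _ S] L2k_kcomp)
qed

lemma trunc_mult_rows:
  assumes "S \<in> sets borel"
  shows "x * trunc (S \<times> UNIV) y = trunc (UNIV \<times> S) x * y"
proof (cases x rule: cls_cases, cases y rule: cls_cases)
  fix A B assume AB: "L2k A" "x = cls A" "L2k B" "y = cls B"
  have S: "S \<times> UNIV \<in> sets (borel \<Otimes>\<^sub>M borel)" "UNIV \<times> S \<in> sets (borel \<Otimes>\<^sub>M borel)" using assms by auto
  have "kcomp A (\<lambda>u v. indicator (S \<times> UNIV) (u, v) * B u v) = kcomp (\<lambda>u v. indicator (UNIV \<times> S) (u, v) * A u v) B"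
    by (auto simp: kcomp_def fun_eq_iff indicator_times mult_ac)
  with AB show ?thesis
    by (simp add: trunc_cls[OF _ S(1)] trunc_cls[OF _ S(2)] cls_mult L2k_indicator_mult[OF _ S(1)]
      L2k_indicator_mult[OF _ S(2)])
qed

section \<open>Upper and lower triangular kernels\<close>

definition upper :: "(real \<times> real) set" where
  "upper = {p. fst p < snd p}"

lemma upper_sets [measurable, simp]: "upper \<in> sets (borel \<Otimes>\<^sub>M borel)" "- upper \<in> sets (borel \<Otimes>\<^sub>M borel)"
proof -
  have "{p \<in> space (borel \<Otimes>\<^sub>M borel). fst p < (snd p :: real)} \<in> sets (borel \<Otimes>\<^sub>M borel)" by measurable
  then show "upper \<in> sets (borel \<Otimes>\<^sub>M borel)" by (simp add: upper_def space_pair_measure)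
  from sets.compl_sets[OF this] show "- upper \<in> sets (borel \<Otimes>\<^sub>M borel)"
    by (simp add: space_pair_measure Compl_eq_Diff_UNIV)
qed

lemma AE_off_diagonal: "AE p in lborel2. fst p \<noteq> snd p"
proof (rule lborel_pair.AE_pair_measure)
  show "AE x in lborel. AE y in lborel. fst (x, y) \<noteq> snd (x, y)"
    using AE_lborel_singleton by (auto simp: eq_commute)
qed measurable

abbreviation "up \<equiv> trunc upper"
abbreviation "lo \<equiv> trunc (- upper)"

lemma lo_eq: "lo x = x - up x"
  by (simp add: trunc_compl)

text \<open>Transposition takes the strict upper triangle to the strict lower one, while
  \<open>lo\<close> also keeps the diagonal; the two agree because the diagonal is a null
  set.\<close>

lemma adj_up: "adj (up x) = lo (adj x)"
proof -
  have "{p. (snd p, fst p) \<in> upper} \<in> sets (borel \<Otimes>\<^sub>M borel)"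
    using sets_pair_swap[of _ borel borel, OF upper_sets(1)] by (simp add: space_pair_measure case_prod_unfold vimage_def)
  moreover have "AE p in lborel2. p \<in> {p. (snd p, fst p) \<in> upper} \<longleftrightarrow> p \<in> - upper"
    using AE_off_diagonal by eventually_elim (auto simp: upper_def)
  ultimately have "trunc {p. (snd p, fst p) \<in> upper} (adj x) = lo (adj x)"
    using upper_sets(2) by (intro trunc_cong_AE)
  then show ?thesis by (simp add: adj_trunc)
qed

lemma adj_lo: "adj (lo x) = up (adj x)"
  using adj_up[of "adj x"] by (metis adj_adj)

text \<open>For u \<ge> v no z satisfies u < z < v, so the integrand of the composition vanishes
  identically.\<close>

lemma up_mult:
  assumes "up x = x" "up y = y"
  shows "up (x * y) = x * y"
proof -
  obtain A where A: "L2k A" "x = cls A" by (rule cls_cases)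
  obtain B where B: "L2k B" "y = cls B" by (rule cls_cases)
  define A' where "A' = (\<lambda>u v. indicator upper (u, v) * A u v)"
  define B' where "B' = (\<lambda>u v. indicator upper (u, v) * B u v)"
  have x: "x = cls A'" "L2k A'" and y: "y = cls B'" "L2k B'"
    using assms A B by (simp_all add: A'_def B'_def trunc_cls L2k_indicator_mult)
  have eq: "indicator upper (u, v) * kcomp A' B' u v = kcomp A' B' u v" for u v
  proof (cases "u < v")
    case False
    then have "(\<lambda>z. A' u z * B' z v) = (\<lambda>z. 0)"
      by (auto simp: A'_def B'_def upper_def indicator_def)
    then show ?thesis by (simp add: kcomp_def)
  qed (simp add: upper_def)
  then show ?thesis
    by (simp add: x y cls_mult L2k_kcomp trunc_cls) (simp only: eq)
qed

lemma lo_mult: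
  assumes "lo x = x" "lo y = y"
  shows "lo (x * y) = x * y"
proof -
  have "up (adj y * adj x) = adj y * adj x"
    using assms by (intro up_mult) (simp_all flip: adj_lo)
  then show ?thesis
    by (metis adj_adj adj_mult adj_up)
qed

section \<open>Coercive operators\<close>

text \<open>The setting of the Lax-Milgram theorem: coercivity and boundedness give a bounded
  inverse, also for operators that are not symmetric.\<close>

locale coercive_operator =
  fixes T :: "'a::{real_inner,complete_space} \<Rightarrow> 'a" and c :: real
  assumes lin: "bounded_linear T" and c_pos: "0 < c" and coercive: "\<And>x. c * (norm x)\<^sup>2 \<le> x \<bullet> T x"
begin

lemma norm_lower: "c * norm x \<le> norm (T x)"
proof (cases "x = 0")
  case False
  have "c * (norm x)\<^sup>2 \<le> norm x * norm (T x)"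
    using coercive[of x] norm_cauchy_schwarz[of x "T x"] by linarith
  then show ?thesis
    using False by (simp add: power2_eq_square)
qed simp

lemma inj: "T x = T y \<Longrightarrow> x = y"
proof -
  assume "T x = T y"
  then have "T (x - y) = 0"
    using linear_diff[OF bounded_linear.linear[OF lin]] by simp
  then show "x = y"
    using norm_lower[of "x - y"] c_pos by (simp add: mult_le_0_iff)
qed

lemma surj: "\<exists>x. T x = f"
proof -
  interpret T: bounded_linear T by (rule lin)
  obtain B0 where B0: "\<And>x. norm (T x) \<le> norm x * B0"
    using T.bounded by blast
  \<comment> \<open>The maximum with \<open>c\<close> ensures B > 0 and \<open>c \<le> B\<close>,
    hence \<open>0 \<le> q\<close> below.\<close>
  define B where "B = max B0 c"
  have B: "norm (T x) \<le> B * norm x" and B_pos: "B > 0" and cB: "c \<le> B" for x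
  proof -
    show "norm (T x) \<le> B * norm x"
      using B0[of x] mult_right_mono[of B0 B "norm x"] by (simp add: B_def mult.commute)
    show "B > 0" "c \<le> B" using c_pos by (auto simp: B_def)
  qed
  define q where "q = 1 - c\<^sup>2 / B\<^sup>2"
  have q: "0 \<le> q" "q < 1"
    using c_pos cB B_pos by (auto simp: q_def power_mono)
  \<comment> \<open>Minimizes 1 - 2 \<omega> c + \<omega>^2 B^2, which bounds the square of the norm
    of 1 - \<omega> T; the minimum is \<open>q\<close>. Fixed points of x - \<omega> (T x - f) solve
    T x = f.\<close>
  define \<omega> where "\<omega> = c / B\<^sup>2"
  have contr: "(norm (y - \<omega> *\<^sub>R T y))\<^sup>2 \<le> q * (norm y)\<^sup>2" for y
  proof -
    have "(norm (y - \<omega> *\<^sub>R T y))\<^sup>2 = (norm y)\<^sup>2 - 2 * \<omega> * (y \<bullet> T y) + \<omega>\<^sup>2 * (norm (T y))\<^sup>2"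
      unfolding power2_norm_eq_inner
      by (simp add: inner_diff_left inner_diff_right inner_commute power2_eq_square[of \<omega>] algebra_simps)
    also have "\<dots> \<le> (norm y)\<^sup>2 - 2 * \<omega> * (c * (norm y)\<^sup>2) + \<omega>\<^sup>2 * (B * norm y)\<^sup>2"
      using coercive[of y] B[of y] c_pos
      by (intro add_mono diff_left_mono mult_left_mono power_mono) (auto simp: \<omega>_def)
    also have "\<dots> = q * (norm y)\<^sup>2"
      using B_pos by (simp add: \<omega>_def q_def field_simps power2_eq_square)
    finally show ?thesis .
  qed
  have "\<exists>!x. x - \<omega> *\<^sub>R (T x - f) = x"
  proof (rule banach_fix_type[where c = "sqrt q"])
    show "\<forall>x y. dist (x - \<omega> *\<^sub>R (T x - f)) (y - \<omega> *\<^sub>R (T y - f)) \<le> sqrt q * dist x y"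
    proof (intro allI)
      fix x y
      have eq: "x - \<omega> *\<^sub>R (T x - f) - (y - \<omega> *\<^sub>R (T y - f)) = (x - y) - \<omega> *\<^sub>R T (x - y)"
        by (simp add: T.diff algebra_simps)
      have "dist (x - \<omega> *\<^sub>R (T x - f)) (y - \<omega> *\<^sub>R (T y - f)) = sqrt ((norm ((x - y) - \<omega> *\<^sub>R T (x - y)))\<^sup>2)"
        unfolding dist_norm eq by simp
      also have "\<dots> \<le> sqrt (q * (norm (x - y))\<^sup>2)"
        using contr by (intro real_sqrt_le_mono)
      finally show "dist (x - \<omega> *\<^sub>R (T x - f)) (y - \<omega> *\<^sub>R (T y - f)) \<le> sqrt q * dist x y"
        by (simp add: dist_norm real_sqrt_mult)
    qed
  qed (use q in auto)
  then obtain x where "x - \<omega> *\<^sub>R (T x - f) = x" by blast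
  then have "\<omega> *\<^sub>R (T x - f) = 0" by (metis add_diff_cancel_left' diff_add_cancel diff_self)
  moreover have "\<omega> \<noteq> 0" using c_pos B_pos by (simp add: \<omega>_def)
  ultimately have "T x = f" by simp
  then show ?thesis by blast
qed

lemma inv_right: "T (inv T f) = f"
  using surj by (metis f_inv_into_f rangeI)

lemma inv_left: "inv T (T x) = x"
  using inj inv_right by blast

lemma bounded_linear_inv: "bounded_linear (inv T)"
proof (rule bounded_linear_intro[of _ "1 / c"])
  interpret T: bounded_linear T by (rule lin)
  show "inv T (x + y) = inv T x + inv T y" for x y
    by (rule inj) (simp add: inv_right T.add)
  show "inv T (r *\<^sub>R x) = r *\<^sub>R inv T x" for r x
    by (rule inj) (simp add: inv_right T.scaleR)
  show "norm (inv T x) \<le> norm x * (1 / c)" for x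
    using norm_lower[of "inv T x"] c_pos by (simp add: inv_right field_simps)
qed

end

text \<open>By Pythagoras: on the range of the orthogonal projection \<open>P\<close> the
  compression inherits the bound of 1 + S, on the complement it is the identity, and
  \<open>\<delta> \<le> 1\<close> makes that bound sufficient. With \<open>P = up\<close> it yields
  C_+, with restriction of rows the inverses on half-lines.\<close>

lemma coercive_compression:
  fixes P S :: "'a::real_inner \<Rightarrow> 'a"
  assumes P: "\<And>x y. P x \<bullet> y = x \<bullet> P y" "\<And>x. P (P x) = P x"
    and S: "\<And>w. \<delta> * (norm w)\<^sup>2 \<le> w \<bullet> (w + S w)" and \<delta>: "\<delta> \<le> 1"
  shows "\<delta> * (norm x)\<^sup>2 \<le> x \<bullet> (x + P (S (P x)))"
proof -
  have pyth: "(norm x)\<^sup>2 = (norm (x - P x))\<^sup>2 + (norm (P x))\<^sup>2"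
  proof -
    have "P x \<bullet> P x = x \<bullet> P x" using P by metis
    then show ?thesis
      by (simp add: power2_norm_eq_inner inner_diff_left inner_diff_right inner_commute)
  qed
  have "\<delta> * (norm x)\<^sup>2 \<le> (norm (x - P x))\<^sup>2 + \<delta> * (norm (P x))\<^sup>2"
    using mult_right_mono[OF \<delta>, of "(norm (x - P x))\<^sup>2"] by (simp add: pyth distrib_left)
  also have "\<dots> \<le> (norm (x - P x))\<^sup>2 + P x \<bullet> (P x + S (P x))"
    using S[of "P x"] by simp
  also have "\<dots> = x \<bullet> (x + P (S (P x)))"
    using pyth P(1)[of x "S (P x)"] by (simp add: inner_add_right power2_norm_eq_inner)
  finally show ?thesis .
qed

section \<open>Unitization of a Banach algebra\<close>

text \<open>The identity is not Hilbert-Schmidt, yet exponentials and inverses live near it, so a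
  unit is adjoined. With the sum of the two norms the result is a unital Banach algebra, in which
  the general \<open>exp\<close> and its derivative are available.\<close>

datatype 'a unitz = Unitz (scal: real) (vec: 'a)

lemma unitz_eq_iff: "m = n \<longleftrightarrow> scal m = scal n \<and> vec m = vec n"
  by (cases m; cases n) auto

instantiation unitz :: (real_vector) real_vector
begin
definition "0 = Unitz 0 0"
definition "m + n = Unitz (scal m + scal n) (vec m + vec n)"
definition "m - n = Unitz (scal m - scal n) (vec m - vec n)"
definition "- m = Unitz (- scal m) (- vec m)"
definition "a *\<^sub>R m = Unitz (a * scal m) (a *\<^sub>R vec m)"

lemma unitz_simps [simp]:
  "scal (0 :: 'a unitz) = 0" "vec (0 :: 'a unitz) = 0"
  "scal (m + n) = scal m + scal n" "vec (m + n) = vec m + vec n"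
  "scal (m - n) = scal m - scal n" "vec (m - n) = vec m - vec n"
  "scal (- m) = - scal m" "vec (- m) = - vec m"
  "scal (a *\<^sub>R m) = a * scal m" "vec (a *\<^sub>R m) = a *\<^sub>R vec m"
  for m n :: "'a unitz"
  by (simp_all add: zero_unitz_def plus_unitz_def minus_unitz_def uminus_unitz_def scaleR_unitz_def)

instance
  by standard (simp_all add: unitz_eq_iff algebra_simps)
end

instantiation unitz :: (real_normed_vector) real_normed_vector
begin
definition "norm m = \<bar>scal m\<bar> + norm (vec m)"
definition "sgn (m :: 'a unitz) = m /\<^sub>R norm m"
definition "dist (m :: 'a unitz) n = norm (m - n)"
definition "uniformity = (INF e\<in>{0<..}. principal {(m :: 'a unitz, n). dist m n < e})"
definition "open (U :: 'a unitz set) = (\<forall>x\<in>U. eventually (\<lambda>(x', y). x' = x \<longrightarrow> y \<in> U) uniformity)"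

instance
proof
  fix m n :: "'a unitz" and a :: real
  show "norm m = 0 \<longleftrightarrow> m = 0"
    by (auto simp: norm_unitz_def unitz_eq_iff add_nonneg_eq_0_iff)
  show "norm (m + n) \<le> norm m + norm n"
    using norm_triangle_ineq[of "vec m" "vec n"] abs_triangle_ineq[of "scal m" "scal n"]
    by (simp add: norm_unitz_def)
  show "norm (a *\<^sub>R m) = \<bar>a\<bar> * norm m"
    by (simp add: norm_unitz_def abs_mult distrib_left)
qed (simp_all add: sgn_unitz_def dist_unitz_def uniformity_unitz_def open_unitz_def)
end

lemma bounded_linear_scal: "bounded_linear scal"
  by (rule bounded_linear_intro[of _ 1]) (simp_all add: norm_unitz_def)

lemma bounded_linear_vec: "bounded_linear vec"
  by (rule bounded_linear_intro[of _ 1]) (simp_all add: norm_unitz_def)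

lemma bounded_linear_Unitz: "bounded_linear (Unitz 0)"
  by (rule bounded_linear_intro[of _ 1]) (simp_all add: norm_unitz_def unitz_eq_iff)

instance unitz :: (banach) banach
proof
  fix X :: "nat \<Rightarrow> 'a unitz" assume X: "Cauchy X"
  have "convergent (\<lambda>n. scal (X n))" "convergent (\<lambda>n. vec (X n))"
    using bounded_linear.Cauchy[OF bounded_linear_scal X] bounded_linear.Cauchy[OF bounded_linear_vec X]
    by (auto simp: Cauchy_convergent_iff)
  then obtain a b where ab: "(\<lambda>n. scal (X n)) \<longlonglongrightarrow> a" "(\<lambda>n. vec (X n)) \<longlonglongrightarrow> b"
    by (auto simp: convergent_def)
  have "(\<lambda>n. \<bar>scal (X n) - a\<bar> + norm (vec (X n) - b)) \<longlonglongrightarrow> \<bar>a - a\<bar> + norm (b - b)"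
    by (intro tendsto_intros ab)
  then have "(\<lambda>n. norm (X n - Unitz a b)) \<longlonglongrightarrow> 0"
    by (simp add: norm_unitz_def)
  then have "X \<longlonglongrightarrow> Unitz a b"
    by (simp add: LIM_zero_iff tendsto_norm_zero_iff)
  then show "convergent X" by (auto simp: convergent_def)
qed

instantiation unitz :: (real_normed_algebra) real_normed_algebra_1
begin
definition "1 = Unitz 1 0"
definition "m * n = Unitz (scal m * scal n) (scal m *\<^sub>R vec n + scal n *\<^sub>R vec m + vec m * vec n)"

lemma unitz_mult_simps [simp]:
  "scal (1 :: 'a unitz) = 1" "vec (1 :: 'a unitz) = 0"
  "scal (m * n) = scal m * scal n"
  "vec (m * n) = scal m *\<^sub>R vec n + scal n *\<^sub>R vec m + vec m * vec n" for m n :: "'a unitz"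
  by (simp_all add: one_unitz_def times_unitz_def)

instance
proof
  fix m n k :: "'a unitz" and a :: real
  show "m * n * k = m * (n * k)" "(m + n) * k = m * k + n * k" "m * (n + k) = m * n + m * k"
    "a *\<^sub>R m * n = a *\<^sub>R (m * n)" "m * a *\<^sub>R n = a *\<^sub>R (m * n)" "1 * m = m" "m * 1 = m"
    by (simp_all add: unitz_eq_iff algebra_simps)
  show "(0 :: 'a unitz) \<noteq> 1" by (simp add: unitz_eq_iff)
  show "norm (1 :: 'a unitz) = 1" by (simp add: norm_unitz_def)
  have "norm (m * n) \<le> \<bar>scal m\<bar> * \<bar>scal n\<bar> + (\<bar>scal m\<bar> * norm (vec n) + \<bar>scal n\<bar> * norm (vec m) + norm (vec m) * norm (vec n))"
    unfolding norm_unitz_def unitz_mult_simps abs_mult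
    by (intro add_mono order_refl norm_triangle_le norm_mult_ineq) simp_all
  then show "norm (m * n) \<le> norm m * norm n"
    by (simp add: norm_unitz_def algebra_simps)
qed
end

subsection \<open>Action on Hilbert-Schmidt kernels\<close>

definition act :: "hs unitz \<Rightarrow> hs \<Rightarrow> hs" where
  "act m x = scal m *\<^sub>R x + vec m * x"

definition uadj :: "hs unitz \<Rightarrow> hs unitz" where
  "uadj m = Unitz (scal m) (adj (vec m))"

lemma act_mult: "act (m * n) x = act m (act n x)"
  by (simp add: act_def algebra_simps)

lemma act_one [simp]: "act 1 x = x"
  by (simp add: act_def)

lemma act_diff_left: "act (m - n) x = act m x - act n x"
  by (simp add: act_def algebra_simps)

lemma act_add_left: "act (m + n) x = act m x + act n x"
  by (simp add: act_def algebra_simps)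

lemma norm_act_le: "norm (act m x) \<le> norm m * norm x"
proof -
  have "norm (act m x) \<le> \<bar>scal m\<bar> * norm x + norm (vec m) * norm x"
    unfolding act_def by (intro norm_triangle_le add_mono norm_mult_ineq) simp
  then show ?thesis by (simp add: norm_unitz_def algebra_simps)
qed

lemma inner_act: "act m x \<bullet> y = x \<bullet> act (uadj m) y"
  by (simp add: act_def uadj_def inner_add_left inner_add_right inner_mult_left)

lemma uadj_mult: "uadj (m * n) = uadj n * uadj m"
  by (simp add: uadj_def unitz_eq_iff adj_add adj_scaleR adj_mult)

lemma scal_Unitz_power: "scal (Unitz 0 b ^ n) = (if n = 0 then 1 else 0)" for b :: "'a::real_normed_algebra"
  by (induction n) auto

lemma Unitz_power_Suc:
  "Unitz 0 b ^ Suc n = Unitz 0 (if n = 0 then b else b * vec (Unitz 0 b ^ n))" for b :: "'a::real_normed_algebra"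
  by (simp add: unitz_eq_iff scal_Unitz_power)

lemma scal_exp: "scal (exp (Unitz 0 b)) = 1" for b :: "'a::{real_normed_algebra,banach}"
proof -
  have "(\<lambda>n. scal (Unitz 0 b ^ n /\<^sub>R fact n)) sums scal (exp (Unitz 0 b))"
    by (intro bounded_linear.sums[OF bounded_linear_scal] exp_converges)
  moreover have "(\<lambda>n. scal (Unitz 0 b ^ n /\<^sub>R fact n)) = (\<lambda>n. if n = 0 then 1 else 0)"
    by (auto simp: fun_eq_iff scal_Unitz_power)
  ultimately show ?thesis
    using sums_If_finite_set[of "{0::nat}" "\<lambda>_. 1 :: real"] sums_unique2 by fastforce
qed

lemma vec_exp_sums: "(\<lambda>n. vec (Unitz 0 b ^ n) /\<^sub>R fact n) sums vec (exp (Unitz 0 b))"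
  for b :: "'a::{real_normed_algebra,banach}"
  using bounded_linear.sums[OF bounded_linear_vec exp_converges[of "Unitz 0 b"]] by simp

text \<open>The fixed points of a bounded linear \<open>P\<close> form a closed subspace; if it
  contains all powers of \<open>b\<close>, it contains the sum of the series for e^b - 1. Applied to
  the adjoint and to the cut-off to a square.\<close>

lemma vec_exp_fixed:
  fixes b :: "'a::{real_normed_algebra,banach}"
  assumes "bounded_linear P" "P b = b" "\<And>n. P (vec (Unitz 0 b ^ n)) = vec (Unitz 0 b ^ n) \<Longrightarrow>
    P (b * vec (Unitz 0 b ^ n)) = b * vec (Unitz 0 b ^ n)"
  shows "P (vec (exp (Unitz 0 b))) = vec (exp (Unitz 0 b))"
proof -
  interpret P: bounded_linear P by fact
  have "P (vec (Unitz 0 b ^ n)) = vec (Unitz 0 b ^ n)" for n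
  proof (induction n)
    case (Suc n)
    then show ?case
      using assms(2,3) by (subst (1 2) Unitz_power_Suc) simp
  qed (simp add: P.zero)
  then have "(\<lambda>n. vec (Unitz 0 b ^ n) /\<^sub>R fact n) sums P (vec (exp (Unitz 0 b)))"
    using P.sums[OF vec_exp_sums[of b]] by (simp add: P.scaleR)
  then show ?thesis
    using sums_unique2 vec_exp_sums by blast
qed

lemma Unitz_power_commute: "b * vec (Unitz 0 b ^ n) = vec (Unitz 0 b ^ n) * b"
  for b :: "'a::real_normed_algebra"
proof -
  have "vec (Unitz 0 b * Unitz 0 b ^ n) = vec (Unitz 0 b ^ n * Unitz 0 b)"
    by (simp add: power_commutes)
  then show ?thesis by (simp add: scal_Unitz_power)
qed

lemma uadj_exp:
  assumes "adj b = b"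
  shows "uadj (exp (Unitz 0 b)) = exp (Unitz 0 b)"
proof -
  have "adj (vec (exp (Unitz 0 b))) = vec (exp (Unitz 0 b))"
    using assms by (intro vec_exp_fixed bounded_linear_adj) (simp_all add: adj_mult Unitz_power_commute)
  then show ?thesis by (simp add: uadj_def unitz_eq_iff)
qed

lemma exp_Unitz_add: "exp (Unitz 0 (s *\<^sub>R b)) * exp (Unitz 0 (t *\<^sub>R b)) = exp (Unitz 0 ((s + t) *\<^sub>R b))"
  for b :: "'a::{real_normed_algebra,banach}"
proof -
  have "Unitz 0 (s *\<^sub>R b) * Unitz 0 (t *\<^sub>R b) = Unitz 0 (t *\<^sub>R b) * Unitz 0 (s *\<^sub>R b)"
    by (simp add: unitz_eq_iff)
  from exp_add_commuting[OF this] show ?thesis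
    by (simp add: plus_unitz_def scaleR_add_left)
qed

lemma norm_Unitz0 [simp]: "norm (Unitz 0 b) = norm b"
  by (simp add: norm_unitz_def)

text \<open>e^b is the square of the self-adjoint element e^(b/2).\<close>

lemma inner_act_exp:
  assumes "adj b = b"
  shows "x \<bullet> act (exp (Unitz 0 b)) x = (norm (act (exp (Unitz 0 ((1/2) *\<^sub>R b))) x))\<^sup>2"
proof -
  let ?e = "exp (Unitz 0 ((1/2) *\<^sub>R b))"
  have "exp (Unitz 0 b) = ?e * ?e"
    using exp_Unitz_add[of "1/2" b "1/2"] by simp
  moreover have "uadj ?e = ?e" using assms by (simp add: uadj_exp adj_scaleR)
  ultimately show ?thesis
    using inner_act[of ?e x "act ?e x"] by (simp add: act_mult power2_norm_eq_inner)
qed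

text \<open>From x = e^(-b/2) e^(b/2) x and the norm bound e^(|b|/2) for the first factor; squaring
  produces the constant e^(-|b|).\<close>

lemma exp_coercive:
  assumes "adj b = b"
  shows "exp (- norm b) * (norm x)\<^sup>2 \<le> x \<bullet> act (exp (Unitz 0 b)) x"
proof -
  let ?e = "exp (Unitz 0 ((1/2) *\<^sub>R b))" and ?e' = "exp (Unitz 0 ((-1/2) *\<^sub>R b))"
  have "?e' * ?e = 1"
    using exp_Unitz_add[of "-1/2" b "1/2"] by (simp flip: zero_unitz_def)
  then have "x = act ?e' (act ?e x)" by (simp flip: act_mult)
  then have "norm x \<le> norm ?e' * norm (act ?e x)" by (metis norm_act_le)
  also have "\<dots> \<le> exp (norm b / 2) * norm (act ?e x)"
    using norm_exp[of "Unitz 0 ((-1/2) *\<^sub>R b)"] by (intro mult_right_mono) auto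
  finally have "(norm x)\<^sup>2 \<le> (exp (norm b / 2) * norm (act ?e x))\<^sup>2"
    by (intro power_mono) auto
  also have "\<dots> = exp (norm b) * (norm (act ?e x))\<^sup>2"
    by (simp add: power_mult_distrib flip: exp_double)
  finally show ?thesis
    unfolding inner_act_exp[OF assms] by (simp add: exp_minus field_simps)
qed

section \<open>The flow in the algebra\<close>

lemma has_vector_derivative_iff_quotient:
  "(f has_vector_derivative f') (at t within S) \<longleftrightarrow>
    ((\<lambda>s. (f s - f t) /\<^sub>R (s - t)) \<longlongrightarrow> f') (at t within S)"
proof -
  have eq: "norm ((1 / norm (y - t)) *\<^sub>R (f y - (f t + (y - t) *\<^sub>R f'))) = norm ((f y - f t) /\<^sub>R (y - t) - f')"
    if "y \<noteq> t" for y
  proof -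
    have "f y - (f t + (y - t) *\<^sub>R f') = (y - t) *\<^sub>R ((f y - f t) /\<^sub>R (y - t) - f')"
      using that by (simp add: scaleR_diff_right)
    then show ?thesis
      using that by (simp only: norm_scaleR) simp
  qed
  have "(f has_vector_derivative f') (at t within S) \<longleftrightarrow>
    ((\<lambda>y. norm ((1 / norm (y - t)) *\<^sub>R (f y - (f t + (y - t) *\<^sub>R f')))) \<longlongrightarrow> 0) (at t within S)"
    unfolding has_vector_derivative_def has_derivative_within tendsto_norm_zero_iff
    by (simp add: bounded_linear_scaleR_left)
  also have "\<dots> \<longleftrightarrow> ((\<lambda>y. norm ((f y - f t) /\<^sub>R (y - t) - f')) \<longlongrightarrow> 0) (at t within S)"
    by (intro filterlim_cong refl) (use eq in \<open>auto simp: eventually_at_filter intro!: always_eventually\<close>)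
  also have "\<dots> \<longleftrightarrow> ((\<lambda>s. (f s - f t) /\<^sub>R (s - t)) \<longlongrightarrow> f') (at t within S)"
    by (simp add: tendsto_norm_zero_iff LIM_zero_iff)
  finally show ?thesis .
qed

definition flow_field :: "hs \<Rightarrow> hs" where
  "flow_field k = lo k * k - k * lo k"

lemmas bounded_linear_up = bounded_linear_trunc[OF upper_sets(1)]
lemmas bounded_linear_lo = bounded_linear_trunc[OF upper_sets(2)]
lemmas up_add = trunc_add[OF upper_sets(1)]
lemmas up_diff = trunc_diff[OF upper_sets(1)]
lemmas up_scaleR = trunc_scaleR[OF upper_sets(1)]
lemmas lo_add = trunc_add[OF upper_sets(2)]
lemmas norm_up_le = norm_trunc_le[OF upper_sets(1)]
lemmas norm_lo_le = norm_trunc_le[OF upper_sets(2)]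

lemma up_up [simp]: "up (up x) = up x"
  using trunc_trunc[OF upper_sets(1) upper_sets(1)] by simp

lemma act_exp: "act (exp (Unitz 0 b)) x = x + vec (exp (Unitz 0 b)) * x"
  by (simp add: act_def scal_exp)

text \<open>\<open>up\<close> is an orthogonal projection of the space of kernels, so this operator
  is left multiplication by e^b compressed to the upper triangular kernels, and the identity on the
  orthogonal complement.\<close>

lemma coercive_up:
  assumes "adj b = b"
  shows "coercive_operator (\<lambda>x. x + up (vec (exp (Unitz 0 b)) * up x)) (exp (- norm b))"
proof (rule coercive_operator.intro)
  interpret up: bounded_linear up by (rule bounded_linear_up)
  show "bounded_linear (\<lambda>x. x + up (vec (exp (Unitz 0 b)) * up x))"
    by (intro bounded_linear_add bounded_linear_ident up.bounded_linear_axioms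
      bounded_linear_compose[OF bounded_linear_up] bounded_linear_compose[OF bounded_linear_mult_right])
  fix x :: hs
  show "exp (- norm b) * (norm x)\<^sup>2 \<le> x \<bullet> (x + up (vec (exp (Unitz 0 b)) * up x))"
  proof (rule coercive_compression[where P = up])
    show "exp (- norm b) * (norm w)\<^sup>2 \<le> w \<bullet> (w + vec (exp (Unitz 0 b)) * w)" for w
      using exp_coercive[OF assms, of w] by (simp add: act_exp)
  qed (simp_all add: inner_trunc[OF upper_sets(1)])
qed simp

text \<open>For upper triangular \<open>x\<close> the equation says that (1 + s)(1 + x) has no
  strictly upper part. The inner \<open>up\<close> makes the left-hand side coercive on all kernels;
  a solution is then automatically upper triangular, see \<open>up_cplus\<close>.\<close>

definition cplus :: "hs \<Rightarrow> hs" where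
  "cplus s = (SOME x. x + up (s * up x) = - up s)"

context
  fixes b s :: hs
  assumes b: "adj b = b" and s: "s = vec (exp (Unitz 0 b))"
begin

interpretation T: coercive_operator "\<lambda>x. x + up (s * up x)" "exp (- norm b)"
  unfolding s by (rule coercive_up) (rule b)

lemma cplus_eq': "cplus s + up (s * up (cplus s)) = - up s"
  unfolding cplus_def by (rule someI_ex) (rule T.surj)

lemma up_cplus: "up (cplus s) = cplus s"
proof -
  have "cplus s = - up s - up (s * up (cplus s))"
    using cplus_eq' by (simp only: eq_diff_eq)
  also have "\<dots> = up (- s - s * up (cplus s))"
    using up_scaleR[of "-1" s] by (simp add: up_diff)
  finally have eq: "cplus s = up (- s - s * up (cplus s))" .
  then have "up (cplus s) = up (up (- s - s * up (cplus s)))" by (rule arg_cong)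
  also have "\<dots> = up (- s - s * up (cplus s))" by (rule up_up)
  also have "\<dots> = cplus s" by (rule eq[symmetric])
  finally show ?thesis .
qed

lemma cplus_eq: "cplus s + up (s * cplus s) = - up s"
  using cplus_eq' unfolding up_cplus .

lemma cplus_unique:
  assumes "up x = x" "x + up (s * x) = - up s"
  shows "x = cplus s"
  by (rule T.inj) (simp only: assms cplus_eq up_cplus)

text \<open>Stability: coercivity bounds the distance between an approximate and the exact solution
  by the residual. Continuity of C_+ in t rests on this.\<close>

lemma cplus_close:
  assumes "up x = x"
  shows "exp (- norm b) * norm (cplus s - x) \<le> norm (up s + x + up (s * x))"
proof -
  have "(cplus s - x) + up (s * up (cplus s - x)) = (cplus s + up (s * cplus s)) - (x + up (s * x))"
    by (simp add: up_diff assms up_cplus right_diff_distrib)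
  also have "\<dots> = - (up s + x + up (s * x))" unfolding cplus_eq by simp
  finally have "norm ((cplus s - x) + up (s * up (cplus s - x))) = norm (up s + x + up (s * x))"
    by (simp only: norm_minus_cancel)
  then show ?thesis
    using T.norm_lower[of "cplus s - x"] by (simp only:)
qed

end

section \<open>The triangular factorization (1 + s)(1 + c) = 1 + l at time t\<close>

locale kernel_flow =
  fixes k0 :: hs
  assumes adj_k0: "adj k0 = k0"
begin

definition M :: "real \<Rightarrow> hs unitz" where "M t = exp (t *\<^sub>R Unitz 0 (- k0))"
definition s :: "real \<Rightarrow> hs" where "s t = vec (M t)"
definition c :: "real \<Rightarrow> hs" where "c t = cplus (s t)"
definition l :: "real \<Rightarrow> hs" where "l t = s t + c t + s t * c t"
definition k :: "real \<Rightarrow> hs" where "k t = k0 + adj (c t) * k0 + (k0 + adj (c t) * k0) * l t"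

definition Cu where "Cu t = 1 + Unitz 0 (c t)"
definition Ca where "Ca t = 1 + Unitz 0 (adj (c t))"
definition Lu where "Lu t = 1 + Unitz 0 (l t)"

lemma M_eq: "M t = exp (Unitz 0 (- t *\<^sub>R k0))"
proof -
  have "t *\<^sub>R Unitz 0 (- k0) = Unitz 0 (- t *\<^sub>R k0)" by (simp add: unitz_eq_iff)
  then show ?thesis by (simp add: M_def)
qed

lemma s_eq: "s t = vec (exp (Unitz 0 (- t *\<^sub>R k0)))"
  by (simp add: s_def M_eq)

lemma M_eq_s: "M t = 1 + Unitz 0 (s t)"
  by (simp add: unitz_eq_iff s_def) (simp add: M_eq scal_exp)

lemma adj_tk0: "adj (- t *\<^sub>R k0) = - t *\<^sub>R k0"
  using adj_k0 adj_scaleR[of "- t" k0] by simp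

lemma uadj_M: "uadj (M t) = M t"
  unfolding M_eq by (rule uadj_exp[OF adj_tk0])

lemmas up_c = up_cplus[OF adj_tk0 s_eq, folded c_def]
  and c_eq = cplus_eq[OF adj_tk0 s_eq, folded c_def]
  and c_unique = cplus_unique[OF adj_tk0 s_eq, folded c_def]
  and c_close = cplus_close[OF adj_tk0 s_eq, folded c_def]

lemma up_s: "up (s t) = - c t - up (s t * c t)"
  using c_eq[of t] by (metis add_diff_cancel_left' add_uminus_conv_diff minus_add minus_minus)

lemma lo_l: "lo (l t) = l t"
proof -
  have "up (l t) = 0"
    by (simp add: l_def up_add up_c up_s)
  then show ?thesis by (simp add: lo_eq)
qed

text \<open>The solution formula contains S + S C, cut to \<zeta>2 \<ge> \<eta>, in the place of
  \<open>l\<close>. The summand \<open>c\<close> by which they differ is strictly upper triangular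
  and disappears in the truncation.\<close>

lemma lo_s_sc: "lo (s t + s t * c t) = l t"
proof -
  have "lo (s t + s t * c t) = lo (l t) - lo (c t)"
    using bounded_linear_lo by (simp add: l_def lo_add)
  also have "lo (c t) = 0" by (simp add: lo_eq up_c)
  finally show ?thesis by (simp add: lo_l)
qed

lemma M_Cu: "M t * Cu t = Lu t"
  by (simp add: M_eq_s Cu_def Lu_def l_def unitz_eq_iff)

lemma uadj_Cu: "uadj (Cu t) = Ca t" and uadj_Ca: "uadj (Ca t) = Cu t"
  by (simp_all add: uadj_def Cu_def Ca_def unitz_eq_iff)

lemma Ca_M: "Ca t * M t = uadj (Lu t)"
  by (simp flip: M_Cu add: uadj_mult uadj_Cu uadj_M)

lemma lo_adj_c: "lo (adj (c t)) = adj (c t)"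
  using adj_up[of "c t"] by (simp add: up_c)

text \<open>Both sides are self-adjoint, while the left-hand side differs from the identity by a lower
  triangular kernel; a self-adjoint lower triangular kernel vanishes.\<close>

lemma Ca_Lu: "Ca t * Lu t = 1"
proof -
  define w where "w = adj (c t) + l t + adj (c t) * l t"
  have w: "Ca t * Lu t = 1 + Unitz 0 w"
    by (simp add: Ca_def Lu_def w_def unitz_eq_iff)
  have "lo w = w"
    by (simp add: w_def lo_add lo_l lo_adj_c lo_mult)
  moreover have "uadj (Ca t * Lu t) = Ca t * Lu t"
    unfolding M_Cu[symmetric] by (simp add: uadj_mult uadj_M uadj_Cu uadj_Ca mult.assoc)
  then have "adj w = w" by (simp add: w uadj_def unitz_eq_iff)
  ultimately have "up w = w" by (metis adj_lo)
  with \<open>lo w = w\<close> have "w = 0" by (simp add: lo_eq)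
  then show ?thesis by (simp add: w unitz_eq_iff)
qed

section \<open>Differentiation of the factors and the Lax equation\<close>

lemma M_deriv: "(M has_vector_derivative - (Unitz 0 k0 * M t)) (at t)"
proof -
  have "Unitz 0 (- k0) = - Unitz 0 k0" by (simp add: unitz_eq_iff)
  then show ?thesis
    using exp_scaleR_has_vector_derivative_left[of "Unitz 0 (- k0)" t]
    unfolding M_def[abs_def] by simp
qed

definition s' where "s' t = vec (- (Unitz 0 k0 * M t))"

lemma s_deriv: "(s has_vector_derivative s' t) (at t)"
  using bounded_linear.has_vector_derivative[OF bounded_linear_vec M_deriv]
  by (simp add: s_def[abs_def] s'_def)

lemma s_tendsto: "(s \<longlongrightarrow> s t) (at t)"
  using has_vector_derivative_continuous[OF s_deriv[of t]] by (simp add: continuous_within)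

text \<open>\<open>c t\<close> is used as an approximate solution at time \<tau>: its residual is
  the upper part of (s \<tau> - s t)(1 + c t), and the inverse of the coercivity constant, exp (norm
  (\<tau> k0)), stays bounded near t.\<close>

lemma c_tendsto: "(c \<longlongrightarrow> c t) (at t)"
proof -
  have bnd: "norm (c \<tau> - c t) \<le> exp (norm (\<tau> *\<^sub>R k0)) * (norm (s \<tau> - s t) * (1 + norm (c t)))" for \<tau>
  proof -
    have "up (s \<tau>) + c t + up (s \<tau> * c t) = up ((s \<tau> - s t) + (s \<tau> - s t) * c t)"
      by (simp add: up_add up_diff up_s[of t] left_diff_distrib)
    then have "norm (up (s \<tau>) + c t + up (s \<tau> * c t)) \<le> norm ((s \<tau> - s t) + (s \<tau> - s t) * c t)"
      by (metis norm_up_le)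
    also have "\<dots> \<le> norm (s \<tau> - s t) + norm (s \<tau> - s t) * norm (c t)"
      by (intro norm_triangle_le add_left_mono norm_mult_ineq)
    finally have "exp (- norm (\<tau> *\<^sub>R k0)) * norm (c t - c \<tau>) \<le> norm (s \<tau> - s t) * (1 + norm (c t))"
      using c_close[OF up_c, of \<tau> t] by (simp add: distrib_left norm_minus_commute[of "c t" "c \<tau>"])
    then show ?thesis
      by (simp add: exp_minus field_simps norm_minus_commute[of "c t" "c \<tau>"])
  qed
  have "((\<lambda>\<tau>. exp (norm (\<tau> *\<^sub>R k0)) * (norm (s \<tau> - s t) * (1 + norm (c t)))) \<longlongrightarrow>
      exp (norm (t *\<^sub>R k0)) * (norm (s t - s t) * (1 + norm (c t)))) (at t)"
    by (intro tendsto_intros s_tendsto)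
  then have "((\<lambda>\<tau>. exp (norm (\<tau> *\<^sub>R k0)) * (norm (s \<tau> - s t) * (1 + norm (c t)))) \<longlongrightarrow> 0) (at t)" by simp
  moreover have "\<forall>\<^sub>F \<tau> in at t. norm (c \<tau> - c t) \<le> exp (norm (\<tau> *\<^sub>R k0)) * (norm (s \<tau> - s t) * (1 + norm (c t)))"
    by (intro always_eventually allI bnd)
  ultimately have "((\<lambda>\<tau>. c \<tau> - c t) \<longlongrightarrow> 0) (at t)"
    by (rule Lim_null_comparison[rotated])
  then show ?thesis by (simp add: LIM_zero_iff)
qed

lemma c_deriv_ex: "\<exists>c'. (c has_vector_derivative c') (at t)"
proof -
  interpret T: coercive_operator "\<lambda>x. x + up (s t * up x)" "exp (- norm (- t *\<^sub>R k0))"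
    unfolding s_eq by (rule coercive_up) (rule adj_tk0)
  define I where "I = inv (\<lambda>x. x + up (s t * up x))"
  interpret I: bounded_linear I unfolding I_def by (rule T.bounded_linear_inv)
  interpret up: bounded_linear up by (rule bounded_linear_up)
  \<comment> \<open>Subtracting the equations at \<tau> and t with the operator frozen at t gives an
    exact identity, linear in s \<tau> - s t. After division by \<tau> - t, continuity of
    \<open>c\<close> and the derivative of \<open>s\<close> suffice to pass to the limit.\<close>
  have diff: "c \<tau> - c t = - I (up ((s \<tau> - s t) + (s \<tau> - s t) * c \<tau>))" for \<tau>
  proof -
    have "(c \<tau> - c t) + up (s t * up (c \<tau> - c t)) = - up ((s \<tau> - s t) + (s \<tau> - s t) * c \<tau>)"
      by (simp add: up_c up_add up_diff up_s left_diff_distrib right_diff_distrib)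
    then have "I (- up ((s \<tau> - s t) + (s \<tau> - s t) * c \<tau>)) = c \<tau> - c t"
      unfolding I_def using T.inv_left by metis
    then show ?thesis by (simp add: linear_neg[OF I.linear])
  qed
  define q where "q \<tau> = (s \<tau> - s t) /\<^sub>R (\<tau> - t)" for \<tau>
  have "(c \<tau> - c t) /\<^sub>R (\<tau> - t) = - I (up (q \<tau> + q \<tau> * c \<tau>))" for \<tau>
    by (simp add: diff q_def I.scaleR up.scaleR flip: scaleR_add_right)
  moreover have "(q \<longlongrightarrow> s' t) (at t)"
    using s_deriv[of t] by (simp add: has_vector_derivative_iff_quotient q_def[abs_def])
  then have "((\<lambda>\<tau>. - I (up (q \<tau> + q \<tau> * c \<tau>))) \<longlongrightarrow> - I (up (s' t + s' t * c t))) (at t)"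
    by (intro tendsto_intros I.tendsto up.tendsto c_tendsto)
  ultimately show ?thesis
    by (auto simp: has_vector_derivative_iff_quotient)
qed

definition c' where "c' t = (SOME d. (c has_vector_derivative d) (at t))"

lemma c_deriv: "(c has_vector_derivative c' t) (at t)"
  unfolding c'_def by (rule someI_ex[OF c_deriv_ex])

text \<open>\<open>up\<close> is bounded and linear, so it commutes with differentiation.
  Triangularity of the derivative is what later allows the two triangular parts of \<open>k\<close>
  to be separated.\<close>

lemma up_c': "up (c' t) = c' t"
proof -
  have "((\<lambda>t. up (c t)) has_vector_derivative up (c' t)) (at t)"
    by (rule bounded_linear.has_vector_derivative[OF bounded_linear_up c_deriv])
  then show ?thesis
    using c_deriv by (simp add: up_c) (rule vector_derivative_unique_at)
qed

lemma Unitz_deriv: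
  "(f has_vector_derivative d) F \<Longrightarrow> ((\<lambda>t. Unitz 0 (f t)) has_vector_derivative Unitz 0 d) F"
  by (rule bounded_linear.has_vector_derivative[OF bounded_linear_Unitz])

lemma Cu_deriv: "(Cu has_vector_derivative Unitz 0 (c' t)) (at t)"
  unfolding Cu_def[abs_def] by (auto intro!: derivative_eq_intros Unitz_deriv c_deriv)

lemma Ca_deriv: "(Ca has_vector_derivative Unitz 0 (adj (c' t))) (at t)"
  unfolding Ca_def[abs_def]
  by (auto intro!: derivative_eq_intros Unitz_deriv bounded_linear.has_vector_derivative[OF bounded_linear_adj] c_deriv)

lemma Lu_deriv: "(Lu has_vector_derivative - (Unitz 0 k0 * Lu t) + M t * Unitz 0 (c' t)) (at t)"
proof -
  have "((\<lambda>t. M t * Cu t) has_vector_derivative M t * Unitz 0 (c' t) + - (Unitz 0 k0 * M t) * Cu t) (at t)"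
    by (intro has_vector_derivative_mult M_deriv Cu_deriv)
  then show ?thesis by (simp add: M_Cu mult.assoc)
qed

lemma Lu_continuous: "isCont Lu t" and Ca_continuous: "isCont Ca t"
  using has_vector_derivative_continuous[OF Lu_deriv] has_vector_derivative_continuous[OF Ca_deriv] by auto

lemma c_0: "c 0 = 0" and l_0: "l 0 = 0"
proof -
  have "s 0 = 0" by (simp add: s_def M_def)
  then have "c 0 = 0" using c_unique[of 0 0] bounded_linear_up by (simp add: linear_simps)
  with \<open>s 0 = 0\<close> show "c 0 = 0" "l 0 = 0" by (simp_all add: l_def)
qed

text \<open>The difference is an idempotent which depends continuously on \<open>t\<close> and vanishes at \<open>t = 0\<close>;
  a nonzero idempotent has norm at least one.\<close>

lemma Lu_Ca: "Lu t * Ca t = 1"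
proof -
  define e where "e t = 1 - Lu t * Ca t" for t
  have idem: "e t * e t = e t" for t
  proof -
    have "Lu t * Ca t * (Lu t * Ca t) = Lu t * (Ca t * Lu t) * Ca t" by (simp add: mult.assoc)
    then show ?thesis by (simp add: e_def Ca_Lu algebra_simps)
  qed
  have gap: "norm (e t) = 0 \<or> 1 \<le> norm (e t)" for t
    using norm_mult_ineq[of "e t" "e t"] idem[of t] mult_le_cancel_right1[of "norm (e t)" "norm (e t)"] by force
  have cont: "continuous_on UNIV (\<lambda>t. norm (e t))"
    unfolding e_def by (intro continuous_at_imp_continuous_on ballI continuous_intros Lu_continuous Ca_continuous)
  have conn: "connected (range (\<lambda>t. norm (e t)))"
    using connected_continuous_image[OF cont] by simp
  have e0: "norm (e 0) = 0"
    by (simp add: e_def Lu_def Ca_def c_0 l_0 flip: zero_unitz_def)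
  have "\<not> 1 \<le> norm (e t)"
  proof
    assume "1 \<le> norm (e t)"
    then have "1/2 \<in> range (\<lambda>t. norm (e t))"
      using connectedD_interval[OF conn, of "norm (e 0)" "norm (e t)" "1/2"] e0 by simp
    then obtain \<tau> where "1/2 = norm (e \<tau>)" by (rule rangeE)
    with gap[of \<tau>] show False by simp
  qed
  then have "e t = 0" using gap[of t] by simp
  then show ?thesis by (simp add: e_def)
qed

lemma k_unitz: "Unitz 0 (k t) = Ca t * Unitz 0 k0 * Lu t"
  by (simp add: unitz_eq_iff Ca_def Lu_def k_def)

definition L' where "L' t = - (Unitz 0 k0 * Lu t) + M t * Unitz 0 (c' t)"

text \<open>Differentiating Lu = M Cu gives L' = - k0 Lu + M c'. Multiplied by Ca from the left,
  this exhibits \<open>k\<close> as an upper triangular kernel minus the lower triangular kernel Ca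
  L', so the lower part of \<open>k\<close> can be read off.\<close>

lemma lo_k: "Unitz 0 (lo (k t)) = - (Ca t * L' t)"
proof -
  define l' where "l' = vec (L' t)"
  have scal: "scal (L' t) = 0" by (simp add: L'_def)
  have "(l has_vector_derivative l') (at t)"
    using bounded_linear.has_vector_derivative[OF bounded_linear_vec Lu_deriv[of t]]
    by (simp add: Lu_def[abs_def] l'_def L'_def)
  from bounded_linear.has_vector_derivative[OF bounded_linear_lo this] this
  have l': "lo l' = l'"
    by (simp add: lo_l) (rule vector_derivative_unique_at)
  have L': "L' t = Unitz 0 l'" using scal by (simp add: l'_def unitz_eq_iff)
  have "Ca t * L' t = - Unitz 0 (k t) + uadj (Lu t) * Unitz 0 (c' t)"
    by (simp add: L'_def k_unitz right_diff_distrib mult.assoc flip: Ca_M)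
  then have "Unitz 0 (k t) = uadj (Lu t) * Unitz 0 (c' t) - Ca t * Unitz 0 l'"
    by (simp add: L')
  then have k: "k t = (c' t + adj (l t) * c' t) - (l' + adj (c t) * l')"
    by (simp add: unitz_eq_iff uadj_def Lu_def Ca_def)
  have "up (adj (l t)) = adj (l t)" using adj_lo[of "l t"] by (simp add: lo_l)
  then have "up (c' t + adj (l t) * c' t) = c' t + adj (l t) * c' t"
    by (simp add: up_add up_mult up_c')
  moreover have "lo (l' + adj (c t) * l') = l' + adj (c t) * l'"
    by (simp add: lo_add lo_mult l' lo_adj_c)
  ultimately have "lo (k t) = - (l' + adj (c t) * l')"
    by (simp add: lo_eq k up_diff)
  then show ?thesis by (simp add: L' unitz_eq_iff Ca_def)
qed

text \<open>Ca Lu = 1 gives Ca' Lu = - Ca L' = lo k. As Ca and Lu are inverse to each other on both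
  sides, Ca' = (lo k) Ca and L' = - Lu (lo k), and the product rule for k = Ca k0 Lu produces the
  commutator.\<close>

lemma k_deriv: "(k has_vector_derivative flow_field (k t)) (at t)"
proof -
  let ?K = "Unitz 0 k0" and ?k = "Unitz 0 (k t)" and ?lk = "Unitz 0 (lo (k t))"
  have Lud: "(Lu has_vector_derivative L' t) (at t)" using Lu_deriv by (simp add: L'_def)
  have "((\<lambda>t. Ca t * Lu t) has_vector_derivative Ca t * L' t + Unitz 0 (adj (c' t)) * Lu t) (at t)"
    by (intro has_vector_derivative_mult Ca_deriv Lud)
  then have "Ca t * L' t + Unitz 0 (adj (c' t)) * Lu t = 0"
    by (simp add: Ca_Lu) (metis has_vector_derivative_const vector_derivative_unique_at)
  then have "Unitz 0 (adj (c' t)) * Lu t = ?lk"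
    by (simp add: lo_k add_eq_0_iff)
  then have "Unitz 0 (adj (c' t)) * (Lu t * Ca t) = ?lk * Ca t"
    by (simp flip: mult.assoc)
  then have Ca': "Unitz 0 (adj (c' t)) = ?lk * Ca t" by (simp add: Lu_Ca)
  have "Lu t * (Ca t * L' t) = - (Lu t * ?lk)" by (simp add: lo_k)
  then have L': "L' t = - (Lu t * ?lk)" by (simp add: Lu_Ca flip: mult.assoc)
  have "((\<lambda>t. Ca t * ?K * Lu t) has_vector_derivative
      (Ca t * ?K) * L' t + (Unitz 0 (adj (c' t)) * ?K) * Lu t) (at t)"
  proof (intro has_vector_derivative_mult Lud)
    show "((\<lambda>t. Ca t * ?K) has_vector_derivative Unitz 0 (adj (c' t)) * ?K) (at t)"
      by (rule bounded_linear.has_vector_derivative[OF bounded_linear_mult_left Ca_deriv])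
  qed
  moreover have "(Ca t * ?K) * L' t + (Unitz 0 (adj (c' t)) * ?K) * Lu t = ?lk * ?k - ?k * ?lk"
    unfolding k_unitz Ca' L' by (simp add: mult.assoc)
  ultimately have "((\<lambda>t. Unitz 0 (k t)) has_vector_derivative ?lk * ?k - ?k * ?lk) (at t)"
    by (simp add: k_unitz)
  from bounded_linear.has_vector_derivative[OF bounded_linear_vec this]
  show ?thesis by (simp add: flow_field_def)
qed

lemma k_0: "k 0 = k0"
  by (simp add: k_def c_0 l_0)

end

subsection \<open>Uniqueness\<close>

text \<open>Gronwall in differential form: e^(-2 \<Lambda> t) |D t|^2 has nonpositive derivative and
  vanishes at 0. The square is taken because the norm itself need not be differentiable where
  \<open>D\<close> vanishes.\<close>

lemma gronwall_zero:
  fixes D :: "real \<Rightarrow> 'a::real_inner"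
  assumes "0 \<le> T" "D 0 = 0"
    and D: "\<And>t. t \<in> {0..T} \<Longrightarrow> (D has_vector_derivative D' t) (at t within {0..T})"
    and bound: "\<And>t. t \<in> {0..T} \<Longrightarrow> norm (D' t) \<le> \<Lambda> * norm (D t)"
  shows "D T = 0"
proof (cases "T = 0")
  case False
  define \<phi> where "\<phi> t = exp (- 2 * \<Lambda> * t) * (D t \<bullet> D t)" for t
  have "\<phi> 0 \<ge> \<phi> T"
  proof (rule DERIV_nonpos_imp_decreasing_open[where f = \<phi> and a = 0 and b = T])
    fix t assume t: "0 < t" "t < T"
    have Dt: "(D has_vector_derivative D' t) (at t)"
      using D[of t] t by (simp add: at_within_Icc_at)
    have "((\<lambda>t. D t \<bullet> D t) has_vector_derivative D t \<bullet> D' t + D' t \<bullet> D t) (at t)"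
      by (rule bounded_bilinear.has_vector_derivative[OF bounded_bilinear_inner Dt Dt])
    then have "((\<lambda>t. D t \<bullet> D t) has_real_derivative 2 * (D t \<bullet> D' t)) (at t)"
      by (simp add: has_real_derivative_iff_has_vector_derivative inner_commute)
    then have "(\<phi> has_real_derivative exp (- 2 * \<Lambda> * t) * (2 * (D t \<bullet> D' t) - 2 * \<Lambda> * (D t \<bullet> D t))) (at t)"
      unfolding \<phi>_def by (auto intro!: derivative_eq_intros simp: algebra_simps)
    moreover have "D t \<bullet> D' t \<le> \<Lambda> * (D t \<bullet> D t)"
    proof -
      have "D t \<bullet> D' t \<le> norm (D t) * norm (D' t)" by (rule norm_cauchy_schwarz)
      also have "\<dots> \<le> norm (D t) * (\<Lambda> * norm (D t))"
        using bound[of t] t by (intro mult_left_mono) auto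
      finally show ?thesis by (simp add: dot_square_norm power2_eq_square mult_ac)
    qed
    then have "exp (- 2 * \<Lambda> * t) * (2 * (D t \<bullet> D' t) - 2 * \<Lambda> * (D t \<bullet> D t)) \<le> 0"
      by (intro mult_nonneg_nonpos) auto
    ultimately show "\<exists>y. (\<phi> has_real_derivative y) (at t) \<and> y \<le> 0"
      by blast
  next
    have "continuous_on {0..T} D"
      by (rule continuous_on_vector_derivative) (rule D)
    then show "continuous_on {0..T} \<phi>"
      unfolding \<phi>_def by (intro continuous_intros)
  qed (use assms in auto)
  then have "D T \<bullet> D T \<le> 0" by (simp add: \<phi>_def assms(2) mult_le_0_iff)
  then show ?thesis by (metis antisym inner_eq_zero_iff inner_ge_zero)
qed (use assms in simp)

text \<open>The commutator is quadratic, so its difference telescopes into four products, each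
  containing x - y once; \<open>lo\<close> does not increase the norm.\<close>

lemma flow_field_lipschitz:
  "norm (flow_field x - flow_field y) \<le> 2 * (norm x + norm y) * norm (x - y)"
proof -
  have eq: "flow_field x - flow_field y = (lo (x - y) * x + lo y * (x - y)) - ((x - y) * lo x + y * lo (x - y))"
    using bounded_linear_lo by (simp add: flow_field_def trunc_diff[OF upper_sets(2)] algebra_simps)
  have b: "norm (a * b) \<le> A * B" if "norm a \<le> A" "norm b \<le> B" for a b :: hs and A B
    by (rule order_trans[OF norm_mult_ineq mult_mono[OF that]]) (use that norm_ge_zero[of a] norm_ge_zero[of b] in linarith)+
  have "norm (flow_field x - flow_field y) \<le>
    (norm (x - y) * norm x + norm y * norm (x - y)) + (norm (x - y) * norm x + norm y * norm (x - y))"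
    unfolding eq by (intro norm_triangle_le_diff norm_triangle_le add_mono b order_refl norm_lo_le)
  then show ?thesis by (simp add: algebra_simps)
qed

text \<open>The sign \<sigma> covers both directions of time. Solutions are bounded on the compact
  interval, which gives a uniform Lipschitz constant for Gronwall's lemma.\<close>

lemma flow_unique_forward:
  fixes x y :: "real \<Rightarrow> hs"
  assumes "0 \<le> T" "x 0 = y 0" "\<bar>\<sigma>\<bar> = 1"
    and x: "\<And>t. t \<in> {0..T} \<Longrightarrow> (x has_vector_derivative \<sigma> *\<^sub>R flow_field (x t)) (at t within {0..T})"
    and y: "\<And>t. t \<in> {0..T} \<Longrightarrow> (y has_vector_derivative \<sigma> *\<^sub>R flow_field (y t)) (at t within {0..T})"
  shows "x T = y T"
proof -
  have "continuous_on {0..T} x" "continuous_on {0..T} y"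
    by (rule continuous_on_vector_derivative, erule x, rule continuous_on_vector_derivative, erule y)
  then have "bounded (x ` {0..T})" "bounded (y ` {0..T})"
    by (simp_all add: compact_imp_bounded compact_continuous_image)
  then obtain A B where "\<forall>z\<in>x ` {0..T}. norm z \<le> A" "\<forall>z\<in>y ` {0..T}. norm z \<le> B"
    unfolding bounded_iff by blast
  then have AB: "norm (x t) \<le> A" "norm (y t) \<le> B" if "t \<in> {0..T}" for t
    using that by blast+
  have "x T - y T = 0"
  proof (rule gronwall_zero)
    fix t assume t: "t \<in> {0..T}"
    show "((\<lambda>t. x t - y t) has_vector_derivative \<sigma> *\<^sub>R flow_field (x t) - \<sigma> *\<^sub>R flow_field (y t)) (at t within {0..T})"
      by (intro has_vector_derivative_diff x y t)
    have "norm (\<sigma> *\<^sub>R flow_field (x t) - \<sigma> *\<^sub>R flow_field (y t)) = norm (flow_field (x t) - flow_field (y t))"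
      using assms(3) by (simp flip: scaleR_diff_right)
    also have "\<dots> \<le> 2 * (norm (x t) + norm (y t)) * norm (x t - y t)"
      by (rule flow_field_lipschitz)
    also have "\<dots> \<le> 2 * (A + B) * norm (x t - y t)"
      using AB[OF t] by (intro mult_right_mono mult_left_mono add_mono) auto
    finally show "norm (\<sigma> *\<^sub>R flow_field (x t) - \<sigma> *\<^sub>R flow_field (y t)) \<le> 2 * (A + B) * norm (x t - y t)" .
  qed (use assms in auto)
  then show ?thesis by simp
qed

text \<open>The segment from 0 to T, on either side of 0, is parametrized by \<sigma> t with t in
  [0, |T|]; an interval containing 0 and T contains it.\<close>

lemma flow_unique:
  fixes x y :: "real \<Rightarrow> hs"
  assumes J: "is_interval J" "0 \<in> J" "T \<in> J" and "x 0 = y 0"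
    and x: "\<And>t. t \<in> J \<Longrightarrow> (x has_vector_derivative flow_field (x t)) (at t within J)"
    and y: "\<And>t. t \<in> J \<Longrightarrow> (y has_vector_derivative flow_field (y t)) (at t within J)"
  shows "x T = y T"
proof -
  define \<sigma> where "\<sigma> = (if T \<ge> 0 then 1 else -1 :: real)"
  have sub: "(\<lambda>t. \<sigma> * t) ` {0..\<bar>T\<bar>} \<subseteq> J"
  proof
    fix u assume "u \<in> (\<lambda>t. \<sigma> * t) ` {0..\<bar>T\<bar>}"
    then have "0 \<le> u \<and> u \<le> T \<or> T \<le> u \<and> u \<le> 0"
      by (auto simp: \<sigma>_def split: if_splits)
    then show "u \<in> J"
      using mem_is_interval_1_I[OF J(1,2,3)] mem_is_interval_1_I[OF J(1,3,2)] by blast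
  qed
  have *: "((\<lambda>t. z (\<sigma> * t)) has_vector_derivative \<sigma> *\<^sub>R flow_field (z (\<sigma> * t))) (at t within {0..\<bar>T\<bar>})"
    if z: "\<And>t. t \<in> J \<Longrightarrow> (z has_vector_derivative flow_field (z t)) (at t within J)"
      and t: "t \<in> {0..\<bar>T\<bar>}" for z :: "real \<Rightarrow> hs" and t
  proof -
    have "((\<lambda>t. \<sigma> * t) has_vector_derivative \<sigma>) (at t within {0..\<bar>T\<bar>})"
      by (auto intro!: derivative_eq_intros simp flip: has_real_derivative_iff_has_vector_derivative)
    moreover have "(z has_vector_derivative flow_field (z (\<sigma> * t))) (at (\<sigma> * t) within (\<lambda>t. \<sigma> * t) ` {0..\<bar>T\<bar>})"
    proof (rule has_vector_derivative_within_subset[OF z sub])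
      show "\<sigma> * t \<in> J" using sub t by (auto simp only: image_subset_iff)
    qed
    ultimately show ?thesis
      using vector_diff_chain_within[of "\<lambda>t. \<sigma> * t" \<sigma> t "{0..\<bar>T\<bar>}" z] by (simp add: o_def)
  qed
  have "x (\<sigma> * \<bar>T\<bar>) = y (\<sigma> * \<bar>T\<bar>)"
  proof (rule flow_unique_forward[where \<sigma> = \<sigma> and x = "\<lambda>t. x (\<sigma> * t)" and y = "\<lambda>t. y (\<sigma> * t)"])
    show "\<bar>\<sigma>\<bar> = 1" by (simp add: \<sigma>_def)
  qed (use assms(4) *[OF x] *[OF y] in auto)
  then show ?thesis by (simp add: \<sigma>_def split: if_splits)
qed

section \<open>Principal minors of positive matrices\<close>

definition quad :: "(nat \<Rightarrow> nat \<Rightarrow> real) \<Rightarrow> nat set \<Rightarrow> (nat \<Rightarrow> real) \<Rightarrow> real" where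
  "quad a J v = (\<Sum>i\<in>J. \<Sum>j\<in>J. v i * v j * a i j)"

abbreviation delta :: "nat \<Rightarrow> nat \<Rightarrow> real" where
  "delta i \<equiv> \<lambda>k. if k = i then 1 else 0"

definition schur :: "(nat \<Rightarrow> nat \<Rightarrow> real) \<Rightarrow> nat \<Rightarrow> nat \<Rightarrow> nat \<Rightarrow> real" where
  "schur a i j k = a j k - a j i * a i k / a i i"

lemma principal_minor_cong:
  assumes "\<And>i j. i \<in> J \<Longrightarrow> j \<in> J \<Longrightarrow> a i j = b i j"
  shows "principal_minor a J = principal_minor b J"
  unfolding principal_minor_def
  by (intro sum.cong arg_cong2[of _ _ _ _ "(*)"] prod.cong refl) (auto simp: assms permutes_in_image)

lemma principal_minor_row_add:
  assumes "finite J" "j \<in> J"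
  shows "principal_minor (a(j := \<lambda>k. r k + c * r' k)) J =
    principal_minor (a(j := r)) J + c * principal_minor (a(j := r')) J"
proof -
  have "(\<Prod>i\<in>J. (a(j := q)) i (p i)) = q (p j) * (\<Prod>i\<in>J - {j}. a i (p i))" for p q
    using assms by (subst prod.remove[of _ j]) (auto intro!: prod.cong)
  then show ?thesis
    unfolding principal_minor_def by (simp add: algebra_simps sum.distrib sum_distrib_left)
qed

lemma principal_minor_identical_rows:
  assumes J: "finite J" "i \<in> J" "j \<in> J" "i \<noteq> j" and "a i = a j"
  shows "principal_minor a J = 0"
proof -
  let ?\<tau> = "Transposition.transpose i j"
  have \<tau>: "?\<tau> permutes J" using J by (intro permutes_swap_id)
  have "principal_minor a J = (\<Sum>p | p permutes J. of_int (sign (p \<circ> ?\<tau>)) * (\<Prod>i\<in>J. a i ((p \<circ> ?\<tau>) i)))"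
    unfolding principal_minor_def by (rule sum_permutations_compose_right[OF \<tau>])
  also have "\<dots> = (\<Sum>p | p permutes J. - (of_int (sign p) * (\<Prod>i\<in>J. a i (p i))))"
  proof (rule sum.cong)
    fix p assume "p \<in> {p. p permutes J}"
    then have "permutation p" using J by (auto simp: permutation_permutes)
    then have "sign (p \<circ> ?\<tau>) = - sign p"
      using J by (simp add: sign_compose permutation_swap_id sign_swap_id)
    moreover have "(\<Prod>k\<in>J. a k ((p \<circ> ?\<tau>) k)) = (\<Prod>k\<in>J. a (?\<tau> k) (p (?\<tau> k)))"
      using assms(5) by (intro prod.cong refl) (auto simp: Transposition.transpose_def)
    moreover have "\<dots> = (\<Prod>k\<in>J. a k (p k))"
      using prod.permute[OF \<tau>, of "\<lambda>k. a k (p k)"] by (simp add: o_def)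
    ultimately show "of_int (sign (p \<circ> ?\<tau>)) * (\<Prod>i\<in>J. a i ((p \<circ> ?\<tau>) i)) = - (of_int (sign p) * (\<Prod>i\<in>J. a i (p i)))"
      by simp
  qed simp
  also have "\<dots> = - principal_minor a J" by (simp add: principal_minor_def sum_negf)
  finally show ?thesis by simp
qed

lemma principal_minor_zero_column:
  assumes "finite J" "i \<notin> J" "\<And>j. j \<in> J \<Longrightarrow> a j i = 0"
  shows "principal_minor a (insert i J) = a i i * principal_minor a J"
proof -
  have "principal_minor a (insert i J) = (\<Sum>p | p permutes J. of_int (sign p) * (\<Prod>k\<in>insert i J. a k (p k)))"
    unfolding principal_minor_def
  proof (rule sum.mono_neutral_right)
    show "finite {p. p permutes insert i J}" using assms by (intro finite_permutations) auto
    show "{p. p permutes J} \<subseteq> {p. p permutes insert i J}"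
      by (auto intro: permutes_subset)
    show "\<forall>p\<in>{p. p permutes insert i J} - {p. p permutes J}. of_int (sign p) * (\<Prod>k\<in>insert i J. a k (p k)) = 0"
    proof
      fix p assume "p \<in> {p. p permutes insert i J} - {p. p permutes J}"
      then have p: "p permutes insert i J" "\<not> p permutes J" by auto
      then have "p i \<noteq> i" using permutes_superset[of p "insert i J" J] by auto
      obtain j where j: "j \<in> insert i J" "p j = i"
        using permutes_image[OF p(1)] by (metis imageE insertI1)
      with \<open>p i \<noteq> i\<close> have "j \<in> J" by auto
      then have "(\<Prod>k\<in>insert i J. a k (p k)) = 0"
        using assms j by (intro prod_zero) auto
      then show "of_int (sign p) * (\<Prod>k\<in>insert i J. a k (p k)) = 0" by simp
    qed
  qed
  also have "\<dots> = a i i * principal_minor a J"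
    unfolding principal_minor_def sum_distrib_left
    using assms by (intro sum.cong refl) (auto simp: permutes_not_in)
  finally show ?thesis .
qed

text \<open>Gaussian elimination: the rows in \<open>J\<close> are reduced against row
  \<open>i\<close> one at a time (\<open>T\<close> collects those already done), which leaves the
  determinant unchanged. Afterwards column \<open>i\<close> vanishes off the pivot, and expansion
  along it leaves the Schur complement.\<close>

lemma principal_minor_schur:
  assumes J: "finite J" "i \<notin> J" and "a i i \<noteq> 0"
  shows "principal_minor a (insert i J) = a i i * principal_minor (schur a i) J"
proof -
  define b where "b T j k = (if j \<in> T then schur a i j k else a j k)" for T j k
  have "principal_minor (b T) (insert i J) = principal_minor a (insert i J)" if "finite T" "T \<subseteq> J" for T
    using that
  proof (induction T)
    case empty
    then show ?case by (simp add: b_def)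
  next
    case (insert j T)
    let ?c = "- (a j i / a i i)"
    have j: "j \<in> insert i J" "j \<noteq> i" "i \<notin> T" using insert J by auto
    have "b (insert j T) = (b T)(j := \<lambda>k. a j k + ?c * b T i k)"
      using j by (auto simp: b_def schur_def fun_eq_iff)
    then have "principal_minor (b (insert j T)) (insert i J) =
        principal_minor ((b T)(j := a j)) (insert i J) + ?c * principal_minor ((b T)(j := b T i)) (insert i J)"
      using principal_minor_row_add[of "insert i J" j "b T" "a j" ?c "b T i"] j J by simp
    moreover have "principal_minor ((b T)(j := b T i)) (insert i J) = 0"
      using j J by (intro principal_minor_identical_rows[of _ i j]) auto
    moreover have "(b T)(j := a j) = b T" using insert by (auto simp: b_def fun_eq_iff)
    ultimately show ?case using insert by simp
  qed
  then have "principal_minor a (insert i J) = principal_minor (b J) (insert i J)" using J by simp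
  also have "\<dots> = b J i i * principal_minor (b J) J"
    using J assms(3) by (intro principal_minor_zero_column) (auto simp: b_def schur_def)
  also have "principal_minor (b J) J = principal_minor (schur a i) J"
    by (rule principal_minor_cong) (simp add: b_def)
  finally show ?thesis using J by (simp add: b_def)
qed

lemma quad_insert:
  assumes "finite J" "i \<notin> J" "\<And>j k. a j k = a k j"
  shows "quad a (insert i J) v = a i i * (v i)\<^sup>2 + 2 * v i * (\<Sum>j\<in>J. a i j * v j) + quad a J v"
proof -
  have "(\<Sum>j\<in>J. v j * v i * a j i) = v i * (\<Sum>j\<in>J. a i j * v j)" "(\<Sum>j\<in>J. v i * v j * a i j) = v i * (\<Sum>j\<in>J. a i j * v j)"
    using assms(3) by (simp_all add: sum_distrib_left mult_ac)
  then show ?thesis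
    using assms(1,2) by (simp add: quad_def sum.distrib power2_eq_square mult_ac)
qed

lemma quad_schur:
  assumes "finite J" "\<And>j k. a j k = a k j"
  shows "quad (schur a i) J v = quad a J v - (\<Sum>j\<in>J. a i j * v j)\<^sup>2 / a i i"
proof -
  have e: "schur a i j k = a j k - a i j * a i k / a i i" for j k
    unfolding schur_def assms(2)[of j i] ..
  have "(\<Sum>j\<in>J. a i j * v j)\<^sup>2 / a i i = (\<Sum>j\<in>J. \<Sum>k\<in>J. v j * v k * (a i j * a i k / a i i))"
    by (simp add: power2_eq_square sum_product sum_divide_distrib mult_ac)
  then show ?thesis
    by (simp add: quad_def e right_diff_distrib sum_subtractf)
qed

text \<open>The value inserted at \<open>i\<close> is the critical point of the form in that
  coordinate, where the completed square vanishes. Hence lower bounds on the form pass to the Schur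
  complement.\<close>

lemma quad_complete_square:
  assumes "finite J" "i \<notin> J" "\<And>j k. a j k = a k j" "a i i \<noteq> 0"
  shows "quad a (insert i J) (v(i := - (\<Sum>j\<in>J. a i j * v j) / a i i)) = quad (schur a i) J v"
proof -
  let ?B = "\<Sum>j\<in>J. a i j * v j" and ?w = "v(i := - (\<Sum>j\<in>J. a i j * v j) / a i i)"
  have "(\<Sum>j\<in>J. a i j * ?w j) = ?B" "quad a J ?w = quad a J v"
    using assms(2) by (auto intro!: sum.cong simp: quad_def)
  then show ?thesis
    using assms by (simp add: quad_insert quad_schur field_simps power2_eq_square)
qed

lemma quad_single:
  assumes "finite J" "i \<in> J"
  shows "quad a J (\<lambda>j. if j = i then s else 0) = a i i * s\<^sup>2"
proof -
  have "quad a J (\<lambda>j. if j = i then s else 0) = (\<Sum>k\<in>J. \<Sum>j\<in>J. if j = i then (if k = i then s * s * a i i else 0) else 0)"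
    unfolding quad_def by (intro sum.cong refl) auto
  then show ?thesis using assms by (simp add: power2_eq_square mult.commute)
qed

lemma schur_sym: "(\<And>j k. a j k = a k j) \<Longrightarrow> schur a i j k = schur a i k j"
  by (simp add: schur_def mult.commute)

text \<open>Hadamard's inequality, by induction over Schur complements: these are again positive
  semidefinite, with diagonal entries no larger than the original ones. A zero pivot forces its
  whole row, and so the minor, to vanish.\<close>

lemma principal_minor_psd:
  assumes "finite J" "\<And>j k. a j k = a k j" "\<And>v. 0 \<le> quad a J v"
  shows "0 \<le> principal_minor a J \<and> principal_minor a J \<le> (\<Prod>j\<in>J. a j j)"
  using assms
proof (induction J arbitrary: a rule: finite_induct)
  case empty
  then show ?case by (simp add: principal_minor_def sign_id)
next
  case (insert i J)
  have diag: "0 \<le> a j j" if "j \<in> insert i J" for j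
    using insert.prems(2)[of "delta j"] insert.hyps that quad_single[of "insert i J" j a 1] by simp
  show ?case
  proof (cases "a i i = 0")
    case True
    have row: "a i j = 0" if j: "j \<in> J" for j
    proof (rule ccontr)
      assume nz: "a i j \<noteq> 0"
      \<comment> \<open>With a zero pivot, the form at the vector with entries \<open>r\<close> at
        \<open>i\<close> and 1 at \<open>j\<close> equals 2 r a i j + a j j; this \<open>r\<close>
        makes it -1.\<close>
      define r where "r = - (a j j + 1) / (2 * a i j)"
      let ?v = "(delta j)(i := r)"
      have "quad a J ?v = quad a J (delta j)"
        unfolding quad_def using insert.hyps by (intro sum.cong refl) auto
      moreover have "(\<Sum>k\<in>J. a i k * ?v k) = (\<Sum>k\<in>J. if k = j then a i j else 0)"
        using insert.hyps by (intro sum.cong refl) auto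
      ultimately have "quad a (insert i J) ?v = 2 * r * a i j + a j j"
        using insert.hyps j True quad_single[OF insert.hyps(1) j, of a 1]
        by (subst quad_insert) (simp_all add: insert.prems(1))
      also have "2 * r * a i j = - (a j j + 1)" using nz by (simp add: r_def)
      also have "- (a j j + 1) + a j j = - 1" by simp
      finally show False using insert.prems(2)[of ?v] by simp
    qed
    have "(\<Prod>k\<in>insert i J. a k (p k)) = 0" if "p permutes insert i J" for p
    proof -
      have "p i \<in> insert i J" using permutes_in_image[OF that, of i] by blast
      then have "a i (p i) = 0" using row True by auto
      then show ?thesis using insert.hyps by simp
    qed
    then have "principal_minor a (insert i J) = 0"
      unfolding principal_minor_def by (intro sum.neutral) auto
    then show ?thesis using True insert.hyps by simp
  next
    case False
    then have pos: "0 < a i i" using diag[of i] by simp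
    have IH: "0 \<le> principal_minor (schur a i) J \<and> principal_minor (schur a i) J \<le> (\<Prod>j\<in>J. schur a i j j)"
    proof (rule insert.IH)
      show "schur a i j k = schur a i k j" for j k using insert.prems(1) by (rule schur_sym)
      show "0 \<le> quad (schur a i) J v" for v
        unfolding quad_complete_square[where a = a and i = i and v = v, OF insert.hyps insert.prems(1) False, symmetric]
        by (rule insert.prems(2))
    qed
    have "0 \<le> schur a i j j \<and> schur a i j j \<le> a j j" if j: "j \<in> J" for j
    proof
      have "0 \<le> quad (schur a i) J (delta j)"
        unfolding quad_complete_square[where a = a and i = i, OF insert.hyps insert.prems(1) False, symmetric]
        by (rule insert.prems(2))
      then show "0 \<le> schur a i j j" using quad_single[OF insert.hyps(1) j, of "schur a i" 1] by simp
      have "0 \<le> a j i * a i j / a i i" using insert.prems(1)[of i j] pos by simp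
      then show "schur a i j j \<le> a j j" by (simp add: schur_def)
    qed
    then have "(\<Prod>j\<in>J. schur a i j j) \<le> (\<Prod>j\<in>J. a j j)" by (intro prod_mono) auto
    with IH have "principal_minor (schur a i) J \<le> (\<Prod>j\<in>J. a j j)" by linarith
    then have "a i i * principal_minor (schur a i) J \<le> a i i * (\<Prod>j\<in>J. a j j)"
      using pos by (intro mult_left_mono) auto
    moreover have "0 \<le> a i i * principal_minor (schur a i) J" using pos IH by simp
    ultimately show ?thesis
      using insert.hyps by (simp add: principal_minor_schur[where a = a and i = i, OF insert.hyps False])
  qed
qed

text \<open>The hypothesis says that the quadratic form \<open>R\<close> dominates the one of the inverse matrix.
  It is inherited by Schur complements, and it bounds each pivot from below by \<open>1 / h\<close>.\<close>

lemma principal_minor_lower_bound: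
  assumes "finite J" "\<And>j k. a j k = a k j"
    and "\<And>x v. (\<And>j. j \<notin> J \<Longrightarrow> x j = 0) \<Longrightarrow> 2 * (\<Sum>j\<in>J. x j * v j) \<le> quad a J v + R x"
    and "\<And>j. j \<in> J \<Longrightarrow> R (delta j) = h j"
  shows "(\<Prod>j\<in>J. 1 / h j) \<le> principal_minor a J \<and> (\<forall>j\<in>J. 0 < h j)"
  using assms
proof (induction J arbitrary: a rule: finite_induct)
  case empty
  then show ?case by (simp add: principal_minor_def sign_id)
next
  case (insert i J)
  \<comment> \<open>Both test vectors are concentrated at \<open>i\<close>: x = delta i and v = r
    delta i. Then r = h i + 1 excludes a nonpositive pivot, and r = 1 / a i i gives the bound 1 / h
    i.\<close>
  have piv: "2 * r \<le> a i i * r\<^sup>2 + h i" for r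
  proof -
    have "(\<Sum>j\<in>insert i J. (if j = i then 1 else 0) * (if j = i then r else 0)) = r"
      using insert.hyps by (simp add: if_distrib[of "\<lambda>x. x * _"] cong: if_cong)
    then show ?thesis
      using insert.prems(2)[of "delta i" "\<lambda>k. if k = i then r else 0"] insert.hyps
        insert.prems(3)[of i] quad_single[of "insert i J" i a r] by simp
  qed
  have h0: "0 \<le> h i" using piv[of 0] by simp
  have pos: "0 < a i i"
  proof (rule ccontr)
    assume "\<not> 0 < a i i"
    then have "a i i * (h i + 1)\<^sup>2 \<le> 0" by (intro mult_nonpos_nonneg) auto
    from order_trans[OF piv[of "h i + 1"] add_right_mono[OF this]] show False using h0 by simp
  qed
  have h: "1 / a i i \<le> h i"
    using piv[of "1 / a i i"] pos by (simp add: power2_eq_square)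
  then have h_pos: "0 < h i" using pos by (meson less_le_trans zero_less_divide_1_iff)
  with h pos have piv_le: "1 / h i \<le> a i i" by (simp add: field_simps)
  have IH: "(\<Prod>j\<in>J. 1 / h j) \<le> principal_minor (schur a i) J \<and> (\<forall>j\<in>J. 0 < h j)"
  proof (rule insert.IH)
    show "schur a i j k = schur a i k j" for j k using insert.prems(1) by (rule schur_sym)
    show "2 * (\<Sum>j\<in>J. x j * v j) \<le> quad (schur a i) J v + R x" if x: "\<And>j. j \<notin> J \<Longrightarrow> x j = 0" for x v
    proof -
      let ?w = "v(i := - (\<Sum>j\<in>J. a i j * v j) / a i i)"
      have "(\<Sum>j\<in>insert i J. x j * ?w j) = (\<Sum>j\<in>J. x j * v j)"
        using insert.hyps x[of i] by (auto intro!: sum.cong)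
      moreover have "2 * (\<Sum>j\<in>insert i J. x j * ?w j) \<le> quad a (insert i J) ?w + R x"
        using x by (intro insert.prems(2)) auto
      ultimately show ?thesis
        using quad_complete_square[where a = a and i = i and v = v, OF insert.hyps insert.prems(1)] pos by simp
    qed
  qed (use insert.prems(3) in auto)
  then have "1 / h i * (\<Prod>j\<in>J. 1 / h j) \<le> a i i * principal_minor (schur a i) J"
    using piv_le h_pos pos by (intro mult_mono prod_nonneg) (auto intro: less_imp_le)
  then show ?case
    using insert.hyps IH h_pos pos by (simp add: principal_minor_schur[where a = a and i = i])
qed

text \<open>Expansion of det(1 + a): the product over the rows is multiplied out over subsets
  \<open>J\<close>, and a permutation that moves a point outside \<open>J\<close> contributes zero.
  This identifies partial sums of the Fredholm series with finite determinants.\<close>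

lemma sum_principal_minors:
  assumes F: "finite F"
  shows "(\<Sum>J\<in>Pow F. principal_minor a J) = principal_minor (\<lambda>i j. of_bool (i = j) + a i j) F"
proof -
  have "principal_minor (\<lambda>i j. of_bool (i = j) + a i j) F =
    (\<Sum>p | p permutes F. \<Sum>J\<in>Pow F. of_int (sign p) * ((\<Prod>i\<in>J. a i (p i)) * (\<Prod>i\<in>F - J. of_bool (i = p i))))"
    unfolding principal_minor_def
    by (intro sum.cong refl) (simp add: sum_distrib_left prod_add[OF F] add.commute[of "of_bool _"])
  also have "\<dots> = (\<Sum>J\<in>Pow F. \<Sum>p | p permutes F. of_int (sign p) * ((\<Prod>i\<in>J. a i (p i)) * (\<Prod>i\<in>F - J. of_bool (i = p i))))"
    by (rule sum.swap)
  also have "\<dots> = (\<Sum>J\<in>Pow F. principal_minor a J)"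
  proof (rule sum.cong)
    fix J assume J: "J \<in> Pow F"
    have "(\<Sum>p | p permutes F. of_int (sign p) * ((\<Prod>i\<in>J. a i (p i)) * (\<Prod>i\<in>F - J. of_bool (i = p i)))) =
      (\<Sum>p | p permutes J. of_int (sign p) * ((\<Prod>i\<in>J. a i (p i)) * (\<Prod>i\<in>F - J. of_bool (i = p i))))"
    proof (rule sum.mono_neutral_right)
      show "finite {p. p permutes F}" using F by (rule finite_permutations)
      show "{p. p permutes J} \<subseteq> {p. p permutes F}" using J by (auto intro: permutes_subset)
      show "\<forall>p\<in>{p. p permutes F} - {p. p permutes J}.
        of_int (sign p) * ((\<Prod>i\<in>J. a i (p i)) * (\<Prod>i\<in>F - J. of_bool (i = p i))) = 0"
      proof
        fix p assume "p \<in> {p. p permutes F} - {p. p permutes J}"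
        then have "p permutes F" "\<not> p permutes J" by auto
        then obtain i where "i \<in> F - J" "p i \<noteq> i"
          using permutes_superset[of p F J] by auto
        then have "(\<Prod>i\<in>F - J. of_bool (i = p i) :: real) = 0"
          using F by (intro prod_zero) (auto intro!: bexI[of _ i])
        then show "of_int (sign p) * ((\<Prod>i\<in>J. a i (p i)) * (\<Prod>i\<in>F - J. of_bool (i = p i))) = 0" by simp
      qed
    qed
    also have "\<dots> = principal_minor a J"
      unfolding principal_minor_def
    proof (intro sum.cong refl)
      fix p assume "p \<in> {p. p permutes J}"
      then have "(\<Prod>i\<in>F - J. of_bool (i = p i) :: real) = 1"
        by (intro prod.neutral) (auto simp: permutes_not_in)
      then show "of_int (sign p) * ((\<Prod>i\<in>J. a i (p i)) * (\<Prod>i\<in>F - J. of_bool (i = p i))) =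
        of_int (sign p) * (\<Prod>i\<in>J. a i (p i))" by simp
    qed
    finally show "(\<Sum>p | p permutes F. of_int (sign p) * ((\<Prod>i\<in>J. a i (p i)) * (\<Prod>i\<in>F - J. of_bool (i = p i)))) = principal_minor a J" .
  qed simp
  finally show ?thesis by simp
qed

lemma principal_minor_uminus:
  assumes "finite J"
  shows "\<bar>principal_minor (\<lambda>i j. - a i j) J\<bar> = \<bar>principal_minor a J\<bar>"
proof -
  have "principal_minor (\<lambda>i j. - a i j) J = (-1) ^ card J * principal_minor a J"
    using assms by (simp add: principal_minor_def prod_uminus sum_distrib_left mult_ac)
  then show ?thesis by (simp add: abs_mult power_abs)
qed

text \<open>By Hadamard's inequality the absolute partial sums are at most the product of the 1 + P
  j j, hence at most exp of the trace, so the series converges absolutely. Its sums over the power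
  sets of {..<n} are the determinants of 1 - P on {..<n}, bounded below by the product of 1 / (1 + h
  j) and so by exp of minus the sum of \<open>h\<close>. \<open>R\<close> stands for a bound on the
  quadratic form of the inverse of 1 - P.\<close>

lemma infsum_principal_minors_pos:
  fixes P :: "nat \<Rightarrow> nat \<Rightarrow> real"
  assumes sym: "\<And>i j. P i j = P j i"
    and psd: "\<And>J v. finite J \<Longrightarrow> 0 \<le> quad P J v"
    and trace: "summable (\<lambda>i. P i i)"
    and dom: "\<And>J x v. finite J \<Longrightarrow> (\<And>j. j \<notin> J \<Longrightarrow> x j = 0) \<Longrightarrow>
      2 * (\<Sum>j\<in>J. x j * v j) \<le> (\<Sum>j\<in>J. (v j)\<^sup>2) - quad P J v + R J x"
    and R: "\<And>J j. finite J \<Longrightarrow> j \<in> J \<Longrightarrow> R J (delta j) = 1 + h j"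
    and h: "summable h" "\<And>j. 0 \<le> h j"
  shows "0 < (\<Sum>\<^sub>\<infinity>J\<in>{J. finite J}. principal_minor (\<lambda>i j. - P i j) J)"
proof -
  let ?f = "principal_minor (\<lambda>i j. - P i j)"
  have diag: "0 \<le> P i i" for i
    using psd[of "{i}" "\<lambda>_. 1"] by (simp add: quad_def)
  have f_bound: "\<bar>?f J\<bar> \<le> (\<Prod>j\<in>J. P j j)" if "finite J" for J
    using principal_minor_psd[where a = P, OF that sym psd[OF that]] by (simp add: principal_minor_uminus[OF that])
  have pow_bound: "(\<Sum>J\<in>Pow {..<n}. \<bar>?f J\<bar>) \<le> exp (\<Sum>i. P i i)" for n
  proof -
    have "(\<Sum>J\<in>Pow {..<n}. \<bar>?f J\<bar>) \<le> (\<Sum>J\<in>Pow {..<n}. \<Prod>j\<in>J. P j j)"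
      by (intro sum_mono f_bound) (auto intro: finite_subset[OF _ finite_lessThan])
    also have "\<dots> = (\<Prod>j<n. P j j + 1)" using prod_add[of "{..<n}" "\<lambda>j. P j j" "\<lambda>_. 1"] by simp
    also have "\<dots> \<le> (\<Prod>j<n. exp (P j j))"
    proof (intro prod_mono conjI)
      fix j show "0 \<le> P j j + 1" using diag[of j] by simp
      show "P j j + 1 \<le> exp (P j j)" by (subst add.commute) (rule exp_ge_add_one_self)
    qed
    also have "\<dots> = exp (\<Sum>j<n. P j j)" by (simp add: exp_sum)
    also have "\<dots> \<le> exp (\<Sum>i. P i i)"
      using diag trace by (simp add: sum_le_suminf)
    finally show ?thesis .
  qed
  \<comment> \<open>The power sets of {..<n} are cofinal among the finite families of finite sets,
    so bounds and limits may be taken along this sequence.\<close>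
  have cofinal: "\<exists>n. \<X> \<subseteq> Pow {..<n}" if "finite \<X>" "\<X> \<subseteq> {J. finite J}" for \<X> :: "nat set set"
  proof -
    have "finite (\<Union>\<X>)"
    proof (rule finite_Union[OF that(1)])
      fix J assume "J \<in> \<X>"
      from subsetD[OF that(2) this] show "finite J" by simp
    qed
    from iffD1[OF finite_nat_iff_bounded this] obtain n where n: "\<Union>\<X> \<subseteq> {..<n}" by (rule exE)
    have "J \<subseteq> {..<n}" if "J \<in> \<X>" for J
      using Union_upper[OF that] n by (rule subset_trans)
    then show ?thesis by (intro exI[of _ n] subsetI) simp
  qed
  have "(\<lambda>J. norm (?f J)) summable_on {J. finite J}"
  proof (rule nonneg_bdd_above_summable_on)
    show "bdd_above (sum (\<lambda>J. norm (?f J)) ` {\<X>. \<X> \<subseteq> {J. finite J} \<and> finite \<X>})"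
    proof (rule bdd_aboveI2)
      fix \<X> :: "nat set set" assume "\<X> \<in> {\<X>. \<X> \<subseteq> {J. finite J} \<and> finite \<X>}"
      then have "finite \<X>" "\<X> \<subseteq> {J. finite J}" by simp_all
      from cofinal[OF this] obtain n where "\<X> \<subseteq> Pow {..<n}" by (rule exE)
      then have "sum (\<lambda>J. norm (?f J)) \<X> \<le> (\<Sum>J\<in>Pow {..<n}. \<bar>?f J\<bar>)"
        unfolding real_norm_def by (intro sum_mono2) auto
      also have "\<dots> \<le> exp (\<Sum>i. P i i)" by (rule pow_bound)
      finally show "sum (\<lambda>J. norm (?f J)) \<X> \<le> exp (\<Sum>i. P i i)" .
    qed
  qed simp
  then have "?f summable_on {J. finite J}" by (rule abs_summable_summable)
  then have "(?f has_sum infsum ?f {J. finite J}) {J. finite J}" by (rule has_sum_infsum)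
  then have lim0: "(sum ?f \<longlongrightarrow> infsum ?f {J. finite J}) (finite_subsets_at_top {J. finite J})"
    by (simp add: has_sum_def)
  have "filterlim (\<lambda>n. Pow {..<n}) (finite_subsets_at_top {J :: nat set. finite J}) sequentially"
    unfolding filterlim_finite_subsets_at_top
  proof (intro allI impI)
    fix \<X> :: "nat set set" assume X: "finite \<X> \<and> \<X> \<subseteq> {J. finite J}"
    from cofinal[OF conjunct1[OF X] conjunct2[OF X]] obtain n where n: "\<X> \<subseteq> Pow {..<n}" by (rule exE)
    show "\<forall>\<^sub>F m in sequentially. finite (Pow {..<m}) \<and> \<X> \<subseteq> Pow {..<m} \<and> Pow {..<m} \<subseteq> {J :: nat set. finite J}"
      using eventually_ge_at_top[of n]
    proof eventually_elim
      case (elim m)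
      then have "Pow {..<n} \<subseteq> Pow {..<m}" by auto
      with n show ?case
        by (intro conjI subset_trans[OF n]) (auto intro: finite_subset[OF _ finite_lessThan])
    qed
  qed
  from filterlim_compose[OF lim0 this]
  have lim: "(\<lambda>n. sum ?f (Pow {..<n})) \<longlonglongrightarrow> infsum ?f {J. finite J}" .
  have lower: "exp (- (\<Sum>i. h i)) \<le> sum ?f (Pow {..<n})" for n
  proof -
    have quadI: "quad (\<lambda>i j. of_bool (i = j) + - P i j) J v = (\<Sum>j\<in>J. (v j)\<^sup>2) - quad P J v" if "finite J" for J v
    proof -
      have "(\<Sum>i\<in>J. \<Sum>j\<in>J. v i * v j * of_bool (i = j)) = (\<Sum>i\<in>J. \<Sum>j\<in>J. if j = i then (v i)\<^sup>2 else 0)"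
        by (intro sum.cong refl) (auto simp: power2_eq_square)
      also have "\<dots> = (\<Sum>j\<in>J. (v j)\<^sup>2)" using that by simp
      finally show ?thesis
        by (simp add: quad_def right_diff_distrib sum_subtractf)
    qed
    have *: "(\<Prod>j\<in>{..<n}. 1 / (1 + h j)) \<le> principal_minor (\<lambda>i j. of_bool (i = j) + - P i j) {..<n} \<and> (\<forall>j\<in>{..<n}. 0 < 1 + h j)"
    proof (rule principal_minor_lower_bound)
      show "of_bool (j = k) + - P j k = of_bool (k = j) + - P k j" for j k
        using sym[of j k] by auto
      show "2 * (\<Sum>j<n. x j * v j) \<le> quad (\<lambda>i j. of_bool (i = j) + - P i j) {..<n} v + R {..<n} x"
        if "\<And>j. j \<notin> {..<n} \<Longrightarrow> x j = 0" for x v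
        using dom[of "{..<n}" x v] that quadI[of "{..<n}" v] by simp
    qed (simp_all add: R)
    have "exp (- (\<Sum>i. h i)) \<le> exp (- (\<Sum>j<n. h j))"
      using h by (simp add: sum_le_suminf)
    also have "\<dots> = (\<Prod>j<n. exp (- h j))" by (simp add: exp_sum flip: sum_negf)
    also have "\<dots> \<le> (\<Prod>j<n. 1 / (1 + h j))"
    proof (intro prod_mono conjI)
      fix j assume "j \<in> {..<n}"
      then have "0 < 1 + h j" using * by blast
      moreover have "1 + h j \<le> exp (h j)" by (rule exp_ge_add_one_self)
      ultimately show "exp (- h j) \<le> 1 / (1 + h j)"
        by (simp add: exp_minus field_simps)
    qed simp
    also have "\<dots> \<le> sum ?f (Pow {..<n})"
      using * sum_principal_minors[of "{..<n}" "\<lambda>i j. - P i j"] by simp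
    finally show ?thesis .
  qed
  have "exp (- (\<Sum>i. h i)) \<le> infsum ?f {J. finite J}"
    by (rule LIMSEQ_le_const[OF lim]) (use lower in blast)
  then show ?thesis by (rule less_le_trans[OF exp_gt_zero])
qed

section \<open>Operators on square-integrable functions as kernels\<close>

abbreviation on :: "real set \<Rightarrow> real measure" where
  "on \<Omega> \<equiv> restrict_space lborel \<Omega>"

lemma on_UNIV: "on UNIV = lborel"
  by (rule measure_eqI) (auto simp: sets_restrict_space emeasure_restrict_space)

lemma L2_space_on_iff:
  assumes "\<Omega> \<in> sets borel"
  shows "f \<in> L2_space (on \<Omega>) \<longleftrightarrow> (\<lambda>x. indicator \<Omega> x * f x) \<in> L2_space lborel"
proof -
  have "indicator \<Omega> x *\<^sub>R (f x)\<^sup>2 = (indicator \<Omega> x * f x)\<^sup>2" for x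
    by (auto simp: indicator_def)
  then show ?thesis
    using assms by (simp add: L2_space_def borel_measurable_restrict_space_iff integrable_restrict_space)
qed

text \<open>A function of norm one equal to its own square; tensoring with it embeds L2(R)
  isometrically into the kernels.\<close>

definition unit_ind :: "real \<Rightarrow> real" where "unit_ind = indicator {0..1}"

lemma unit_ind: "unit_ind \<in> borel_measurable lborel" "unit_ind v * unit_ind v = unit_ind v"
  "integrable lborel unit_ind" "integral\<^sup>L lborel unit_ind = 1" "unit_ind 0 = 1"
  by (auto simp: unit_ind_def indicator_def)

lemma unit_ind_L2: "unit_ind \<in> L2_space lborel"
proof -
  have "(\<lambda>x. (unit_ind x)\<^sup>2) = unit_ind" by (auto simp: unit_ind_def indicator_def)
  then show ?thesis using unit_ind(1,3) by (simp add: L2_space_def)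
qed

lemma L2k_tensor_iff: "L2k (\<lambda>x v. f x * unit_ind v) \<longleftrightarrow> f \<in> L2_space lborel"
proof -
  note [measurable] = unit_ind(1)
  have meas: "f \<in> borel_measurable lborel" if "(\<lambda>(x, v). f x * unit_ind v) \<in> borel_measurable lborel2"
  proof -
    have "(\<lambda>x. f x * unit_ind 0) \<in> borel_measurable lborel"
      by (rule kernel_measurable[OF that]) auto
    then show ?thesis by (simp add: unit_ind)
  qed
  have "(\<integral>\<^sup>+p. (ennreal \<bar>f (fst p) * unit_ind (snd p)\<bar>)\<^sup>2 \<partial>lborel2) = (\<integral>\<^sup>+x. ennreal ((f x)\<^sup>2) \<partial>lborel)"
    if [measurable]: "f \<in> borel_measurable lborel"
  proof -
    have "(\<integral>\<^sup>+p. (ennreal \<bar>f (fst p) * unit_ind (snd p)\<bar>)\<^sup>2 \<partial>lborel2)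
      = (\<integral>\<^sup>+p. ennreal ((f (fst p))\<^sup>2) * indicator {0..1} (snd p) \<partial>lborel2)"
      by (intro nn_integral_cong) (auto simp: unit_ind_def indicator_def ennreal_power)
    also have "\<dots> = (\<integral>\<^sup>+x. \<integral>\<^sup>+v. ennreal ((f x)\<^sup>2) * indicator {0..1} (v::real) \<partial>lborel \<partial>lborel)"
      by (subst lborel.nn_integral_fst[symmetric]) simp_all
    also have "\<dots> = (\<integral>\<^sup>+x. ennreal ((f x)\<^sup>2) \<partial>lborel)"
      by (simp add: nn_integral_cmult)
    finally show ?thesis .
  qed
  note eq = this
  show ?thesis
  proof
    assume L: "L2k (\<lambda>x v. f x * unit_ind v)"
    then have m: "f \<in> borel_measurable lborel" by (intro meas L2kD(1))
    then show "f \<in> L2_space lborel"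
      using L2kD(2)[OF L] by (simp add: eq[OF m] L2_space_iff_nn_integral)
  next
    assume f: "f \<in> L2_space lborel"
    then have [measurable]: "f \<in> borel_measurable lborel" by auto
    have "(\<lambda>(x, v). f x * unit_ind v) \<in> borel_measurable lborel2" by measurable
    then show "L2k (\<lambda>x v. f x * unit_ind v)"
      using f eq by (intro L2kI) (auto simp: L2_space_iff_nn_integral)
  qed
qed

text \<open>A function \<open>f\<close> on \<open>\<Omega>\<close> is identified with the kernel \<open>f(x) 1\<^bsub>[0,1]\<^esub>(v)\<close>, so that operators on functions
  become left multiplications in the algebra of kernels.\<close>

definition emb :: "real set \<Rightarrow> (real \<Rightarrow> real) \<Rightarrow> hs" where
  "emb \<Omega> f = cls (\<lambda>x v. indicator \<Omega> x * f x * unit_ind v)"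

definition box :: "real set \<Rightarrow> hs \<Rightarrow> hs" where
  "box \<Omega> = trunc (\<Omega> \<times> \<Omega>)"

text \<open>The rank-one projection onto \<open>unit_ind\<close>. It is a right unit for embedded
  functions, and \<open>adj (emb \<Omega> f) * emb \<Omega> g\<close> is the inner product of f and
  g times it.\<close>

definition E_unit :: hs where
  "E_unit = cls (\<lambda>v w. unit_ind v * unit_ind w)"

locale region =
  fixes \<Omega> :: "real set"
  assumes \<Omega>: "\<Omega> \<in> sets borel"
begin

abbreviation L2_region :: "(real \<Rightarrow> real) set" ("L2\<^sub>\<Omega>") where
  "L2\<^sub>\<Omega> \<equiv> L2_space (on \<Omega>)"

abbreviation exp_sum :: "hs unitz \<Rightarrow> nat \<Rightarrow> hs unitz" where
  "exp_sum m N \<equiv> \<Sum>n<N. m ^ n /\<^sub>R fact n"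

lemma Times_sets: "\<Omega> \<times> \<Omega> \<in> sets (borel \<Otimes>\<^sub>M borel)" "\<Omega> \<times> UNIV \<in> sets (borel \<Otimes>\<^sub>M borel)"
  "UNIV \<times> \<Omega> \<in> sets (borel \<Otimes>\<^sub>M borel)"
  using \<Omega> by auto

lemma L2k_emb: "f \<in> L2\<^sub>\<Omega> \<Longrightarrow> L2k (\<lambda>x v. indicator \<Omega> x * f x * unit_ind v)"
  by (simp add: L2k_tensor_iff L2_space_on_iff[OF \<Omega>])

lemma emb_add: "f \<in> L2\<^sub>\<Omega> \<Longrightarrow> g \<in> L2\<^sub>\<Omega> \<Longrightarrow> emb \<Omega> (\<lambda>x. f x + g x) = emb \<Omega> f + emb \<Omega> g"
  unfolding emb_def by (simp add: cls_add L2k_emb distrib_left distrib_right)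

lemma emb_scale: "f \<in> L2\<^sub>\<Omega> \<Longrightarrow> emb \<Omega> (\<lambda>x. a * f x) = a *\<^sub>R emb \<Omega> f"
  unfolding emb_def by (subst cls_scale[OF L2k_emb]) (simp_all add: mult_ac)

lemma emb_diff: "f \<in> L2\<^sub>\<Omega> \<Longrightarrow> g \<in> L2\<^sub>\<Omega> \<Longrightarrow> emb \<Omega> (\<lambda>x. f x - g x) = emb \<Omega> f - emb \<Omega> g"
  unfolding emb_def by (simp add: cls_diff L2k_emb left_diff_distrib right_diff_distrib)

lemma emb_lincomb:
  "f \<in> L2\<^sub>\<Omega> \<Longrightarrow> g \<in> L2\<^sub>\<Omega> \<Longrightarrow> emb \<Omega> (\<lambda>x. a * f x + b * g x) = a *\<^sub>R emb \<Omega> f + b *\<^sub>R emb \<Omega> g"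
  by (simp add: emb_add emb_scale L2_space_scale)

lemma inner_emb:
  assumes "f \<in> L2\<^sub>\<Omega>" "g \<in> L2\<^sub>\<Omega>"
  shows "emb \<Omega> f \<bullet> emb \<Omega> g = L2_inner (on \<Omega>) f g"
proof -
  let ?F = "\<lambda>x v. indicator \<Omega> x * f x * unit_ind v" and ?G = "\<lambda>x v. indicator \<Omega> x * g x * unit_ind v"
  have "integrable lborel2 (\<lambda>p. case_prod ?F p * case_prod ?G p)"
    using L2k_emb[OF assms(1)] L2k_emb[OF assms(2)] by (intro L2_mult_integrable) (simp_all add: L2_kernel_def)
  then have "integrable lborel2 (\<lambda>(x, v). ?F x v * ?G x v)" by (simp add: case_prod_unfold)
  from lborel_pair.integral_fst[OF this]
  have "emb \<Omega> f \<bullet> emb \<Omega> g = (\<integral>x. \<integral>v. ?F x v * ?G x v \<partial>lborel \<partial>lborel)"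
    unfolding emb_def using assms by (simp add: inner_cls L2k_emb case_prod_unfold)
  also have "\<dots> = (\<integral>x. indicator \<Omega> x *\<^sub>R (f x * g x) \<partial>lborel)"
  proof (intro Bochner_Integration.integral_cong refl)
    fix x
    have "(\<integral>v. ?F x v * ?G x v \<partial>lborel) = (\<integral>v. indicator \<Omega> x * f x * g x * unit_ind v \<partial>lborel)"
      by (intro Bochner_Integration.integral_cong refl) (auto simp: indicator_def unit_ind_def)
    also have "\<dots> = indicator \<Omega> x *\<^sub>R (f x * g x)" by (simp add: unit_ind)
    finally show "(\<integral>v. ?F x v * ?G x v \<partial>lborel) = indicator \<Omega> x *\<^sub>R (f x * g x)" .
  qed
  also have "\<dots> = L2_inner (on \<Omega>) f g"
    unfolding L2_inner_def using \<Omega> by (subst integral_restrict_space) auto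
  finally show ?thesis .
qed

lemma norm_emb: "f \<in> L2\<^sub>\<Omega> \<Longrightarrow> norm (emb \<Omega> f) = L2_norm (on \<Omega>) f"
  by (simp add: norm_eq_sqrt_inner inner_emb L2_norm_def)

lemma emb_eq_iff:
  assumes "f \<in> L2\<^sub>\<Omega>" "g \<in> L2\<^sub>\<Omega>"
  shows "emb \<Omega> f = emb \<Omega> g \<longleftrightarrow> (AE x in on \<Omega>. f x = g x)"
proof -
  have d: "(\<lambda>x. f x - g x) \<in> L2\<^sub>\<Omega>" using assms by (rule L2_space_diff)
  have "emb \<Omega> f = emb \<Omega> g \<longleftrightarrow> emb \<Omega> (\<lambda>x. f x - g x) \<bullet> emb \<Omega> (\<lambda>x. f x - g x) = 0"
    by (simp add: emb_diff assms)
  also have "\<dots> \<longleftrightarrow> (AE x in on \<Omega>. f x = g x)"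
    unfolding inner_emb[OF d d] L2_inner_self_eq_0_iff[OF d] by simp
  finally show ?thesis .
qed

lemma integral_op_L2:
  assumes A: "L2k A" and f: "f \<in> L2\<^sub>\<Omega>"
  shows "integral_op (on \<Omega>) A f \<in> L2\<^sub>\<Omega>"
    and "emb \<Omega> (integral_op (on \<Omega>) A f) = box \<Omega> (cls A) * emb \<Omega> f"
proof -
  let ?A = "\<lambda>u v. indicator (\<Omega> \<times> \<Omega>) (u, v) * A u v" and ?f = "\<lambda>x v. indicator \<Omega> x * f x * unit_ind v"
  have eq: "kcomp ?A ?f x v = indicator \<Omega> x * integral_op (on \<Omega>) A f x * unit_ind v" for x v
  proof -
    have "integral_op (on \<Omega>) A f x = (\<integral>z. indicator \<Omega> z *\<^sub>R (A x z * f z) \<partial>lborel)"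
      unfolding integral_op_def using \<Omega> by (subst integral_restrict_space) auto
    then have "indicator \<Omega> x * integral_op (on \<Omega>) A f x * unit_ind v
      = (\<integral>z. indicator \<Omega> x * unit_ind v * (indicator \<Omega> z *\<^sub>R (A x z * f z)) \<partial>lborel)"
      by simp
    also have "\<dots> = kcomp ?A ?f x v"
      unfolding kcomp_def by (intro Bochner_Integration.integral_cong refl) (auto simp: indicator_def)
    finally show ?thesis by simp
  qed
  have L: "L2k ?A" "L2k ?f"
    using L2k_indicator_mult[OF A Times_sets(1)] L2k_emb[OF f] by auto
  have "L2k (\<lambda>x v. indicator \<Omega> x * integral_op (on \<Omega>) A f x * unit_ind v)"
    using L2k_kcomp[OF L] by (simp flip: eq)
  then show "integral_op (on \<Omega>) A f \<in> L2\<^sub>\<Omega>"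
    by (simp add: L2k_tensor_iff L2_space_on_iff[OF \<Omega>])
  show "emb \<Omega> (integral_op (on \<Omega>) A f) = box \<Omega> (cls A) * emb \<Omega> f"
    unfolding emb_def box_def trunc_cls[OF A Times_sets(1)] cls_mult[OF L]
    by (intro arg_cong[of _ _ cls] ext) (simp add: eq)
qed

text \<open>The embedding is injective modulo null sets, so the element \<open>m\<close> determines
  \<open>T\<close> up to null sets, and statements about operators on L2(\<Omega>) become identities
  in the unitization.\<close>

definition represents :: "real fop \<Rightarrow> hs unitz \<Rightarrow> bool" where
  "represents T m \<longleftrightarrow> (\<forall>f\<in>L2\<^sub>\<Omega>. T f \<in> L2\<^sub>\<Omega> \<and> emb \<Omega> (T f) = act m (emb \<Omega> f))"

lemma representsD:
  assumes "represents T m" "f \<in> L2\<^sub>\<Omega>"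
  shows "T f \<in> L2\<^sub>\<Omega>" "emb \<Omega> (T f) = act m (emb \<Omega> f)"
  using assms by (auto simp: represents_def)

lemma represents_integral_op: "L2k A \<Longrightarrow> represents (integral_op (on \<Omega>) A) (Unitz 0 (box \<Omega> (cls A)))"
  by (simp add: represents_def integral_op_L2 act_def)

lemma represents_id_plus: "represents T m \<Longrightarrow> represents (id_plus T) (1 + m)"
  unfolding represents_def id_plus_def[abs_def] by (simp add: emb_add act_add_left L2_space_add)

lemma represents_compose: "represents T m \<Longrightarrow> represents R n \<Longrightarrow> represents (\<lambda>f. T (R f)) (m * n)"
  by (simp add: represents_def act_mult)

lemma represents_scale: "represents T m \<Longrightarrow> represents (\<lambda>f x. a * T f x) (a *\<^sub>R m)"
  unfolding represents_def by (simp add: emb_scale L2_space_scale act_def algebra_simps)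

lemma represents_diff_id: "represents T m \<Longrightarrow> represents (\<lambda>f x. T f x - f x) (m - 1)"
  unfolding represents_def by (simp add: emb_diff L2_space_diff act_diff_left)

lemma represents_power: "represents T m \<Longrightarrow> represents (T ^^ n) (m ^ n)"
  by (induction n) (simp_all add: represents_def act_mult)

lemma bounded_op_if_represents:
  assumes T: "represents T m"
  shows "bounded_op (on \<Omega>) T"
  unfolding bounded_op_def
proof (intro conjI ballI allI)
  fix f g and a b :: real assume fg: "f \<in> L2\<^sub>\<Omega>" "g \<in> L2\<^sub>\<Omega>"
  note L = L2_space_lincomb[OF fg, of a b]
  note L' = L2_space_lincomb[OF representsD(1)[OF T fg(1)] representsD(1)[OF T fg(2)], of a b]
  have "emb \<Omega> (T (\<lambda>u. a * f u + b * g u)) = emb \<Omega> (\<lambda>x. a * T f x + b * T g x)"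
    unfolding representsD(2)[OF T L] emb_lincomb[OF fg]
      emb_lincomb[OF representsD(1)[OF T fg(1)] representsD(1)[OF T fg(2)]]
      representsD(2)[OF T fg(1)] representsD(2)[OF T fg(2)]
    by (simp add: act_def algebra_simps)
  then show "AE x in on \<Omega>. T (\<lambda>u. a * f u + b * g u) x = a * T f x + b * T g x"
    by (rule iffD1[OF emb_eq_iff[OF representsD(1)[OF T L] L']])
next
  have "L2_norm (on \<Omega>) (T f) \<le> norm m * L2_norm (on \<Omega>) f" if "f \<in> L2\<^sub>\<Omega>" for f
    using norm_act_le[of m "emb \<Omega> f"] that
    by (simp add: representsD(1)[OF T] flip: norm_emb) (simp add: representsD(2)[OF T])
  then show "\<exists>B. \<forall>f\<in>L2\<^sub>\<Omega>. L2_norm (on \<Omega>) (T f) \<le> B * L2_norm (on \<Omega>) f" by blast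
qed (use T in \<open>simp add: represents_def\<close>)

lemma represents_cong_AE:
  assumes "represents T m" "\<And>f. f \<in> L2\<^sub>\<Omega> \<Longrightarrow> T' f \<in> L2\<^sub>\<Omega>"
    "\<And>f. f \<in> L2\<^sub>\<Omega> \<Longrightarrow> AE x in on \<Omega>. T' f x = T f x"
  shows "represents T' m"
  unfolding represents_def
proof (intro ballI conjI)
  fix f assume f: "f \<in> L2\<^sub>\<Omega>"
  then show "T' f \<in> L2\<^sub>\<Omega>" by (rule assms)
  have "emb \<Omega> (T' f) = emb \<Omega> (T f)"
    unfolding emb_eq_iff[OF assms(2)[OF f] representsD(1)[OF assms(1) f]] by (rule assms(3)[OF f])
  then show "emb \<Omega> (T' f) = act m (emb \<Omega> f)" by (simp add: representsD(2)[OF assms(1) f])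
qed

lemma is_inverse_op_if_represents:
  assumes "represents T m" "represents R n" "m * n = 1" "n * m = 1"
  shows "is_inverse_op (on \<Omega>) T R"
  unfolding is_inverse_op_def
proof (intro conjI ballI)
  show "bounded_op (on \<Omega>) R" using assms(2) by (rule bounded_op_if_represents)
  fix f assume f: "f \<in> L2\<^sub>\<Omega>"
  note TR = representsD[OF represents_compose[OF assms(1,2)] f]
  note RT = representsD[OF represents_compose[OF assms(2,1)] f]
  have "emb \<Omega> (T (R f)) = emb \<Omega> f" "emb \<Omega> (R (T f)) = emb \<Omega> f"
    unfolding TR(2) RT(2) assms(3,4) by simp_all
  then show "AE x in on \<Omega>. T (R f) x = f x" "AE x in on \<Omega>. R (T f) x = f x"
    by (simp_all only: emb_eq_iff[OF TR(1) f] emb_eq_iff[OF RT(1) f])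
qed

text \<open>\<open>R\<close> acts on functions rather than classes, so equality of T h and f almost
  everywhere does not at once give the same for their images. Boundedness helps: R maps T h - f,
  which has norm zero, to a null function, and linearity splits this.\<close>

lemma inverse_apply:
  assumes R: "is_inverse_op (on \<Omega>) T R" and T: "represents T m"
    and h: "h \<in> L2\<^sub>\<Omega>" and f: "f \<in> L2\<^sub>\<Omega>" and eq: "AE x in on \<Omega>. T h x = f x"
  shows "AE x in on \<Omega>. h x = R f x"
proof -
  have Th: "T h \<in> L2\<^sub>\<Omega>" using T h by (rule representsD)
  have b: "bounded_op (on \<Omega>) R" using R by (simp add: is_inverse_op_def)
  then obtain B where B: "\<And>g. g \<in> L2\<^sub>\<Omega> \<Longrightarrow> L2_norm (on \<Omega>) (R g) \<le> B * L2_norm (on \<Omega>) g"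
    unfolding bounded_op_def by blast
  have RL: "\<And>g. g \<in> L2\<^sub>\<Omega> \<Longrightarrow> R g \<in> L2\<^sub>\<Omega>"
    using b unfolding bounded_op_def by blast
  define d where "d = (\<lambda>u. 1 * T h u + (-1) * f u)"
  have d: "d \<in> L2\<^sub>\<Omega>" unfolding d_def by (intro L2_space_lincomb Th f)
  have "AE x in on \<Omega>. d x = 0" using eq by eventually_elim (simp add: d_def)
  then have "L2_norm (on \<Omega>) d = 0"
    using L2_inner_self_eq_0_iff[OF d] by (simp add: L2_norm_def)
  then have "L2_norm (on \<Omega>) (R d) \<le> 0" using B[OF d] by simp
  then have "L2_inner (on \<Omega>) (R d) (R d) = 0"
    using L2_inner_self_nonneg[of "on \<Omega>" "R d"] by (simp add: L2_norm_def)
  then have "AE x in on \<Omega>. R d x = 0" using L2_inner_self_eq_0_iff[OF RL[OF d]] by simp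
  moreover have "AE x in on \<Omega>. R d x = 1 * R (T h) x + (-1) * R f x"
    unfolding d_def using b Th f unfolding bounded_op_def by blast
  moreover have "AE x in on \<Omega>. R (T h) x = h x"
    using R h by (simp add: is_inverse_op_def)
  ultimately show ?thesis by eventually_elim simp
qed

lemma represents_exp_sum:
  assumes T: "represents T m" and f: "f \<in> L2\<^sub>\<Omega>"
  shows "(\<lambda>x. \<Sum>n<N. (T ^^ n) f x / fact n) \<in> L2\<^sub>\<Omega> \<and>
    emb \<Omega> (\<lambda>x. \<Sum>n<N. (T ^^ n) f x / fact n) = act (exp_sum m N) (emb \<Omega> f)"
proof (induction N)
  case 0
  have "emb \<Omega> (\<lambda>x. 0) = 0" by (simp add: emb_def cls_zero)
  then show ?case by (simp add: L2_space_zero act_def)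
next
  case (Suc N)
  note P = representsD[OF represents_scale[OF represents_power[OF T], of "inverse (fact N)" N] f]
  have eq: "(\<lambda>x. \<Sum>n<Suc N. (T ^^ n) f x / fact n) =
      (\<lambda>x. (\<Sum>n<N. (T ^^ n) f x / fact n) + inverse (fact N) * (T ^^ N) f x)"
    by (simp add: fun_eq_iff divide_inverse)
  show ?case
    unfolding eq using Suc P by (simp add: L2_space_add emb_add act_add_left)
qed

lemma exp_partial_sums: "(\<lambda>N. exp_sum m N) \<longlonglongrightarrow> exp m" for m :: "hs unitz"
  using exp_converges[of m] by (simp add: sums_def)

lemma is_exp_op_if_represents:
  assumes T: "represents T m" and E: "represents E (exp m)"
  shows "is_exp_op (on \<Omega>) T E"
  unfolding is_exp_op_def
proof (intro conjI exI[of _ "\<lambda>N. norm (exp m - (exp_sum m N))"] allI ballI)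
  show "bounded_op (on \<Omega>) E" using E by (rule bounded_op_if_represents)
  show "(\<lambda>N. norm (exp m - (exp_sum m N))) \<longlonglongrightarrow> 0"
    using tendsto_norm[OF tendsto_diff[OF tendsto_const exp_partial_sums[of m]], of "exp m"] by simp
  fix N f assume f: "f \<in> L2\<^sub>\<Omega>"
  note S = represents_exp_sum[OF T f, of N]
  have "emb \<Omega> (\<lambda>x. E f x - (\<Sum>n<N. (T ^^ n) f x / fact n)) = act (exp m - (exp_sum m N)) (emb \<Omega> f)"
    using S representsD[OF E f] by (simp add: emb_diff act_diff_left)
  moreover have "(\<lambda>x. E f x - (\<Sum>n<N. (T ^^ n) f x / fact n)) \<in> L2\<^sub>\<Omega>"
    using S representsD[OF E f] by (simp add: L2_space_diff)
  ultimately show "L2_norm (on \<Omega>) (\<lambda>x. E f x - (\<Sum>n<N. (T ^^ n) f x / fact n)) \<le>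
      norm (exp m - (exp_sum m N)) * L2_norm (on \<Omega>) f"
    using f norm_act_le[of "exp m - (exp_sum m N)" "emb \<Omega> f"] by (simp flip: norm_emb)
qed

text \<open>Uniqueness of the exponential: the remainder estimate makes E f the limit of the partial
  sums, which converge to \<open>exp m\<close> in the algebra. This covers whichever operator
  \<open>exp_op\<close> picks.\<close>

lemma represents_if_is_exp_op:
  assumes T: "represents T m" and E: "is_exp_op (on \<Omega>) T E"
  shows "represents E (exp m)"
  unfolding represents_def
proof (intro ballI conjI)
  fix f assume f: "f \<in> L2\<^sub>\<Omega>"
  show Ef: "E f \<in> L2\<^sub>\<Omega>"
    using E f by (simp add: is_exp_op_def bounded_op_def)
  obtain \<epsilon> where \<epsilon>: "\<epsilon> \<longlonglongrightarrow> 0" and bound: "\<And>N. L2_norm (on \<Omega>) (\<lambda>x. E f x - (\<Sum>n<N. (T ^^ n) f x / fact n)) \<le> \<epsilon> N * L2_norm (on \<Omega>) f"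
    using E f unfolding is_exp_op_def by blast
  let ?s = "\<lambda>N. act (exp_sum m N) (emb \<Omega> f)"
  have lim0: "(\<lambda>N. \<epsilon> N * L2_norm (on \<Omega>) f) \<longlonglongrightarrow> 0"
    using tendsto_mult_right[OF \<epsilon>, of "L2_norm (on \<Omega>) f"] by simp
  have "norm (emb \<Omega> (E f) - ?s N) \<le> \<epsilon> N * L2_norm (on \<Omega>) f" for N
    using represents_exp_sum[OF T f, of N] bound[of N] Ef
    by (simp add: L2_space_diff emb_diff flip: norm_emb)
  then have "\<forall>\<^sub>F N in sequentially. norm (emb \<Omega> (E f) - ?s N) \<le> \<epsilon> N * L2_norm (on \<Omega>) f"
    by (intro always_eventually allI)
  from Lim_null_comparison[OF this lim0] have "(\<lambda>N. emb \<Omega> (E f) - ?s N) \<longlonglongrightarrow> 0" .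
  then have "(\<lambda>N. emb \<Omega> (E f) - (emb \<Omega> (E f) - ?s N)) \<longlonglongrightarrow> emb \<Omega> (E f) - 0"
    by (intro tendsto_diff tendsto_const)
  then have "?s \<longlonglongrightarrow> emb \<Omega> (E f)" by simp
  moreover have "bounded_linear (\<lambda>m. act m (emb \<Omega> f))"
  proof (rule bounded_linear_intro[of _ "norm (emb \<Omega> f)"])
    show "norm (act m (emb \<Omega> f)) \<le> norm m * norm (emb \<Omega> f)" for m by (rule norm_act_le)
  qed (simp_all add: act_def algebra_simps)
  then have "?s \<longlonglongrightarrow> act (exp m) (emb \<Omega> f)"
    by (rule bounded_linear.tendsto[OF _ exp_partial_sums])
  ultimately show "emb \<Omega> (E f) = act (exp m) (emb \<Omega> f)" by (rule LIMSEQ_unique)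
qed

section \<open>Kernels supported in a square\<close>

lemma box_box: "box \<Omega> (box \<Omega> a) = box \<Omega> a"
  unfolding box_def by (simp add: trunc_trunc[OF Times_sets(1) Times_sets(1)])

lemma bounded_linear_box: "bounded_linear (box \<Omega>)"
  unfolding box_def by (rule bounded_linear_trunc[OF Times_sets(1)])

lemma adj_box: "adj (box \<Omega> a) = box \<Omega> (adj a)"
proof -
  have "{p. (snd p, fst p) \<in> \<Omega> \<times> \<Omega>} = \<Omega> \<times> \<Omega>" by auto
  then show ?thesis by (simp add: box_def adj_trunc[OF Times_sets(1)])
qed

lemma box_eq: "box \<Omega> a = trunc (\<Omega> \<times> UNIV) (trunc (UNIV \<times> \<Omega>) a)"
  unfolding box_def trunc_trunc[OF Times_sets(2,3)] by (simp add: Times_Int_Times)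

text \<open>Acting with the cut-off kernel is left multiplication by \<open>a\<close> compressed
  with the row projection, the shape required by \<open>coercive_compression\<close>.\<close>

lemma box_mult_left: "box \<Omega> a * x = trunc (\<Omega> \<times> UNIV) (a * trunc (\<Omega> \<times> UNIV) x)"
  unfolding box_eq by (simp add: trunc_mult_rows[OF \<Omega>] trunc_rows_mult[OF \<Omega>])

lemma rows_box_mult:
  assumes "box \<Omega> a = a"
  shows "trunc (\<Omega> \<times> UNIV) (a * b) = a * b"
proof -
  have "trunc (\<Omega> \<times> UNIV) a = trunc (\<Omega> \<times> UNIV) (box \<Omega> a)" using assms by simp
  also have "\<dots> = box \<Omega> a"
    unfolding box_def trunc_trunc[OF Times_sets(2,1)] by (simp add: Times_Int_Times)
  finally show ?thesis using assms by (simp add: trunc_rows_mult[OF \<Omega>])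
qed

lemma columns_mult_box:
  assumes "box \<Omega> b = b"
  shows "trunc (UNIV \<times> \<Omega>) (a * b) = a * b"
proof -
  have adj_rows: "adj (trunc (\<Omega> \<times> UNIV) c) = trunc (UNIV \<times> \<Omega>) (adj c)" for c
  proof -
    have "{p. (snd p, fst p) \<in> \<Omega> \<times> UNIV} = UNIV \<times> \<Omega>" by auto
    then show ?thesis unfolding adj_trunc[OF Times_sets(2)] by (rule arg_cong)
  qed
  have "box \<Omega> (adj b) = adj b" using assms by (metis adj_box)
  then show ?thesis
    using rows_box_mult[of "adj b" "adj a"] adj_rows[of "adj b * adj a"] by (simp add: adj_mult)
qed

lemma box_mult: "box \<Omega> a = a \<Longrightarrow> box \<Omega> b = b \<Longrightarrow> box \<Omega> (a * b) = a * b"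
  by (simp add: box_eq[of "a * b"] rows_box_mult columns_mult_box)

lemma box_exp:
  assumes "box \<Omega> b = b"
  shows "box \<Omega> (vec (exp (Unitz 0 b))) = vec (exp (Unitz 0 b))"
  using assms by (intro vec_exp_fixed bounded_linear_box box_mult)

lemma represents_vec:
  assumes "scal m = 0" "box \<Omega> (vec m) = vec m"
  shows "represents (integral_op (on \<Omega>) (ker (vec m))) m"
proof -
  have "m = Unitz 0 (vec m)" using assms(1) by (simp add: unitz_eq_iff)
  then show ?thesis
    using represents_integral_op[OF L2k_ker, of "vec m"] assms(2) by simp
qed

text \<open>1 plus the integral operator of a kernel for e^b - 1, which stays in the square, is an
  exponential of \<open>T\<close>. Hence the choice in \<open>exp_op\<close> succeeds and uniqueness
  applies to it.\<close>

lemma represents_exp_op: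
  assumes T: "represents T (Unitz 0 b)" and b: "box \<Omega> b = b"
  shows "represents (exp_op (on \<Omega>) T) (exp (Unitz 0 b))"
proof (rule represents_if_is_exp_op[OF T])
  let ?m = "exp (Unitz 0 b) - 1"
  have "represents (id_plus (integral_op (on \<Omega>) (ker (vec ?m)))) (1 + ?m)"
    using box_exp[OF b] by (intro represents_id_plus represents_vec) (simp_all add: scal_exp)
  then have "is_exp_op (on \<Omega>) T (id_plus (integral_op (on \<Omega>) (ker (vec ?m))))"
    using T by (intro is_exp_op_if_represents) simp_all
  then show "is_exp_op (on \<Omega>) T (exp_op (on \<Omega>) T)"
    unfolding exp_op_def by (rule someI[of "is_exp_op (on \<Omega>) T"])
qed

subsection \<open>Orthonormal systems\<close>

lemma adj_emb_mult_emb: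
  assumes "f \<in> L2\<^sub>\<Omega>" "g \<in> L2\<^sub>\<Omega>"
  shows "adj (emb \<Omega> f) * emb \<Omega> g = L2_inner (on \<Omega>) f g *\<^sub>R E_unit"
proof -
  let ?F = "\<lambda>v x. indicator \<Omega> x * f x * unit_ind v" and ?G = "\<lambda>x v. indicator \<Omega> x * g x * unit_ind v"
  have L: "L2k ?F" "L2k ?G" using L2k_swap[OF L2k_emb[OF assms(1)]] L2k_emb[OF assms(2)] by auto
  have E: "L2k (\<lambda>v w. unit_ind v * unit_ind w)" by (simp add: L2k_tensor_iff unit_ind_L2)
  have "kcomp ?F ?G v w = L2_inner (on \<Omega>) f g * (unit_ind v * unit_ind w)" for v w
  proof -
    have "L2_inner (on \<Omega>) f g = (\<integral>x. indicator \<Omega> x *\<^sub>R (f x * g x) \<partial>lborel)"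
      unfolding L2_inner_def using \<Omega> by (subst integral_restrict_space) auto
    then have "L2_inner (on \<Omega>) f g * (unit_ind v * unit_ind w) =
        (\<integral>x. (indicator \<Omega> x *\<^sub>R (f x * g x)) * (unit_ind v * unit_ind w) \<partial>lborel)"
      by simp
    also have "\<dots> = kcomp ?F ?G v w"
      unfolding kcomp_def by (intro Bochner_Integration.integral_cong refl) (auto simp: indicator_def)
    finally show ?thesis by simp
  qed
  then show ?thesis
    unfolding emb_def adj_cls[OF L2k_emb[OF assms(1)]] cls_mult[OF L] E_unit_def cls_scale[OF E]
    by (intro arg_cong[of _ _ cls] ext)
qed

lemma emb_mult_E:
  assumes "f \<in> L2\<^sub>\<Omega>"
  shows "emb \<Omega> f * E_unit = emb \<Omega> f"
proof -
  have E: "L2k (\<lambda>v w. unit_ind v * unit_ind w)" by (simp add: L2k_tensor_iff unit_ind_L2)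
  have "kcomp (\<lambda>x v. indicator \<Omega> x * f x * unit_ind v) (\<lambda>v w. unit_ind v * unit_ind w) x w
    = indicator \<Omega> x * f x * unit_ind w" for x w
  proof -
    have "kcomp (\<lambda>x v. indicator \<Omega> x * f x * unit_ind v) (\<lambda>v w. unit_ind v * unit_ind w) x w
      = (\<integral>v. (indicator \<Omega> x * f x * unit_ind w) * unit_ind v \<partial>lborel)"
      unfolding kcomp_def by (intro Bochner_Integration.integral_cong refl) (auto simp: unit_ind_def indicator_def)
    then show ?thesis by (simp add: unit_ind)
  qed
  then show ?thesis
    unfolding emb_def E_unit_def cls_mult[OF L2k_emb[OF assms] E] by (intro arg_cong[of _ _ cls] ext)
qed

text \<open>\<open>q\<close> is the projection onto the first N vectors, and |a q|^2 equals the
  partial sum, so all partial sums are at most |a|^2. It shows that S(t) is Hilbert-Schmidt and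
  makes the trace in the determinant finite.\<close>

lemma bessel:
  assumes e: "\<And>i. e i \<in> L2\<^sub>\<Omega>" "\<And>i j. L2_inner (on \<Omega>) (e i) (e j) = (if i = j then 1 else 0)"
  shows "summable (\<lambda>i::nat. (norm (a * emb \<Omega> (e i)))\<^sup>2)"
proof (rule summableI_nonneg_bounded)
  fix N :: nat
  define u where "u i = emb \<Omega> (e i)" for i
  have uu: "adj (u i) * u j = (if i = j then E_unit else 0)" for i j
    using e by (simp add: u_def adj_emb_mult_emb)
  have uE: "u i * E_unit = u i" for i using e by (simp add: u_def emb_mult_E)
  define q where "q = (\<Sum>i<N. u i * adj (u i))"
  have adj_q: "adj q = q"
    unfolding q_def linear_sum[OF bounded_linear.linear[OF bounded_linear_adj]] by (simp add: adj_mult)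
  have qu: "q * u j = u j" if "j < N" for j
  proof -
    have "q * u j = (\<Sum>i<N. if i = j then u j else 0)"
      unfolding q_def sum_distrib_right by (intro sum.cong refl) (simp add: mult.assoc uu uE)
    then show ?thesis using that by simp
  qed
  have "(norm (a * q))\<^sup>2 = (\<Sum>j<N. (norm (a * u j))\<^sup>2)"
  proof -
    have "(norm (a * q))\<^sup>2 = (\<Sum>j<N. (a * q) \<bullet> (a * u j * adj (u j)))"
      unfolding power2_norm_eq_inner by (subst (2) q_def) (simp add: sum_distrib_left inner_sum_right mult.assoc)
    also have "\<dots> = (\<Sum>j<N. (norm (a * u j))\<^sup>2)"
    proof (intro sum.cong refl)
      fix j assume "j \<in> {..<N}"
      have "(a * q) \<bullet> (a * u j * adj (u j)) = (a * u j) \<bullet> (a * q * u j)"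
        by (subst inner_commute) (simp add: inner_mult_right)
      then show "(a * q) \<bullet> (a * u j * adj (u j)) = (norm (a * u j))\<^sup>2"
        using \<open>j \<in> {..<N}\<close> by (simp add: mult.assoc qu power2_norm_eq_inner)
    qed
    finally show ?thesis .
  qed
  moreover have "q * q = q"
  proof -
    have "q * q = (\<Sum>j<N. q * (u j * adj (u j)))" by (subst (2) q_def) (simp add: sum_distrib_left)
    also have "\<dots> = (\<Sum>j<N. u j * adj (u j))" by (intro sum.cong refl) (simp add: qu flip: mult.assoc)
    finally show ?thesis by (simp add: q_def)
  qed
  then have "(norm (a * q))\<^sup>2 = (a * q) \<bullet> a"
    using inner_mult_right[of a q "a * q"] by (simp add: power2_norm_eq_inner adj_q mult.assoc inner_commute)
  then have "(norm (a * q))\<^sup>2 \<le> norm (a * q) * norm a" by (simp add: norm_cauchy_schwarz)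
  then have "norm (a * q) \<le> norm a" by (cases "a * q = 0") (auto simp: power2_eq_square)
  then have "(norm (a * q))\<^sup>2 \<le> (norm a)\<^sup>2" by (intro power_mono) auto
  ultimately show "(\<Sum>i<N. (norm (a * emb \<Omega> (e i)))\<^sup>2) \<le> (norm a)\<^sup>2" by (simp add: u_def)
qed simp

end

lemma L2k_section:
  assumes C: "L2k C"
  shows "AE x in lborel. (\<lambda>z. C x z) \<in> L2_space lborel"
proof -
  note [measurable (raw)] = L2k_measurable[OF C]
  have "integrable lborel2 (\<lambda>(x, z). (C x z)\<^sup>2)"
    using C by (simp add: L2_kernel_def L2_space_def case_prod_unfold)
  from lborel_pair.AE_integrable_fst[OF this] show ?thesis
    by eventually_elim (simp add: L2_space_def)
qed

text \<open>The null set in the hypothesis depends on f; testing with the countable basis leaves one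
  common null set of x, outside which the section of A - B is orthogonal to every basis vector and
  hence vanishes.\<close>

lemma kernel_unique:
  assumes A: "L2k A" and B: "L2k B" and e: "orthonormal_basis (lborel :: real measure) e"
    and eq: "\<And>f. f \<in> L2_space lborel \<Longrightarrow> AE x in lborel. integral_op lborel A f x = integral_op lborel B f x"
  shows "cls A = cls B"
proof -
  note [measurable (raw)] = L2k_measurable[OF A] L2k_measurable[OF B]
  have eL: "e i \<in> L2_space lborel" for i using e by (simp add: orthonormal_basis_def)
  have "AE x in lborel. \<forall>i. integral_op lborel A (e i) x = integral_op lborel B (e i) x"
    unfolding AE_all_countable using eq eL by blast
  with L2k_section[OF A] L2k_section[OF B] have "AE x in lborel. AE z in lborel. A x z = B x z"
  proof eventually_elim
    case (elim x)
    then have d: "(\<lambda>z. A x z - B x z) \<in> L2_space lborel" by (intro L2_space_diff)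
    have "L2_inner lborel (e i) (\<lambda>z. A x z - B x z) = 0" for i
    proof -
      have "L2_inner lborel (e i) (\<lambda>z. A x z - B x z) = integral_op lborel A (e i) x - integral_op lborel B (e i) x"
        unfolding L2_inner_def integral_op_def
        using L2_mult_integrable[OF elim(1) eL[of i]] L2_mult_integrable[OF elim(2) eL[of i]]
        by (simp add: right_diff_distrib mult.commute[of "e i _"])
      then show ?thesis using elim by simp
    qed
    with e d have "AE z in lborel. A x z - B x z = 0"
      unfolding orthonormal_basis_def by blast
    then show ?case by simp
  qed
  then have ae: "AE x in lborel. AE z in lborel. A (fst (x, z)) (snd (x, z)) = B (fst (x, z)) (snd (x, z))"
    by simp
  have "AE p in lborel2. A (fst p) (snd p) = B (fst p) (snd p)"
    by (rule lborel_pair.AE_pair_measure[OF _ ae]) measurable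
  then show ?thesis using A B by (simp add: cls_eq_iff case_prod_unfold)
qed

subsection \<open>An orthonormal basis of a half-line\<close>

text \<open>The map taking u to y - e^(-u) is a diffeomorphism of the line onto (-inf, y) with
  derivative e^(-u). The change of variables is made for absolutely integrable functions and then
  carried back to Borel measure.\<close>

lemma half_line_substitution:
  fixes F :: "real \<Rightarrow> real"
  assumes F: "(\<lambda>x. indicator {..<y} x * F x) \<in> borel_measurable borel"
  shows "integrable (on {..<y}) F \<longleftrightarrow> integrable lborel (\<lambda>u. exp (- u) * F (y - exp (- u)))"
    and "integrable (on {..<y}) F \<Longrightarrow>
      integral\<^sup>L (on {..<y}) F = (\<integral>u. exp (- u) * F (y - exp (- u)) \<partial>lborel)"
proof -
  define F' where "F' x = indicator {..<y} x * F x" for x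
  define H where "H u = exp (- u) * F (y - exp (- u))" for u
  have F': "F' \<in> borel_measurable borel" using F by (simp add: F'_def[abs_def])
  have H_eq: "H u = \<bar>exp (- u)\<bar> * F' (y - exp (- u))" for u
    by (simp add: H_def F'_def)
  have "(\<lambda>u. y - exp (- u :: real)) \<in> borel_measurable borel" by measurable
  then have H: "H \<in> borel_measurable borel"
    unfolding H_eq using measurable_compose[OF _ F'] by measurable
  have img: "(\<lambda>u. y - exp (- u)) ` UNIV = {..<y}"
  proof (intro equalityI subsetI)
    fix x assume "x \<in> {..<y}"
    then show "x \<in> (\<lambda>u. y - exp (- u)) ` UNIV" by (intro image_eqI[of _ _ "- ln (y - x)"]) auto
  qed auto
  have cov: "((\<lambda>u. \<bar>exp (- u)\<bar> * F' (y - exp (- u))) absolutely_integrable_on UNIV \<and>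
      integral UNIV (\<lambda>u. \<bar>exp (- u)\<bar> * F' (y - exp (- u))) = b) \<longleftrightarrow>
    (F' absolutely_integrable_on (\<lambda>u. y - exp (- u)) ` UNIV \<and> integral ((\<lambda>u. y - exp (- u)) ` UNIV) F' = b)" for b
    by (rule has_absolute_integral_change_of_variables_1') (auto intro!: derivative_eq_intros injI)
  have ind: "indicator {..<y} x *\<^sub>R F' x = F' x" for x by (simp add: F'_def indicator_def)
  have cov': "H absolutely_integrable_on UNIV \<and> integral UNIV H = b \<longleftrightarrow>
      F' absolutely_integrable_on {..<y} \<and> integral {..<y} F' = b" for b
    using cov[of b] unfolding img H_eq[symmetric] by (simp add: H_eq[abs_def])
  have abs_H: "H absolutely_integrable_on UNIV \<longleftrightarrow> integrable lborel H"
    using H integrable_completion[of H lborel] by (simp add: set_integrable_def)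
  have abs_F: "F' absolutely_integrable_on {..<y} \<longleftrightarrow> integrable lborel F'"
    using F' integrable_completion[of F' lborel] by (simp only: set_integrable_def ind) simp
  have on_F: "integrable (on {..<y}) F \<longleftrightarrow> integrable lborel F'"
    by (subst integrable_restrict_space) (simp_all add: F'_def[abs_def])
  have int_F: "integral {..<y} F' = integral\<^sup>L (on {..<y}) F" if "integrable lborel F'"
  proof -
    have "set_integrable lebesgue {..<y} F'" using that abs_F by simp
    then have "integral {..<y} F' = (LINT x:{..<y}|lebesgue. F' x)"
      by (rule set_lebesgue_integral_eq_integral(2)[symmetric])
    also have "\<dots> = integral\<^sup>L lborel F'"
      using F' by (simp only: set_lebesgue_integral_def ind) (simp add: integral_completion)
    also have "\<dots> = integral\<^sup>L (on {..<y}) F"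
      by (subst integral_restrict_space) (simp_all add: F'_def[abs_def])
    finally show ?thesis .
  qed
  show *: "integrable (on {..<y}) F \<longleftrightarrow> integrable lborel (\<lambda>u. exp (- u) * F (y - exp (- u)))"
    using cov' abs_H abs_F on_F unfolding H_def[abs_def] by blast
  assume "integrable (on {..<y}) F"
  then have "integrable lborel F'" "integrable lborel H" using * on_F by (simp_all add: H_def[abs_def])
  then have "integral\<^sup>L (on {..<y}) F = integral UNIV H"
    using int_F cov'[of "integral UNIV H"] abs_H by simp
  also have "\<dots> = integral\<^sup>L lborel H" using \<open>integrable lborel H\<close> by (rule integral_lborel)
  finally show "integral\<^sup>L (on {..<y}) F = (\<integral>u. exp (- u) * F (y - exp (- u)) \<partial>lborel)"
    by (simp add: H_def[abs_def])
qed

text \<open>Transport by the unitary map belonging to x = y - e^(-u); the factor (y - x)^(-1/2) is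
  the square root of du/dx. The determinant is computed in a chosen basis, so one has to exist on
  every half-line.\<close>

lemma orthonormal_basis_half_line:
  assumes e: "orthonormal_basis (lborel :: real measure) e"
  shows "orthonormal_basis (on {..<y}) (\<lambda>i x. e i (- ln (y - x)) * exp (- ln (y - x) / 2))"
proof -
  define U where "U i x = e i (- ln (y - x)) * exp (- ln (y - x) / 2)" for i x
  have eL: "e i \<in> L2_space lborel" for i using e by (simp add: orthonormal_basis_def)
  have [measurable]: "e i \<in> borel_measurable borel" for i
    using L2_spaceD(1)[OF eL[of i]] by simp
  have [measurable]: "U i \<in> borel_measurable borel" for i unfolding U_def by measurable
  have U: "U i (y - exp (- u)) = e i u * exp (u / 2)" for i u by (simp add: U_def)
  have E: "exp (u / 2) * exp (u / 2) = exp u" "exp (- u / 2) * exp (- u / 2) = exp (- u)"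
    "exp (- u) * exp (u / 2) = exp (- u / 2)" for u :: real
    by (simp_all flip: exp_add)
  have UU: "exp (- u) * (U i (y - exp (- u)) * U j (y - exp (- u))) = e i u * e j u" for i j u
  proof -
    have "exp (- u) * (U i (y - exp (- u)) * U j (y - exp (- u))) = (exp (- u) * (exp (u / 2) * exp (u / 2))) * (e i u * e j u)"
      by (simp add: U mult_ac)
    then show ?thesis unfolding E by (simp flip: exp_add)
  qed
  have m: "(\<lambda>x. indicator {..<y} x * (U i x * U j x)) \<in> borel_measurable borel" for i j by measurable
  have iUU: "integrable (on {..<y}) (\<lambda>x. U i x * U j x)" for i j
    unfolding half_line_substitution(1)[OF m] UU by (rule L2_mult_integrable[OF eL eL])
  have UL: "U i \<in> L2_space (on {..<y})" for i
    using iUU[of i i] unfolding L2_space_def power2_eq_square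
    by (simp add: borel_measurable_restrict_space_iff)
  have ortho: "L2_inner (on {..<y}) (U i) (U j) = (if i = j then 1 else 0)" for i j
    using e unfolding L2_inner_def half_line_substitution(2)[OF m iUU] UU
    by (simp add: orthonormal_basis_def L2_inner_def)
  have complete: "AE x in on {..<y}. f x = 0"
    if f: "f \<in> L2_space (on {..<y})" and 0: "\<And>i. L2_inner (on {..<y}) (U i) f = 0" for f
  proof -
    define h where "h u = f (y - exp (- u)) * exp (- u / 2)" for u
    have f': "(\<lambda>x. indicator {..<y} x * f x) \<in> borel_measurable borel"
      using L2_spaceD(1)[OF f] by (simp add: borel_measurable_restrict_space_iff)
    have "(\<lambda>u. y - exp (- u :: real)) \<in> borel_measurable borel" by measurable
    from measurable_compose[OF this f'] have "(\<lambda>u. f (y - exp (- u))) \<in> borel_measurable borel"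
      by simp
    then have hm: "h \<in> borel_measurable borel" unfolding h_def by measurable
    have ff: "exp (- u) * (f (y - exp (- u)))\<^sup>2 = (h u)\<^sup>2" for u
    proof -
      have "(h u)\<^sup>2 = (exp (- u / 2) * exp (- u / 2)) * (f (y - exp (- u)))\<^sup>2"
        by (simp add: h_def power2_eq_square mult_ac)
      then show ?thesis unfolding E by simp
    qed
    have "(\<lambda>x. (indicator {..<y} x * f x)\<^sup>2) \<in> borel_measurable borel"
      using f' by measurable
    also have "(\<lambda>x. (indicator {..<y} x * f x)\<^sup>2) = (\<lambda>x. indicator {..<y} x * (f x)\<^sup>2)"
      by (auto simp: indicator_def fun_eq_iff)
    finally have m2: "(\<lambda>x. indicator {..<y} x * (f x)\<^sup>2) \<in> borel_measurable borel" .
    have hL: "h \<in> L2_space lborel"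
      using L2_spaceD(2)[OF f] hm unfolding half_line_substitution(1)[OF m2] ff by (simp add: L2_space_def)
    have "L2_inner lborel (e i) h = 0" for i
    proof -
      have Uf: "exp (- u) * (U i (y - exp (- u)) * f (y - exp (- u))) = e i u * h u" for u
      proof -
        have "exp (- u) * (U i (y - exp (- u)) * f (y - exp (- u))) = (exp (- u) * exp (u / 2)) * (e i u * f (y - exp (- u)))"
          by (simp add: U mult_ac)
        then show ?thesis unfolding E h_def by (simp add: mult_ac)
      qed
      have "(\<lambda>x. U i x * (indicator {..<y} x * f x)) \<in> borel_measurable borel" using f' by measurable
      then have m3: "(\<lambda>x. indicator {..<y} x * (U i x * f x)) \<in> borel_measurable borel" by (simp add: mult_ac)
      have "L2_inner (on {..<y}) (U i) f = L2_inner lborel (e i) h"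
        unfolding L2_inner_def half_line_substitution(2)[OF m3 L2_mult_integrable[OF UL f]] Uf ..
      then show ?thesis using 0 by simp
    qed
    then have "AE u in lborel. h u = 0" using e hL unfolding orthonormal_basis_def by blast
    then have "L2_inner lborel h h = 0" using L2_inner_self_eq_0_iff[OF hL] by simp
    moreover have "L2_inner (on {..<y}) f f = L2_inner lborel h h"
      unfolding L2_inner_def power2_eq_square[symmetric] half_line_substitution(2)[OF m2 L2_spaceD(2)[OF f]] ff ..
    ultimately show ?thesis using L2_inner_self_eq_0_iff[OF f] by simp
  qed
  show ?thesis
    unfolding orthonormal_basis_def U_def[symmetric] using UL ortho complete by blast
qed

section \<open>The regularized determinant\<close>

text \<open>For self-adjoint \<open>a\<close> with \<open>1 + a\<close> coercive, \<open>(1 + a) e\<^bsup>-a\<^esup> = 1 - p\<close> with \<open>p\<close> positive and of trace class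
  because \<open>(1 + a) e\<^bsup>-a\<^esup>\<close> has derivative \<open>- s a\<^sup>2 e\<^bsup>-sa\<^esup>\<close> along \<open>s a\<close>.\<close>

locale coercive_kernel =
  fixes a :: hs and \<delta> :: real
  assumes adj_a: "adj a = a" and \<delta>: "0 < \<delta>" and coercive_a: "\<And>x. \<delta> * (norm x)\<^sup>2 \<le> x \<bullet> (x + a * x)"
begin

definition p :: hs where "p = - vec ((1 + Unitz 0 a) * exp (Unitz 0 (- a)))"

lemma Unitz_neg: "Unitz 0 (- a) = - Unitz 0 a" "Unitz 0 (r *\<^sub>R a) = r *\<^sub>R Unitz 0 a"
  by (simp_all add: unitz_eq_iff)

lemma commute: "Unitz 0 a * exp (Unitz 0 (r *\<^sub>R a)) = exp (Unitz 0 (r *\<^sub>R a)) * Unitz 0 a"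
  unfolding Unitz_neg by (rule exp_times_scaleR_commute[symmetric])

lemma one_minus_p: "1 - Unitz 0 p = (1 + Unitz 0 a) * exp (Unitz 0 (- a))"
  by (simp add: unitz_eq_iff p_def scal_exp)

lemma adj_p: "adj p = p"
proof -
  have "uadj (1 - Unitz 0 p) = 1 - Unitz 0 p"
    unfolding one_minus_p uadj_mult
    using commute[of "-1"] uadj_exp[of "- a"]
    by (simp add: adj_uminus adj_a distrib_left distrib_right)
      (simp add: uadj_def unitz_eq_iff adj_a distrib_left distrib_right)
  then show ?thesis by (simp add: uadj_def unitz_eq_iff adj_uminus)
qed

text \<open>Bounds the norm of e^(-sa) for s in [0, 1].\<close>

definition C :: real where "C = exp (norm a)"

lemma inner_exp_bounds:
  assumes "0 \<le> s" "s \<le> 1"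
  shows "0 \<le> x \<bullet> act (exp (Unitz 0 (- s *\<^sub>R a))) x" "x \<bullet> act (exp (Unitz 0 (- s *\<^sub>R a))) x \<le> C * (norm x)\<^sup>2"
proof -
  have sa: "adj (- s *\<^sub>R a) = - s *\<^sub>R a" using adj_scaleR[of "- s" a] adj_a by simp
  show "0 \<le> x \<bullet> act (exp (Unitz 0 (- s *\<^sub>R a))) x"
    unfolding inner_act_exp[OF sa] by simp
  have "x \<bullet> act (exp (Unitz 0 (- s *\<^sub>R a))) x \<le> norm x * norm (act (exp (Unitz 0 (- s *\<^sub>R a))) x)"
    by (rule norm_cauchy_schwarz)
  also have "\<dots> \<le> norm x * (norm (exp (Unitz 0 (- s *\<^sub>R a))) * norm x)"
    by (intro mult_left_mono norm_act_le) simp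
  also have "\<dots> \<le> norm x * (C * norm x)"
  proof (intro mult_left_mono mult_right_mono)
    have "norm (exp (Unitz 0 (- s *\<^sub>R a))) \<le> exp (norm (- s *\<^sub>R a))"
      using norm_exp[of "Unitz 0 (- s *\<^sub>R a)"] by simp
    also have "\<dots> \<le> C" using assms mult_right_mono[of s 1 "norm a"] by (simp add: C_def)
    finally show "norm (exp (Unitz 0 (- s *\<^sub>R a))) \<le> C" .
  qed auto
  finally show "x \<bullet> act (exp (Unitz 0 (- s *\<^sub>R a))) x \<le> C * (norm x)\<^sup>2"
    by (simp add: power2_eq_square mult_ac)
qed

text \<open>The form of \<open>p\<close> at x is \<phi> 0 - \<phi> 1, and on [0, 1] the derivative
  of \<phi> lies between - C |a x|^2 and 0. That the upper bound is quadratic in a x makes the trace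
  finite, since the sum of |a u_i|^2 over an orthonormal system is.\<close>

lemma p_bounds: "0 \<le> x \<bullet> (p * x)" "x \<bullet> (p * x) \<le> C * (norm (a * x))\<^sup>2"
proof -
  let ?A = "Unitz 0 a"
  define \<phi> where "\<phi> s = x \<bullet> act ((1 + s *\<^sub>R ?A) * exp (s *\<^sub>R (- ?A))) x" for s
  define \<phi>' where "\<phi>' s = - s * ((a * x) \<bullet> act (exp (Unitz 0 (- s *\<^sub>R a))) (a * x))" for s
  have "bounded_linear (\<lambda>m. x \<bullet> act m x)"
    unfolding act_def
    by (intro bounded_linear_compose[OF bounded_linear_inner_right] bounded_linear_add
        bounded_linear_compose[OF bounded_linear_scaleR_left bounded_linear_scal]
        bounded_linear_compose[OF bounded_linear_mult_left bounded_linear_vec])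
  note bl = this
  have \<phi>: "(\<phi> has_real_derivative \<phi>' s) (at s)" for s
  proof -
    let ?e = "exp (s *\<^sub>R (- ?A))"
    have e: "?e = exp (Unitz 0 (- s *\<^sub>R a))" unfolding Unitz_neg(2) by simp
    have "((\<lambda>s. (1 + s *\<^sub>R ?A) * exp (s *\<^sub>R (- ?A))) has_vector_derivative
        (1 + s *\<^sub>R ?A) * (- ?A * ?e) + ?A * ?e) (at s)"
      by (intro has_vector_derivative_mult exp_scaleR_has_vector_derivative_left)
        (auto intro!: derivative_eq_intros)
    moreover have "(1 + s *\<^sub>R ?A) * (- ?A * ?e) + ?A * ?e = - s *\<^sub>R (?A * (?A * ?e))"
      by (simp add: distrib_right)
    moreover have "?A * (?A * ?e) = ?A * (?e * ?A)"
      unfolding e using commute[of "- s"] by simp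
    ultimately have "((\<lambda>s. (1 + s *\<^sub>R ?A) * exp (s *\<^sub>R (- ?A))) has_vector_derivative - s *\<^sub>R (?A * (?e * ?A))) (at s)"
      by simp
    from bounded_linear.has_vector_derivative[OF bl this]
    have "(\<phi> has_vector_derivative x \<bullet> act (- s *\<^sub>R (?A * (?e * ?A))) x) (at s)"
      by (simp add: \<phi>_def[abs_def])
    moreover have "x \<bullet> act (- s *\<^sub>R (?A * (?e * ?A))) x = \<phi>' s"
    proof -
      have aA: "act ?A z = a * z" for z by (simp add: act_def)
      have "x \<bullet> act (- s *\<^sub>R (?A * (?e * ?A))) x = - s * (x \<bullet> act (?A * (?e * ?A)) x)"
        by (simp add: act_def inner_add_right algebra_simps)
      also have "x \<bullet> act (?A * (?e * ?A)) x = (a * x) \<bullet> act ?e (a * x)"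
        using inner_mult_left[of a x "act ?e (a * x)"] by (simp add: act_mult aA adj_a)
      finally show ?thesis by (simp only: \<phi>'_def e)
    qed
    ultimately show ?thesis by (simp add: has_real_derivative_iff_has_vector_derivative)
  qed
  have p: "x \<bullet> (p * x) = \<phi> 0 - \<phi> 1"
  proof -
    have "\<phi> 1 = x \<bullet> act (1 - Unitz 0 p) x" by (simp add: \<phi>_def one_minus_p Unitz_neg)
    also have "\<dots> = x \<bullet> x - x \<bullet> (p * x)" by (simp add: act_def inner_diff_right)
    finally show ?thesis by (simp add: \<phi>_def)
  qed
  have "\<phi> 1 \<le> \<phi> 0"
  proof (rule DERIV_nonpos_imp_nonincreasing[where f = \<phi> and a = 0 and b = 1])
    show "\<exists>d. (\<phi> has_real_derivative d) (at s) \<and> d \<le> 0" if "0 \<le> s" "s \<le> 1" for s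
      using inner_exp_bounds(1)[OF that, of "a * x"] that \<phi>[of s]
      by (intro exI[of _ "\<phi>' s"]) (simp add: \<phi>'_def)
  qed simp
  then show "0 \<le> x \<bullet> (p * x)" using p by simp
  have "\<phi> 0 + C * (norm (a * x))\<^sup>2 * 0 \<le> \<phi> 1 + C * (norm (a * x))\<^sup>2 * 1"
  proof (rule DERIV_nonneg_imp_nondecreasing[where f = "\<lambda>s. \<phi> s + C * (norm (a * x))\<^sup>2 * s"])
    fix s :: real assume s: "0 \<le> s" "s \<le> 1"
    have "s * ((a * x) \<bullet> act (exp (Unitz 0 (- s *\<^sub>R a))) (a * x)) \<le> 1 * (C * (norm (a * x))\<^sup>2)"
      using inner_exp_bounds[OF s, of "a * x"] s by (intro mult_mono) auto
    then have "0 \<le> \<phi>' s + C * (norm (a * x))\<^sup>2" by (simp add: \<phi>'_def)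
    moreover have "((\<lambda>s. \<phi> s + C * (norm (a * x))\<^sup>2 * s) has_real_derivative \<phi>' s + C * (norm (a * x))\<^sup>2) (at s)"
      by (auto intro!: derivative_eq_intros \<phi>)
    ultimately show "\<exists>d. ((\<lambda>s. \<phi> s + C * (norm (a * x))\<^sup>2 * s) has_real_derivative d) (at s) \<and> 0 \<le> d"
      by blast
  qed simp
  then show "x \<bullet> (p * x) \<le> C * (norm (a * x))\<^sup>2" using p by simp
qed

text \<open>One half of e^(-a) commutes past 1 + a, leaving the symmetric product e^(-a/2) (1 + a)
  e^(-a/2): the middle factor contributes \<delta>, the outer ones e^(-|a|).\<close>

lemma one_minus_p_coercive: "\<delta> * exp (- norm a) * (norm x)\<^sup>2 \<le> x \<bullet> x - x \<bullet> (p * x)"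
proof -
  let ?e = "exp (Unitz 0 ((1/2) *\<^sub>R (- a)))" and ?A = "Unitz 0 a"
  have na: "adj (- a) = - a" by (simp add: adj_uminus adj_a)
  have e2: "exp (Unitz 0 (- a)) = ?e * ?e"
    using exp_Unitz_add[of "1/2" "- a" "1/2"] by simp
  have com: "?A * ?e = ?e * ?A" using commute[of "- 1/2"] by simp
  have ue: "uadj ?e = ?e" by (rule uadj_exp) (simp only: adj_scaleR na)
  have "?e * (1 + ?A) = (1 + ?A) * ?e"
    by (simp only: distrib_left distrib_right com mult_1_left mult_1_right)
  then have "?e * ((1 + ?A) * ?e) = (1 + ?A) * ?e * ?e"
    by (simp only: mult.assoc[symmetric])
  then have "(1 + ?A) * exp (Unitz 0 (- a)) = ?e * ((1 + ?A) * ?e)"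
    by (simp only: e2 mult.assoc)
  then have "x \<bullet> act (1 - Unitz 0 p) x = x \<bullet> act ?e (act (1 + ?A) (act ?e x))"
    unfolding one_minus_p by (simp only: act_mult)
  also have "\<dots> = act ?e x \<bullet> act (1 + ?A) (act ?e x)"
    using inner_act[of ?e x "act (1 + ?A) (act ?e x)"] by (simp only: ue)
  also have "\<dots> \<ge> \<delta> * (norm (act ?e x))\<^sup>2"
    using coercive_a[of "act ?e x"] by (simp add: act_add_left) (simp add: act_def)
  finally have 1: "\<delta> * (norm (act ?e x))\<^sup>2 \<le> x \<bullet> act (1 - Unitz 0 p) x" .
  have "exp (- norm a) * (norm x)\<^sup>2 \<le> (norm (act ?e x))\<^sup>2"
    using exp_coercive[OF na, of x] unfolding inner_act_exp[OF na] by simp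
  then have "\<delta> * (exp (- norm a) * (norm x)\<^sup>2) \<le> \<delta> * (norm (act ?e x))\<^sup>2"
    using \<delta> by (intro mult_left_mono) auto
  also note 1
  also have "x \<bullet> act (1 - Unitz 0 p) x = x \<bullet> x - x \<bullet> (p * x)"
    by (simp add: act_def inner_diff_right)
  finally show ?thesis by (simp add: mult.assoc)
qed

text \<open>The right-hand side dominates \<open>V \<bullet> (1 - p) V + X \<bullet> (1 - p)\<^sup>-\<^sup>1 X\<close>, since
  \<open>(1 - p)\<^sup>-\<^sup>1 = 1 + p + p (1 - p)\<^sup>-\<^sup>1 p\<close>.\<close>

lemma one_minus_p_dominated:
  defines "\<kappa> \<equiv> \<delta> * exp (- norm a)"
  shows "2 * (X \<bullet> V) \<le> (norm V)\<^sup>2 - V \<bullet> (p * V) + ((norm X)\<^sup>2 + X \<bullet> (p * X) + (norm (p * X))\<^sup>2 / \<kappa>)"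
proof -
  have \<kappa>: "0 < \<kappa>" using \<delta> by (simp add: \<kappa>_def)
  \<comment> \<open>With V = X + W the right side minus the left is |W|^2 - <W, pW> - 2 <W, pX> +
    |pX|^2 / \<kappa>; coercivity of 1 - p bounds it below by a perfect square.\<close>
  define W where "W = V - X"
  have V: "V = X + W" by (simp add: W_def)
  have sym: "X \<bullet> (p * W) = W \<bullet> (p * X)"
    using inner_mult_left[of p X W] by (simp add: adj_p inner_commute)
  have "2 * (W \<bullet> (p * X)) \<le> \<kappa> * (norm W)\<^sup>2 + (norm (p * X))\<^sup>2 / \<kappa>"
  proof -
    have "0 \<le> (norm (\<kappa> *\<^sub>R W - p * X))\<^sup>2 / \<kappa>" using \<kappa> by simp
    also have "\<dots> = (\<kappa>\<^sup>2 * (norm W)\<^sup>2 - 2 * \<kappa> * (W \<bullet> (p * X)) + (norm (p * X))\<^sup>2) / \<kappa>"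
      unfolding power2_norm_eq_inner
      by (simp add: inner_diff_left inner_diff_right inner_commute power2_eq_square[of \<kappa>] algebra_simps)
    also have "\<dots> = \<kappa> * (norm W)\<^sup>2 - 2 * (W \<bullet> (p * X)) + (norm (p * X))\<^sup>2 / \<kappa>"
      using \<kappa> by (simp add: field_simps power2_eq_square)
    finally show ?thesis by simp
  qed
  moreover have "\<kappa> * (norm W)\<^sup>2 \<le> W \<bullet> W - W \<bullet> (p * W)"
    unfolding \<kappa>_def by (rule one_minus_p_coercive)
  ultimately show ?thesis
    unfolding V power2_norm_eq_inner
    by (simp add: inner_add_left inner_add_right distrib_left sym inner_commute[of W X])
qed

end

text \<open>In the chosen basis the operator (1 + a) e^(-a) - 1 has the matrix -P, so the
  determinant is the series of \<open>infsum_principal_minors_pos\<close>. Its hypotheses are the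
  bounds on \<open>p\<close> at finite linear combinations of basis vectors.\<close>

lemma (in region) det2_nonzero:
  assumes T: "represents T (Unitz 0 a)" and a: "adj a = a" "box \<Omega> a = a"
    and \<delta>: "0 < \<delta>" "\<And>x. \<delta> * (norm x)\<^sup>2 \<le> x \<bullet> (x + a * x)"
    and basis: "orthonormal_basis (on \<Omega>) e0"
  shows "det2 (on \<Omega>) T \<noteq> 0"
proof -
  interpret K: coercive_kernel a \<delta> using a \<delta> by unfold_locales
  define e where "e = (SOME e. orthonormal_basis (on \<Omega>) e)"
  have "orthonormal_basis (on \<Omega>) e" unfolding e_def using basis by (rule someI[of "orthonormal_basis (on \<Omega>)"])
  then have e: "\<And>i. e i \<in> L2_space (on \<Omega>)" "\<And>i j. L2_inner (on \<Omega>) (e i) (e j) = (if i = j then 1 else 0)"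
    by (auto simp: orthonormal_basis_def)
  define T' where "T' = (\<lambda>f x. id_plus T (exp_op (on \<Omega>) (\<lambda>g u. - T g u) f) x - f x)"
  have "represents (\<lambda>g u. - T g u) (Unitz 0 (- a))"
    using represents_scale[OF T, of "-1"] by (simp add: scaleR_unitz_def)
  moreover have "box \<Omega> (- a) = - a"
    using a(2) linear_neg[OF bounded_linear.linear[OF bounded_linear_box], of a] by simp
  ultimately have E: "represents (exp_op (on \<Omega>) (\<lambda>g u. - T g u)) (exp (Unitz 0 (- a)))"
    by (rule represents_exp_op)
  have "represents T' ((1 + Unitz 0 a) * exp (Unitz 0 (- a)) - 1)"
    unfolding T'_def by (rule represents_diff_id[OF represents_compose[OF represents_id_plus[OF T] E]])
  moreover have "(1 + Unitz 0 a) * exp (Unitz 0 (- a)) - 1 = Unitz 0 (- K.p)"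
    unfolding K.one_minus_p[symmetric] by (simp add: unitz_eq_iff)
  ultimately have T': "represents T' (Unitz 0 (- K.p))" by simp
  define u where "u i = emb \<Omega> (e i)" for i
  have uu: "u i \<bullet> u j = (if i = j then 1 else 0)" for i j
    by (simp add: u_def inner_emb e)
  define P where "P i j = u i \<bullet> (K.p * u j)" for i j
  have entry: "L2_inner (on \<Omega>) (e i) (T' (e j)) = - P i j" for i j
    using representsD[OF T' e(1)[of j]] inner_emb[OF e(1)[of i] representsD(1)[OF T' e(1)[of j]]]
    by (simp add: P_def u_def act_def)
  have det: "det2 (on \<Omega>) T = (\<Sum>\<^sub>\<infinity>J\<in>{J. finite J}. principal_minor (\<lambda>i j. - P i j) J)"
    unfolding det2_def fredholm_det_def Let_def e_def[symmetric] T'_def[symmetric] entry ..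
  define comb where "comb J v = (\<Sum>j\<in>J. v j *\<^sub>R u j)" for J :: "nat set" and v :: "nat \<Rightarrow> real"
  have inner_comb: "comb J x \<bullet> comb J v = (\<Sum>j\<in>J. x j * v j)" if "finite J" for J x v
  proof -
    have "comb J x \<bullet> comb J v = (\<Sum>i\<in>J. \<Sum>j\<in>J. if j = i then x i * v i else 0)"
      unfolding comb_def inner_sum_left inner_sum_right
      by (intro sum.cong refl) (simp add: uu)
    then show ?thesis using that by simp
  qed
  have P_sym: "P i j = P j i" for i j
    using inner_mult_left[of K.p "u i" "u j"] by (simp add: P_def K.adj_p inner_commute)
  have quad_comb: "quad P J v = comb J v \<bullet> (K.p * comb J v)" for J v
  proof -
    have "comb J v \<bullet> (K.p * comb J v) = (\<Sum>j\<in>J. \<Sum>i\<in>J. v i * v j * P i j)"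
      unfolding comb_def inner_sum_left sum_distrib_left inner_sum_right P_def
      by (subst sum.swap, intro sum.cong refl) (use P_sym[unfolded P_def] in simp)
    then show ?thesis unfolding quad_def by (subst sum.swap) simp
  qed
  define \<kappa> where "\<kappa> = \<delta> * exp (- norm a)"
  have \<kappa>: "0 < \<kappa>" using \<delta> by (simp add: \<kappa>_def)
  have P_sum: "summable (\<lambda>i. P i i)"
  proof (rule summable_comparison_test'[where N = 0])
    show "summable (\<lambda>i. K.C * (norm (a * emb \<Omega> (e i)))\<^sup>2)"
      by (intro summable_mult bessel e)
    show "norm (P i i) \<le> K.C * (norm (a * emb \<Omega> (e i)))\<^sup>2" for i
      using K.p_bounds[of "u i"] by (simp add: P_def u_def)
  qed
  have "0 < (\<Sum>\<^sub>\<infinity>J\<in>{J. finite J}. principal_minor (\<lambda>i j. - P i j) J)"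
  proof (rule infsum_principal_minors_pos)
    show "P i j = P j i" for i j by (rule P_sym)
    show "0 \<le> quad P J v" for J v by (simp add: quad_comb K.p_bounds)
    show "summable (\<lambda>i. P i i)" by (rule P_sum)
    show "2 * (\<Sum>j\<in>J. x j * v j) \<le> (\<Sum>j\<in>J. (v j)\<^sup>2) - quad P J v +
        ((norm (comb J x))\<^sup>2 + comb J x \<bullet> (K.p * comb J x) + (norm (K.p * comb J x))\<^sup>2 / \<kappa>)"
      if "finite J" for J x v
      using K.one_minus_p_dominated[of "comb J x" "comb J v"] that
      by (simp add: quad_comb inner_comb \<kappa>_def power2_norm_eq_inner[of "comb J v"] power2_eq_square[of "v _"])
    \<comment> \<open>This fixes h j = P j j + |p u_j|^2 / \<kappa>: the first part is summable by
      the trace bound, the second by Bessel.\<close>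
    show "(norm (comb J (delta j)))\<^sup>2 + comb J (delta j) \<bullet> (K.p * comb J (delta j)) +
        (norm (K.p * comb J (delta j)))\<^sup>2 / \<kappa> = 1 + (P j j + (norm (K.p * u j))\<^sup>2 / \<kappa>)"
      if "finite J" "j \<in> J" for J j
    proof -
      have "comb J (delta j) = (\<Sum>k\<in>J. if k = j then u j else 0)"
        unfolding comb_def by (intro sum.cong) auto
      then have "comb J (delta j) = u j" using that by simp
      then show ?thesis by (simp add: P_def power2_norm_eq_inner[of "u j"] uu)
    qed
    show "summable (\<lambda>j. P j j + (norm (K.p * u j))\<^sup>2 / \<kappa>)"
      unfolding u_def by (intro summable_add P_sum summable_divide bessel e)
    show "0 \<le> P j j + (norm (K.p * u j))\<^sup>2 / \<kappa>" for j
      using \<kappa> K.p_bounds[of "u j"] by (simp add: P_def)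
  qed
  then show ?thesis by (simp add: det)
qed

section \<open>Solution of the flow\<close>

text \<open>Coercivity gives a right inverse; since \<open>a\<close> is self-adjoint, its adjoint is
  a left inverse, so the two coincide. Inserting the two equations for r into each other gives r = a
  a + a r a - a, where every term is enclosed by factors supported in the square.\<close>

lemma (in region) resolvent_exists:
  assumes a: "adj a = a" "box \<Omega> a = a" and \<delta>: "0 < \<delta>" "\<And>x. \<delta> * (norm x)\<^sup>2 \<le> x \<bullet> (x + a * x)"
  shows "\<exists>r. box \<Omega> r = r \<and> (1 + Unitz 0 a) * (1 + Unitz 0 r) = 1 \<and> (1 + Unitz 0 r) * (1 + Unitz 0 a) = 1"
proof -
  interpret T: coercive_operator "\<lambda>x. x + a * x" \<delta>
    by (rule coercive_operator.intro)
      (intro bounded_linear_add bounded_linear_ident bounded_linear_mult_right, fact, rule \<delta>(2))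
  obtain r where r: "r + a * r = - a" using T.surj[of "- a"] by blast
  have "(r + a * r) + a = 0" unfolding r by simp
  then have right: "(1 + Unitz 0 a) * (1 + Unitz 0 r) = 1"
    by (simp add: unitz_eq_iff ac_simps)
  then have "uadj ((1 + Unitz 0 a) * (1 + Unitz 0 r)) = uadj 1" by simp
  then have left: "(1 + Unitz 0 (adj r)) * (1 + Unitz 0 a) = 1"
    unfolding uadj_mult by (simp add: uadj_def unitz_eq_iff a(1))
  have "1 + Unitz 0 (adj r) = (1 + Unitz 0 (adj r)) * ((1 + Unitz 0 a) * (1 + Unitz 0 r))"
    unfolding right by simp
  also have "\<dots> = 1 + Unitz 0 r" unfolding mult.assoc[symmetric] left by simp
  finally have adj_r: "adj r = r" by (simp add: unitz_eq_iff)
  have r1: "r = - a - a * r" using r by (simp only: eq_diff_eq)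
  have "adj (r + a * r) = adj (- a)" using r by simp
  then have "r + r * a = - a" by (simp add: adj_add adj_mult adj_uminus a(1) adj_r)
  then have r2: "r = - a - r * a" by (simp only: eq_diff_eq)
  have ara: "box \<Omega> (a * r * a) = a * r * a"
    using columns_mult_box[OF a(2), of "a * r"] rows_box_mult[OF a(2), of "r * a"]
    by (simp only: box_eq mult.assoc)
  have "r = - a - a * (- a - r * a)" using r1 by (subst r2[symmetric])
  also have "\<dots> = a * a + a * r * a - a" by (simp add: right_diff_distrib mult.assoc)
  finally have r3: "r = a * a + a * r * a - a" .
  interpret box: bounded_linear "box \<Omega>" by (rule bounded_linear_box)
  have "box \<Omega> (a * a + a * r * a - a) = a * a + a * r * a - a"
    by (simp add: box.add box.diff ara box_mult a(2))
  then have "box \<Omega> r = r" by (simp only: r3[symmetric])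
  with right left adj_r show ?thesis by auto
qed

lemma (in region) coercive_box:
  assumes "adj b = b" and s: "s = vec (exp (Unitz 0 b))"
  shows "exp (- norm b) * (norm x)\<^sup>2 \<le> x \<bullet> (x + box \<Omega> s * x)"
  unfolding box_mult_left
proof (rule coercive_compression[where P = "trunc (\<Omega> \<times> UNIV)" and S = "\<lambda>w. s * w"])
  show "exp (- norm b) * (norm w)\<^sup>2 \<le> w \<bullet> (w + s * w)" for w
    using exp_coercive[OF assms(1), of w] by (simp add: act_exp s)
qed (simp_all add: inner_trunc[OF Times_sets(2)] trunc_trunc[OF Times_sets(2,2)])

subsection \<open>The flow equation\<close>

text \<open>Restricting to z \<le> x cuts the left factor to its lower triangle, restricting to z
  \<ge> y the right factor.\<close>

lemma L2k_flow_rhs: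
  assumes A: "L2k A"
  shows "L2k (flow_rhs A)" "cls (flow_rhs A) = flow_field (cls A)"
proof -
  define B where "B = (\<lambda>u v. indicator (- upper) (u, v) * A u v)"
  have B: "L2k B" unfolding B_def by (rule L2k_indicator_mult[OF A upper_sets(2)])
  have eq: "flow_rhs A = (\<lambda>x y. kcomp B A x y - kcomp A B x y)"
    unfolding flow_rhs_def kcomp_def set_lebesgue_integral_def B_def fun_eq_iff
    by (intro allI arg_cong2[of _ _ _ _ "(-)"] Bochner_Integration.integral_cong refl)
      (auto simp: indicator_def upper_def)
  show "L2k (flow_rhs A)" unfolding eq by (intro L2k_diff L2k_kcomp A B)
  show "cls (flow_rhs A) = flow_field (cls A)"
    unfolding eq flow_field_def trunc_cls[OF A upper_sets(2)] B_def[symmetric]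
    by (simp add: cls_diff L2k_kcomp cls_mult A B)
qed

lemma flow_derivative_iff:
  assumes L: "\<And>s. s \<in> J \<Longrightarrow> L2k (L s)" and t: "t \<in> J"
  shows "((\<lambda>s. L2_norm lborel2 (\<lambda>(x, y). (L s x y - L t x y) / (s - t) - flow_rhs (L t) x y)) \<longlongrightarrow> 0) (at t within J)
    \<longleftrightarrow> ((\<lambda>s. cls (L s)) has_vector_derivative flow_field (cls (L t))) (at t within J)"
proof -
  have eq: "L2_norm lborel2 (\<lambda>(x, y). (L s x y - L t x y) / (s - t) - flow_rhs (L t) x y) =
    norm ((cls (L s) - cls (L t)) /\<^sub>R (s - t) - flow_field (cls (L t)))" if s: "s \<in> J" for s
  proof -
    let ?D = "\<lambda>x y. inverse (s - t) * (L s x y - L t x y) - flow_rhs (L t) x y"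
    have D: "L2k ?D" by (intro L2k_diff L2k_scale L s t L2k_flow_rhs)
    have "(cls (L s) - cls (L t)) /\<^sub>R (s - t) - flow_field (cls (L t)) = cls ?D"
      by (simp add: cls_diff cls_scale L2k_diff L2k_scale L s t L2k_flow_rhs flip: L2k_flow_rhs(2))
    moreover have "norm (cls ?D) = L2_norm lborel2 (case_prod ?D)"
      unfolding cls_def using D by (intro norm_abs_hs) (simp add: L2_kernel_def)
    moreover have "case_prod ?D = (\<lambda>(x, y). (L s x y - L t x y) / (s - t) - flow_rhs (L t) x y)"
      by (simp add: divide_inverse mult.commute fun_eq_iff)
    ultimately show ?thesis by simp
  qed
  have "\<forall>\<^sub>F s in at t within J. s \<in> J" by (simp add: eventually_at_filter)
  then have "\<forall>\<^sub>F s in at t within J. L2_norm lborel2 (\<lambda>(x, y). (L s x y - L t x y) / (s - t) - flow_rhs (L t) x y) =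
    norm ((cls (L s) - cls (L t)) /\<^sub>R (s - t) - flow_field (cls (L t)))"
    by eventually_elim (rule eq)
  from tendsto_cong[OF this] show ?thesis
    by (simp add: has_vector_derivative_iff_quotient tendsto_norm_zero_iff LIM_zero_iff)
qed

lemma solves_flow_iff:
  assumes K: "L2k K" and "0 \<in> J"
  shows "solves_flow J K L \<longleftrightarrow> (\<forall>t\<in>J. L2k (L t)) \<and> cls (L 0) = cls K \<and>
    (\<forall>t\<in>J. ((\<lambda>s. cls (L s)) has_vector_derivative flow_field (cls (L t))) (at t within J))"
proof (cases "\<forall>t\<in>J. L2k (L t)")
  case True
  then have "L2k (L 0)" using assms(2) by blast
  then show ?thesis
    unfolding solves_flow_def using True flow_derivative_iff[of J L] K by (simp add: cls_eq_iff)
next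
  case False
  then show ?thesis unfolding solves_flow_def by blast
qed

text \<open>C enters the integrals against K with transposed arguments, hence the adjoint;
  integrating over \<zeta>2 \<ge> \<eta> composes with the lower triangle of S + S C.\<close>

lemma solution_formula_cls:
  assumes L: "L2k K" "L2k S" "L2k C"
  shows "L2k (solution_formula K S C)"
    and "cls (solution_formula K S C) = cls K + adj (cls C) * cls K +
      (cls K + adj (cls C) * cls K) * lo (cls S + cls S * cls C)"
proof -
  define C' where "C' = (\<lambda>x y. C y x)"
  define B where "B = (\<lambda>x y. K x y + kcomp C' K x y)"
  define D where "D = (\<lambda>x y. S x y + kcomp S C x y)"
  define D' where "D' = (\<lambda>u v. indicator (- upper) (u, v) * D u v)"
  have C': "L2k C'" unfolding C'_def by (rule L2k_swap[OF L(3)])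
  have B: "L2k B" unfolding B_def by (intro L2k_add L2k_kcomp L C')
  have D: "L2k D" unfolding D_def by (intro L2k_add L2k_kcomp L)
  have D': "L2k D'" unfolding D'_def by (rule L2k_indicator_mult[OF D upper_sets(2)])
  have eq: "solution_formula K S C = (\<lambda>x y. B x y + kcomp B D' x y)"
    unfolding solution_formula_def B_def D'_def D_def C'_def kcomp_def set_lebesgue_integral_def fun_eq_iff
    by (intro allI arg_cong2[of _ _ _ _ "(+)"] Bochner_Integration.integral_cong refl)
      (auto simp: indicator_def upper_def)
  show "L2k (solution_formula K S C)" unfolding eq by (intro L2k_add L2k_kcomp B D')
  have "cls (solution_formula K S C) = cls B + cls B * cls D'"
    unfolding eq by (simp add: cls_add[symmetric] cls_mult L2k_kcomp B D')
  moreover have "cls B = cls K + adj (cls C) * cls K"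
    unfolding B_def by (simp add: cls_add[symmetric] L2k_kcomp L C' cls_mult[symmetric] adj_cls) (simp add: C'_def)
  moreover have "cls D' = lo (cls S + cls S * cls C)"
  proof -
    have "cls D = cls S + cls S * cls C"
      unfolding D_def by (simp add: cls_add[symmetric] L2k_kcomp L cls_mult)
    then show ?thesis unfolding D'_def by (simp add: trunc_cls[OF D upper_sets(2), symmetric])
  qed
  ultimately show "cls (solution_formula K S C) = cls K + adj (cls C) * cls K +
      (cls K + adj (cls C) * cls K) * lo (cls S + cls S * cls C)" by simp
qed

subsection \<open>The upper triangular factor\<close>

lemma up_cls_iff:
  assumes "L2k C"
  shows "up (cls C) = cls C \<longleftrightarrow> (AE (x, y) in lborel2. y < x \<longrightarrow> C x y = 0)"
proof -
  have "up (cls C) = cls C \<longleftrightarrow> (AE p in lborel2. indicator upper p * C (fst p) (snd p) = C (fst p) (snd p))"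
    unfolding trunc_cls[OF assms upper_sets(1)]
    using assms by (simp add: cls_eq_iff L2k_indicator_mult[OF _ upper_sets(1)] case_prod_unfold)
  also have "\<dots> \<longleftrightarrow> (AE p in lborel2. snd p < fst p \<longrightarrow> C (fst p) (snd p) = 0)"
  proof
    assume "AE p in lborel2. indicator upper p * C (fst p) (snd p) = C (fst p) (snd p)"
    then show "AE p in lborel2. snd p < fst p \<longrightarrow> C (fst p) (snd p) = 0"
      by eventually_elim (auto simp: upper_def indicator_def split: if_splits)
  next
    assume "AE p in lborel2. snd p < fst p \<longrightarrow> C (fst p) (snd p) = 0"
    then show "AE p in lborel2. indicator upper p * C (fst p) (snd p) = C (fst p) (snd p)"
      using AE_off_diagonal by eventually_elim (auto simp: upper_def indicator_def)
  qed
  finally show ?thesis by (simp add: case_prod_unfold)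
qed

lemma AE_below_iff: "(AE x in on {..<y}. P x) \<longleftrightarrow> (AE x in lborel. x < y \<longrightarrow> P x)"
  by (subst AE_restrict_space_iff) auto

text \<open>Column y of C lives on (-inf, y), so integrating S C over the line or over (-inf, y) is
  the same. The kernel equation, which concerns only x < y, thus separates into one equation on each
  half-line.\<close>

lemma upper_equation_iff:
  assumes S: "L2k S" and C: "L2k C" and up: "up (cls C) = cls C"
  shows "cls C + up (cls S * cls C) = - up (cls S) \<longleftrightarrow>
    (AE y in lborel. AE x in on {..<y}. C x y + integral_op (on {..<y}) S (\<lambda>u. C u y) x = - S x y)"
proof -
  note [measurable (raw)] = L2k_measurable[OF S] L2k_measurable[OF C]
    L2k_measurable[OF L2k_kcomp[OF S C]]
  let ?D = "\<lambda>x y. C x y + kcomp S C x y + S x y"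
  have D: "L2k ?D" by (intro L2k_add L2k_kcomp S C)
  have "cls C + up (cls S * cls C) = - up (cls S) \<longleftrightarrow> up (cls ?D) = 0"
    by (simp add: cls_add[symmetric] cls_mult[symmetric] L2k_add L2k_kcomp S C up_add up add_eq_0_iff2)
  also have "\<dots> \<longleftrightarrow> (AE p in lborel2. fst p < snd p \<longrightarrow> ?D (fst p) (snd p) = 0)"
    unfolding trunc_cls[OF D upper_sets(1)] cls_zero
    using D by (simp add: cls_eq_iff L2k_indicator_mult[OF _ upper_sets(1)] L2k_zero case_prod_unfold)
      (simp add: indicator_def upper_def)
  also have "\<dots> \<longleftrightarrow> (AE x in lborel. AE y in lborel. x < y \<longrightarrow> ?D x y = 0)"
    by (rule lborel_pair.AE_pair_iff[symmetric]) measurable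
  also have "\<dots> \<longleftrightarrow> (AE y in lborel. AE x in lborel. x < y \<longrightarrow> ?D x y = 0)"
    by (rule lborel_pair.AE_commute) measurable
  also have "\<dots> \<longleftrightarrow> (AE y in lborel. AE x in on {..<y}. C x y + integral_op (on {..<y}) S (\<lambda>u. C u y) x = - S x y)"
  proof -
    have "AE p in lborel2. snd p \<le> fst p \<longrightarrow> C (fst p) (snd p) = 0"
    proof -
      have "AE p in lborel2. snd p < fst p \<longrightarrow> C (fst p) (snd p) = 0"
        using up up_cls_iff[OF C] by (simp add: case_prod_unfold)
      then show ?thesis using AE_off_diagonal by eventually_elim auto
    qed
    from lborel_pair.AE_pair[OF this] have "AE x in lborel. AE y in lborel. y \<le> x \<longrightarrow> C x y = 0"
      by simp
    \<comment> \<open>Measurability of this set allows the two almost everywhere quantifiers to be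
      exchanged, from rows to columns.\<close>
    moreover have "{p \<in> space lborel2. snd p \<le> fst p \<longrightarrow> C (fst p) (snd p) = 0} \<in> sets lborel2"
      by measurable
    note lborel_pair.AE_commute[OF this]
    ultimately have "AE y in lborel. AE x in lborel. y \<le> x \<longrightarrow> C x y = 0" by blast
    then have "AE y in lborel. \<forall>x. kcomp S C x y = integral_op (on {..<y}) S (\<lambda>u. C u y) x"
    proof eventually_elim
      case (elim y)
      show ?case
      proof
        fix x
        have "integral_op (on {..<y}) S (\<lambda>u. C u y) x = (\<integral>z. indicator {..<y} z *\<^sub>R (S x z * C z y) \<partial>lborel)"
          unfolding integral_op_def by (subst integral_restrict_space) auto
        also have "\<dots> = kcomp S C x y"
          unfolding kcomp_def
        proof (rule integral_cong_AE)
          show "AE z in lborel. indicator {..<y} z *\<^sub>R (S x z * C z y) = S x z * C z y"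
            using elim by eventually_elim (auto simp: indicator_def)
        qed measurable
        finally show "kcomp S C x y = integral_op (on {..<y}) S (\<lambda>u. C u y) x" by simp
      qed
    qed
    then have "AE y in lborel. (AE x in lborel. x < y \<longrightarrow> ?D x y = 0) =
        (AE x in on {..<y}. C x y + integral_op (on {..<y}) S (\<lambda>u. C u y) x = - S x y)"
    proof eventually_elim
      case (elim y)
      then show ?case
        unfolding AE_below_iff by (simp add: eq_neg_iff_add_eq_0)
    qed
    then show ?thesis by (auto elim: eventually_elim2)
  qed
  finally show ?thesis .
qed

lemma L2_space_on: "f \<in> L2_space lborel \<Longrightarrow> \<Omega> \<in> sets borel \<Longrightarrow> f \<in> L2_space (on \<Omega>)"
  using L2_space_indicator_mult[of f lborel \<Omega>] by (simp add: L2_space_on_iff)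

lemma (in region) inverse_column_iff:
  assumes T: "represents T m" and inv: "is_inverse_op (on \<Omega>) T R"
    and h: "h \<in> L2_space (on \<Omega>)" and f: "f \<in> L2_space (on \<Omega>)"
  shows "(AE x in on \<Omega>. h x = R f x) \<longleftrightarrow> (AE x in on \<Omega>. T h x = f x)"
proof
  assume eq: "AE x in on \<Omega>. h x = R f x"
  have Rf: "R f \<in> L2_space (on \<Omega>)" using inv f by (simp add: is_inverse_op_def bounded_op_def)
  have "emb \<Omega> h = emb \<Omega> (R f)" using eq by (simp add: emb_eq_iff[OF h Rf])
  then have "emb \<Omega> (T h) = emb \<Omega> (T (R f))"
    by (simp only: representsD(2)[OF T h] representsD(2)[OF T Rf])
  then have "AE x in on \<Omega>. T h x = T (R f) x"
    by (simp only: emb_eq_iff[OF representsD(1)[OF T h] representsD(1)[OF T Rf]])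
  moreover have "AE x in on \<Omega>. T (R f) x = f x" using inv f by (simp add: is_inverse_op_def)
  ultimately show "AE x in on \<Omega>. T h x = f x" by eventually_elim simp
next
  assume "AE x in on \<Omega>. T h x = f x"
  then show "AE x in on \<Omega>. h x = R f x" by (rule inverse_apply[OF inv T h f])
qed

section \<open>Columns of C_+ and the inverses on half-lines\<close>

context
  fixes b :: hs and S :: "real kernel"
  assumes b: "adj b = b" and S: "L2k S" and cls_S: "cls S = vec (exp (Unitz 0 b))"
begin

lemma adj_cls_S: "adj (cls S) = cls S"
  using uadj_exp[OF b] by (simp add: cls_S uadj_def unitz_eq_iff)

lemma half_line_represents:
  "region.represents {..<y} (integral_op (on {..<y}) S) (Unitz 0 (box {..<y} (cls S)))"
proof -
  interpret region "{..<y}" by unfold_locales simp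
  show ?thesis by (rule represents_integral_op[OF S])
qed

text \<open>An inverse has to be exhibited for the choice in \<open>inverse_op\<close> to succeed:
  the kernel cut to the square stays self-adjoint and coercive, and its resolvent is 1 plus an
  integral operator.\<close>

lemma half_line_inverse:
  "is_inverse_op (on {..<y}) (id_plus (integral_op (on {..<y}) S)) (inverse_op (on {..<y}) (id_plus (integral_op (on {..<y}) S)))"
proof -
  interpret region "{..<y}" by unfold_locales simp
  have "adj (box {..<y} (cls S)) = box {..<y} (cls S)" by (simp add: adj_box adj_cls_S)
  from resolvent_exists[OF this box_box exp_gt_zero coercive_box[OF b cls_S]]
  obtain r where r: "box {..<y} r = r" "(1 + Unitz 0 (box {..<y} (cls S))) * (1 + Unitz 0 r) = 1"
    "(1 + Unitz 0 r) * (1 + Unitz 0 (box {..<y} (cls S))) = 1" by blast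
  have "represents (id_plus (integral_op (on {..<y}) (ker r))) (1 + Unitz 0 r)"
    using represents_id_plus[OF represents_vec[of "Unitz 0 r"]] r(1) by simp
  from is_inverse_op_if_represents[OF represents_id_plus[OF half_line_represents] this r(2,3)]
  show ?thesis unfolding inverse_op_def
    by (rule someI[where P = "is_inverse_op (on {..<y}) (id_plus (integral_op (on {..<y}) S))"])
qed

lemma half_line_det2:
  assumes "orthonormal_basis (lborel :: real measure) e"
  shows "det2 (on {..<y}) (integral_op (on {..<y}) S) \<noteq> 0"
proof -
  interpret region "{..<y}" by unfold_locales simp
  show ?thesis
    by (rule det2_nonzero[OF half_line_represents _ box_box exp_gt_zero coercive_box[OF b cls_S]
        orthonormal_basis_half_line[OF assms]])
      (simp add: adj_box adj_cls_S)
qed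

lemma inverse_column:
  assumes C: "L2k C"
  shows "AE y in lborel. (AE x in on {..<y}. C x y =
        - inverse_op (on {..<y}) (id_plus (integral_op (on {..<y}) S)) (\<lambda>u. S u y) x) \<longleftrightarrow>
      (AE x in on {..<y}. C x y + integral_op (on {..<y}) S (\<lambda>u. C u y) x = - S x y)"
  using L2k_section[OF L2k_swap[OF S]] L2k_section[OF L2k_swap[OF C]]
proof eventually_elim
  case (elim y)
  interpret region "{..<y}" by unfold_locales simp
  let ?A = "integral_op (on {..<y}) S"
  have f: "(\<lambda>u. S u y) \<in> L2_space (on {..<y})" by (rule L2_space_on[OF elim(1)]) simp
  have h: "(\<lambda>u. - C u y) \<in> L2_space (on {..<y})" by (intro L2_space_uminus L2_space_on[OF elim(2)]) simp
  have "?A (\<lambda>u. - C u y) x = - ?A (\<lambda>u. C u y) x" for x by (simp add: integral_op_def)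
  then have T: "id_plus ?A (\<lambda>u. - C u y) x = S x y \<longleftrightarrow> C x y + ?A (\<lambda>u. C u y) x = - S x y" for x
    unfolding id_plus_def by (simp only:) linarith
  have N: "C x y = - R \<longleftrightarrow> - C x y = R" for x R by linarith
  show ?case
    unfolding N inverse_column_iff[OF represents_id_plus[OF half_line_represents] half_line_inverse h f] T ..
qed

text \<open>Existence of C_+ and its uniqueness as a class are hereby reduced to those of
  \<open>cplus\<close>, with no inverse depending on y left.\<close>

lemma is_C_plus_iff:
  "is_C_plus S C \<longleftrightarrow> L2k C \<and> up (cls C) = cls C \<and> cls C + up (cls S * cls C) = - up (cls S)"
proof (cases "L2k C \<and> up (cls C) = cls C")
  case True
  then have C: "L2k C" "up (cls C) = cls C" by auto
  have "(AE y in lborel. AE x in on {..<y}. C x y =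
        - inverse_op (on {..<y}) (id_plus (integral_op (on {..<y}) S)) (\<lambda>u. S u y) x) \<longleftrightarrow>
      (AE y in lborel. AE x in on {..<y}. C x y + integral_op (on {..<y}) S (\<lambda>u. C u y) x = - S x y)"
    using inverse_column[OF C(1)] by (auto elim: eventually_elim2)
  then show ?thesis
    unfolding is_C_plus_def below_def upper_equation_iff[OF S C] using C up_cls_iff[OF C(1)] by simp
next
  case False
  then show ?thesis
    unfolding is_C_plus_def using up_cls_iff by blast
qed

text \<open>With R the inverse of 1 + A one has R f = f - A R f, and - A R f is D2 f divided by the
  determinant, which does not vanish.\<close>

lemma D2_column:
  assumes basis: "orthonormal_basis (lborel :: real measure) e" and C: "is_C_plus S C"
  shows "AE y in lborel. AE x in on {..<y}. C x y =
    - (S x y + D2 (on {..<y}) (integral_op (on {..<y}) S) (\<lambda>u. S u y) x / det2 (on {..<y}) (integral_op (on {..<y}) S))"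
proof -
  have "AE y in lborel. AE x in on {..<y}. C x y =
      - inverse_op (on {..<y}) (id_plus (integral_op (on {..<y}) S)) (\<lambda>u. S u y) x"
    using C unfolding is_C_plus_def below_def by blast
  with L2k_section[OF L2k_swap[OF S]] show ?thesis
  proof eventually_elim
    case (elim y)
    let ?A = "integral_op (on {..<y}) S" and ?f = "\<lambda>u. S u y"
    let ?R = "inverse_op (on {..<y}) (id_plus ?A)"
    have f: "?f \<in> L2_space (on {..<y})"
      by (rule L2_space_on[OF elim(1)]) simp
    have "AE x in on {..<y}. id_plus ?A (?R ?f) x = ?f x"
      using half_line_inverse f by (simp add: is_inverse_op_def)
    with elim(2) show ?case
      by eventually_elim (use half_line_det2[OF basis, of y] in \<open>simp add: D2_def id_plus_def\<close>)
  qed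
qed

end

theorem mainTheorem3:
  fixes K0 :: "real fop" and K :: "real kernel"
  assumes "hilbert_schmidt lborel K0"
    and "self_adjoint_op lborel K0"
    and "has_kernel lborel K0 K"
  shows
    "(\<forall>t. hilbert_schmidt lborel (S_op K0 t)) \<and>
     (\<exists>S. \<forall>t. has_kernel lborel (S_op K0 t) (S t)) \<and>
     (\<forall>S. (\<forall>t. has_kernel lborel (S_op K0 t) (S t)) \<longrightarrow>
        (\<forall>t y. invertible_op (below y) (id_plus (integral_op (below y) (S t))) \<and>
               det2 (below y) (integral_op (below y) (S t)) \<noteq> 0) \<and>
        (\<exists>C. \<forall>t. is_C_plus (S t) (C t)) \<and>
        (\<forall>C. (\<forall>t. is_C_plus (S t) (C t)) \<longrightarrow>
          (\<forall>t. AE y in lborel. AE x in below y.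
             C t x y = - (S t x y + D2 (below y) (integral_op (below y) (S t)) (\<lambda>u. S t u y) x
                                    / det2 (below y) (integral_op (below y) (S t)))) \<and>
          solves_flow UNIV K (\<lambda>t. solution_formula K (S t) (C t)) \<and>
          (\<forall>J L. is_interval J \<longrightarrow> 0 \<in> J \<longrightarrow> solves_flow J K L \<longrightarrow>
            (\<forall>t\<in>J. AE (\<xi>, \<eta>) in lborel \<Otimes>\<^sub>M lborel.
               L t \<xi> \<eta> = solution_formula K (S t) (C t) \<xi> \<eta>))))"
proof -
  interpret W: region UNIV by unfold_locales simp
  \<comment> \<open>This basis serves three purposes: uniqueness of kernels, the Hilbert-Schmidt
    property of S(t) and, transported to half-lines, the determinants.\<close>
  obtain e where e: "orthonormal_basis (lborel :: real measure) e"
    using assms(1) unfolding hilbert_schmidt_def by blast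
  have eL: "e i \<in> L2_space lborel" and e_on: "L2_inner lborel (e i) (e j) = (if i = j then 1 else 0)" for i j
    using e by (auto simp: orthonormal_basis_def)
  have K: "L2k K" using assms(3) by (simp add: has_kernel_def)
  define k0 where "k0 = cls K"
  have box_UNIV: "box UNIV x = x" for x by (simp add: box_def)
  have K0L: "K0 f \<in> L2_space lborel" if "f \<in> L2_space lborel" for f
    using assms(1) that by (simp add: hilbert_schmidt_def bounded_op_def)
  have int_op: "W.represents (integral_op lborel A) (Unitz 0 (cls A))" if "L2k A" for A
    using W.represents_integral_op[OF that] by (simp add: on_UNIV box_UNIV)
  have K0: "W.represents K0 (Unitz 0 k0)"
    unfolding k0_def
    by (rule W.represents_cong_AE[unfolded on_UNIV, OF int_op[OF K]])
      (use K0L assms(3) in \<open>simp_all add: has_kernel_def\<close>)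
  note rep = W.representsD[unfolded on_UNIV] and emb_eq = W.emb_eq_iff[unfolded on_UNIV]
    and inner_emb = W.inner_emb[unfolded on_UNIV] and norm_emb = W.norm_emb[unfolded on_UNIV]
  have act0: "act (Unitz 0 a) x = a * x" for a x by (simp add: act_def)

  \<comment> \<open>Self-adjointness passes from the operator to the kernel: for g = (K - K^T) f it
    gives <K f, g> = <K^T f, g>, that is |g|^2 = 0.\<close>
  have "cls K = cls (\<lambda>x y. K y x)"
  proof (rule kernel_unique[OF K L2k_swap[OF K] e])
    fix f :: "real \<Rightarrow> real" assume f: "f \<in> L2_space lborel"
    let ?g = "\<lambda>x. integral_op lborel K f x - integral_op lborel (\<lambda>x y. K y x) f x"
    note I1 = rep[OF int_op[OF K]] and I2 = rep[OF int_op[OF L2k_swap[OF K]]]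
    have g: "?g \<in> L2_space lborel" by (intro L2_space_diff I1(1) I2(1) f)
    have "L2_inner lborel (K0 f) ?g = L2_inner lborel f (K0 ?g)"
      using assms(2) f g by (simp add: self_adjoint_op_def)
    then have "(k0 * emb UNIV f) \<bullet> emb UNIV ?g = emb UNIV f \<bullet> (k0 * emb UNIV ?g)"
      using inner_emb[OF K0L[OF f] g] inner_emb[OF f K0L[OF g]] rep(2)[OF K0 f] rep(2)[OF K0 g]
      by (simp only: act0)
    then have "(k0 * emb UNIV f) \<bullet> emb UNIV ?g = (adj k0 * emb UNIV f) \<bullet> emb UNIV ?g"
      by (simp add: inner_mult_left)
    moreover have "emb UNIV ?g = k0 * emb UNIV f - adj k0 * emb UNIV f"
      using W.emb_diff[unfolded on_UNIV, OF I1(1)[OF f] I2(1)[OF f]] I1(2)[OF f] I2(2)[OF f]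
      by (simp only: act0 k0_def adj_cls[OF K])
    ultimately have "emb UNIV ?g \<bullet> emb UNIV ?g = 0" by (simp add: inner_diff_left)
    then have "L2_inner lborel ?g ?g = 0" using inner_emb[OF g g] by simp
    then show "AE x in lborel. integral_op lborel K f x = integral_op lborel (\<lambda>x y. K y x) f x"
      using L2_inner_self_eq_0_iff[OF g] by simp
  qed
  then have "adj k0 = k0" unfolding k0_def adj_cls[OF K] by (rule sym)
  then interpret F: kernel_flow k0 by unfold_locales

  have S_rep: "W.represents (S_op K0 t) (Unitz 0 (F.s t))" for t
  proof -
    have "W.represents (\<lambda>g u. - t * K0 g u) (Unitz 0 (- t *\<^sub>R k0))"
      using W.represents_scale[OF K0, of "- t"] by (simp add: scaleR_unitz_def)
    from W.represents_exp_op[OF this box_UNIV]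
    have "W.represents (S_op K0 t) (exp (Unitz 0 (- t *\<^sub>R k0)) - 1)"
      unfolding S_op_def[abs_def] on_UNIV by (rule W.represents_diff_id)
    moreover have "exp (Unitz 0 (- t *\<^sub>R k0)) - 1 = Unitz 0 (F.s t)"
      by (simp add: unitz_eq_iff F.s_eq scal_exp)
    ultimately show ?thesis by simp
  qed
  have hs_S: "hilbert_schmidt lborel (S_op K0 t)" for t
    unfolding hilbert_schmidt_def
  proof (intro conjI exI)
    show "bounded_op lborel (S_op K0 t)"
      using W.bounded_op_if_represents[OF S_rep] by (simp add: on_UNIV)
    show "orthonormal_basis lborel e" by (rule e)
    have "summable (\<lambda>i. (norm (F.s t * emb UNIV (e i)))\<^sup>2)"
      by (rule W.bessel[unfolded on_UNIV]) (rule eL, rule e_on)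
    moreover have "norm (F.s t * emb UNIV (e i)) = L2_norm lborel (S_op K0 t (e i))" for i
      unfolding norm_emb[OF rep(1)[OF S_rep eL], symmetric] rep(2)[OF S_rep eL] act0 ..
    ultimately show "summable (\<lambda>i. (L2_norm lborel (S_op K0 t (e i)))\<^sup>2)" by simp
  qed
  have ker_S: "has_kernel lborel (S_op K0 t) (ker (F.s t))" for t
    unfolding has_kernel_def
  proof (intro conjI ballI L2k_ker)
    fix f :: "real \<Rightarrow> real" assume f: "f \<in> L2_space lborel"
    note I = rep[OF int_op[OF L2k_ker] f, unfolded cls_ker]
    have "emb UNIV (S_op K0 t f) = emb UNIV (integral_op lborel (ker (F.s t)) f)"
      by (simp only: rep(2)[OF S_rep f] I(2))
    then show "AE x in lborel. S_op K0 t f x = integral_op lborel (ker (F.s t)) f x"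
      by (simp only: emb_eq[OF rep(1)[OF S_rep f] I(1)])
  qed

  show ?thesis
  proof (intro conjI allI impI)
    show "hilbert_schmidt lborel (S_op K0 t)" for t by (rule hs_S)
    show "\<exists>S. \<forall>t. has_kernel lborel (S_op K0 t) (S t)" using ker_S by (intro exI allI)
    fix S assume S: "\<forall>t. has_kernel lborel (S_op K0 t) (S t)"
    then have SL: "L2k (S t)" for t by (simp add: has_kernel_def)
    have cls_S: "cls (S t) = F.s t" for t
    proof -
      have "cls (S t) = cls (ker (F.s t))"
      proof (rule kernel_unique[OF SL L2k_ker e])
        fix f :: "real \<Rightarrow> real" assume f: "f \<in> L2_space lborel"
        have "AE x in lborel. S_op K0 t f x = integral_op lborel (S t) f x"
          "AE x in lborel. S_op K0 t f x = integral_op lborel (ker (F.s t)) f x"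
          using S ker_S[of t] f by (simp_all add: has_kernel_def)
        then show "AE x in lborel. integral_op lborel (S t) f x = integral_op lborel (ker (F.s t)) f x"
          by eventually_elim simp
      qed
      then show ?thesis by simp
    qed
    note cls_S' = trans[OF cls_S F.s_eq]
    note half = F.adj_tk0 SL cls_S'
    show "invertible_op (below y) (id_plus (integral_op (below y) (S t)))" for t y
      unfolding invertible_op_def below_def using half_line_inverse[OF half] by blast
    show "det2 (below y) (integral_op (below y) (S t)) \<noteq> 0" for t y
      unfolding below_def by (rule half_line_det2[OF half e])
    \<comment> \<open>Every admissible C(t) lies in the class \<open>F.c t\<close>, so the solution
      formula does not depend on the representatives taken for S and C.\<close>
    have C_iff: "is_C_plus (S t) C \<longleftrightarrow> L2k C \<and> cls C = F.c t" for t C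
      unfolding is_C_plus_iff[OF half] cls_S
      using F.c_unique[of "cls C" t] F.up_c[of t] F.c_eq[of t] by metis
    have "is_C_plus (S t) (ker (F.c t))" for t by (simp add: C_iff)
    then show "\<exists>C. \<forall>t. is_C_plus (S t) (C t)" by (intro exI allI)
    fix C assume "\<forall>t. is_C_plus (S t) (C t)"
    then have Cp: "is_C_plus (S t) (C t)" for t by blast
    then have C: "L2k (C t)" "cls (C t) = F.c t" for t by (simp_all add: C_iff)
    show "AE y in lborel. AE x in below y.
        C t x y = - (S t x y + D2 (below y) (integral_op (below y) (S t)) (\<lambda>u. S t u y) x
          / det2 (below y) (integral_op (below y) (S t)))" for t
      unfolding below_def by (rule D2_column[OF half e Cp])
    have sol: "L2k (solution_formula K (S t) (C t))" "cls (solution_formula K (S t) (C t)) = F.k t" for t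
      using solution_formula_cls[OF K SL C(1), of t t]
      by (simp_all add: cls_S C(2) F.lo_s_sc F.k_def flip: k0_def)
    show "solves_flow UNIV K (\<lambda>t. solution_formula K (S t) (C t))"
      unfolding solves_flow_iff[OF K UNIV_I] sol(2) by (simp add: sol(1) F.k_deriv F.k_0 k0_def[symmetric])
    show "\<forall>t\<in>J. AE (\<xi>, \<eta>) in lborel \<Otimes>\<^sub>M lborel. L t \<xi> \<eta> = solution_formula K (S t) (C t) \<xi> \<eta>"
      if J: "is_interval J" "0 \<in> J" and L: "solves_flow J K L" for J L
    proof
      fix t assume t: "t \<in> J"
      note L' = L[unfolded solves_flow_iff[OF K J(2)]]
      \<comment> \<open>The formula is a solution for all times; restricted to \<open>J\<close> it
        is compared with \<open>L\<close>.\<close>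
      have "cls (L t) = F.k t"
      proof (rule flow_unique[OF J t])
        show "cls (L 0) = F.k 0" unfolding F.k_0 unfolding k0_def using L' by blast
        show "((\<lambda>t. cls (L t)) has_vector_derivative flow_field (cls (L u))) (at u within J)" if "u \<in> J" for u
          using L' that by blast
        show "(F.k has_vector_derivative flow_field (F.k u)) (at u within J)" for u
          by (rule has_vector_derivative_at_within[OF F.k_deriv])
      qed
      then have "cls (L t) = cls (solution_formula K (S t) (C t))" by (simp only: sol(2))
      moreover have "L2k (L t)" using L' t by blast
      ultimately show "AE (\<xi>, \<eta>) in lborel \<Otimes>\<^sub>M lborel. L t \<xi> \<eta> = solution_formula K (S t) (C t) \<xi> \<eta>"
        using cls_eq_iff[OF _ sol(1)] by blast
    qed
  qed
qed

end
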